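(* Let $\alpha>2$ and let $(X_k)_{k\ge1}$ be i.i.d. real random variables with unit variance and symmetric density $f(x)=(1+|x|)^{-(\alpha+1)}L(|x|)$, $x\in\mathbb R$, where $L$ is slowly varying at infinity, bounded, differentiable and satisfies $L'(x)=o(L(x)/x)$ as $x\to\infty$. Let $\phi(\theta)=Ee^{i\theta X_k}$ and assume $\int_{-\infty}^\infty|\phi(\theta)|\,d\theta<\infty$. Let $S_n=X_1+\dots+X_n$ and let $f_{S_n/n^{1/2}}$ be the density of $S_n/n^{1/2}$. Then for each fixed $x\in\mathbb R$, as $n\to\infty$, $$f_{S_n/n^{1/2}}(x)=\eta(x)\Big[1+\sum_{\substack{3\le j<\alpha\\ j\text{ even}}}\frac{G_j(x)}{n^{j/2-1}}\Big]+\begin{cases}\dfrac{L(n^{1/2}|x|)}{n^{\alpha/2-1}}G_\alpha(x)+o\Big(\dfrac{L(n^{1/2}|x|)}{n^{\alpha/2-1}}\Big)&\text{if }\alpha\text{ is not an even integer},\\[2ex]\dfrac{\zeta_L(n^{1/2}|x|)}{n^{\alpha/2-1}}G_\alpha(x)+o\Big(\dfrac{\zeta_L(n^{1/2}|x|)}{n^{\alpha/2-1}}\Big)&\text{if }\alpha\text{ is an even integer},\end{cases}$$ where $G_j$ ($j<\alpha$) are the ordinary Edgeworth coefficients and $$G_\alpha(x)=\begin{cases}-\dfrac{\sqrt2}{\Gamma(\alpha+1)}\dfrac{d^\alpha}{dx^\alpha}D\big(\tfrac{x}{\sqrt2}\big)&\text{if }\alpha\text{ is an odd integer},\\[1.5ex]-\sqrt{\dfrac{\pi}{2}}\,\dfrac{e^{-x^2/4}}{\Gamma(\alpha+1)\sin(\alpha\pi)}\big[D_\alpha(x)+D_\alpha(-x)\big]&\text{if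 }\alpha\text{ is not an integer},\\[1.5ex]\sqrt{\dfrac{2}{\pi}}\,\dfrac{e^{-x^2/2}}{\Gamma(\alpha+1)}H_\alpha(x)&\text{if }\alpha\text{ is an even integer}.\end{cases}$$
   Context: A function $L$ is slowly varying at infinity if $L(ct)/L(t)\to1$ as $t\to\infty$ for every $c>0$. For such $L$, $\zeta_L(x)=\int_1^x \frac{L(u)}{u}\,du$. $\eta(x)=e^{-x^2/2}/\sqrt{2\pi}$. $H_k$ is the $k$-th (probabilists') Hermite polynomial, defined by $\frac{d^k}{dx^k}\eta(x)=(-1)^kH_k(x)\eta(x)$. Dawson's integral is $D(z)=e^{-z^2}\int_0^z e^{t^2}\,dt$. The classical parabolic cylinder function with parameter $\nu$, $\mathrm{Re}(\nu)>-1$, is $$D_\nu(z)=\sqrt{\tfrac{2}{\pi}}\,e^{z^2/4}\int_0^\infty e^{-t^2/2}t^\nu\cos\big(zt-\tfrac{\nu\pi}{2}\big)\,dt.$$ The notation $\frac{d^\alpha}{dx^\alpha}D(\frac{x}{\sqrt2})$ means the $\alpha$-th derivative of $x\mapsto D(x/\sqrt2)$. Ordinary Edgeworth coefficients: let $\kappa_l$ be the $l$-th cumulant of $X_k$. For an integer $3\le j<\alpha$ let $\xi_{k,j}(\theta)$ be the coefficient of $n^{-(j/2-1)}$ in the expansion of $\big(\sum_{l=3}^{j}\frac{\kappa_l(i\theta)^l}{l!\,n^{l/2-1}}\big)^k$ in powers of $n^{-1/2}$. Then $G_j$ is the polynomial defined by $$\eta(x)G_j(x)=\frac1{2\pi}\int_{-\infty}^\infty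 e^{-i\theta x-\theta^2/2}\sum_{k=1}^{j}\frac1{k!}\xi_{k,j}(\theta)\,d\theta,$$ i.e. $G_j$ is obtained from $\sum_{k=1}^j\frac{1}{k!}\xi_{k,j}(\theta)$ by replacing each $(i\theta)^l$ by $H_l(x)$.
   Formalization: For even α it is also assumed that ζ_L(t)→∞ (if ζ_L is bounded the formula fails, e.g. α=4, where κ_4<2ζ_L(∞)); at x=0 the argument n^{1/2}|x| of L and ζ_L is replaced by n^{1/2}, since L(0) is unrelated to the tail and ζ_L(0) may diverge. *)

theory Defs
  imports
    "HOL-Probability.Probability"
    "HOL-Library.Landau_Symbols"
    "HOL-Computational_Algebra.Polynomial"
begin

definition slowly_varying :: "(real \<Rightarrow> real) \<Rightarrow> bool" where
  "slowly_varying L \<longleftrightarrow> (\<forall>c>0. ((\<lambda>t. L (c * t) / L t) \<longlongrightarrow> 1) at_top)"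

(* The interval integral is oriented, so this is also the right value for 0 < x < 1. *)
definition zeta_sv :: "(real \<Rightarrow> real) \<Rightarrow> real \<Rightarrow> real" where
  "zeta_sv L x = (LBINT u=ereal 1..ereal x. L u / u)"

definition eta :: "real \<Rightarrow> real" where
  "eta x = exp (- x\<^sup>2 / 2) / sqrt (2 * pi)"

definition hermite :: "nat \<Rightarrow> real \<Rightarrow> real" where
  "hermite k x = (-1) ^ k * (deriv ^^ k) eta x / eta x"

(* Oriented integral: negative z is allowed. *)
definition dawson :: "real \<Rightarrow> real" where
  "dawson z = exp (- z\<^sup>2) * (LBINT t=ereal 0..ereal z. exp (t\<^sup>2))"

(* Real order and argument only; the integral representation requires nu > -1. *)
definition parabolic_cylinder :: "real \<Rightarrow> real \<Rightarrow> real" where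
  "parabolic_cylinder nu z =
     sqrt (2 / pi) * exp (z\<^sup>2 / 4) *
     (LBINT t:{0<..}. exp (- t\<^sup>2 / 2) * t powr nu * cos (z * t - nu * pi / 2))"

(* The l-th cumulant of a distribution: i^(-l) times the l-th derivative at 0 of the logarithm of
   its characteristic function. It is meant for distributions with a finite l-th absolute moment;
   there this value is real, and Re only changes the type. The principal branch Ln is the right
   one because the characteristic function is continuous with value 1 at 0. *)
definition cumulant :: "real measure \<Rightarrow> nat \<Rightarrow> real" where
  "cumulant D l =
     Re (((\<lambda>h \<theta>. vector_derivative h (at \<theta>)) ^^ l) (\<lambda>\<theta>. Ln (char D \<theta>)) 0 / \<i> ^ l)"

(* With h = n^(-1/2), n^(l/2-1) in the denominator becomes h^(l-2), and the coefficient of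
   n^(-(j/2-1)) is the coefficient of h^(j-2). *)
definition edgeworth_xi :: "(nat \<Rightarrow> real) \<Rightarrow> nat \<Rightarrow> nat \<Rightarrow> real \<Rightarrow> complex" where
  "edgeworth_xi \<kappa> k j \<theta> =
     poly.coeff
       ((\<Sum>l=3..j. monom (of_real (\<kappa> l) * (\<i> * of_real \<theta>) ^ l / fact l) (l - 2)) ^ k)
       (j - 2)"

(* The inverse Fourier integral is real, since edgeworth_xi is a polynomial in i\<theta> with real
   coefficients; Re only changes the type. *)
definition edgeworth_G :: "(nat \<Rightarrow> real) \<Rightarrow> nat \<Rightarrow> real \<Rightarrow> real" where
  "edgeworth_G \<kappa> j x =
     Re (1 / (2 * of_real pi) *
         (LBINT \<theta>. exp (- \<i> * of_real (\<theta> * x) - of_real (\<theta>\<^sup>2 / 2)) *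
            (\<Sum>k=1..j. edgeworth_xi \<kappa> k j \<theta> / fact k))) / eta x"

definition edgeworth_sum :: "(nat \<Rightarrow> real) \<Rightarrow> real \<Rightarrow> nat \<Rightarrow> real \<Rightarrow> real" where
  "edgeworth_sum \<kappa> \<alpha> n x =
     eta x * (1 + (\<Sum>j | 3 \<le> j \<and> real j < \<alpha> \<and> even j.
                     edgeworth_G \<kappa> j x / real n powr (real j / 2 - 1)))"

definition even_integer :: "real \<Rightarrow> bool" where
  "even_integer \<alpha> \<longleftrightarrow> (\<exists>m::int. even m \<and> \<alpha> = of_int m)"

definition odd_integer :: "real \<Rightarrow> bool" where
  "odd_integer \<alpha> \<longleftrightarrow> (\<exists>m::int. odd m \<and> \<alpha> = of_int m)"

(* The coefficient of the heavy-tail correction; it is not multiplied by the factor eta. *)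
definition heavy_G :: "real \<Rightarrow> real \<Rightarrow> real" where
  "heavy_G \<alpha> x =
     (if odd_integer \<alpha> then
        - sqrt 2 / Gamma (\<alpha> + 1) * (deriv ^^ nat \<lfloor>\<alpha>\<rfloor>) (\<lambda>y. dawson (y / sqrt 2)) x
      else if even_integer \<alpha> then
        sqrt (2 / pi) * exp (- x\<^sup>2 / 2) / Gamma (\<alpha> + 1) * hermite (nat \<lfloor>\<alpha>\<rfloor>) x
      else
        - sqrt (pi / 2) * exp (- x\<^sup>2 / 4) / (Gamma (\<alpha> + 1) * sin (\<alpha> * pi)) *
          (parabolic_cylinder \<alpha> x + parabolic_cylinder \<alpha> (- x)))"

(* The argument sqrt n * |x| of the slowly varying functions. For x = 0 it would be constant in n,
   and the scale sqrt n is used instead. For every x \<noteq> 0 the two arguments are interchangeable up to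
   a factor tending to 1, by slow variation. *)
definition sv_arg :: "nat \<Rightarrow> real \<Rightarrow> real" where
  "sv_arg n x = (if x = 0 then sqrt (real n) else sqrt (real n) * \<bar>x\<bar>)"

(* Densities are only determined almost everywhere. A pointwise statement about the density of Y
   is about its continuous version, which is unique. *)
definition continuous_density :: "'a measure \<Rightarrow> ('a \<Rightarrow> real) \<Rightarrow> (real \<Rightarrow> real) \<Rightarrow> bool" where
  "continuous_density M Y g \<longleftrightarrow>
     continuous_on UNIV g \<and> (\<forall>x. 0 \<le> g x) \<and> distributed M lborel Y (\<lambda>x. ennreal (g x))"

end

(* Taylor-expanding cos(t x) inside the characteristic function phi of the density f leaves, besides
   the polynomial coming from the finite even moments, the integral of the Taylor remainder of cos
   against the tail of f; rescaling by |t| shows that it is asymptotic to c |t|^alpha Lam(1/|t|),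
   where Lam is L, or zeta_L when alpha is an even integer (there the integral of L(u)/u from 1 to
   1/|t| dominates). The same holds for r = ln phi minus its cumulant polynomial. Hence, with
   h = n^(-1/2), phi(h t)^n = exp(-t^2/2) exp(A_h(t)) exp(n r(h t)), where exp(A_h) expands in powers
   of h into the ordinary Edgeworth terms and n r(h t) is asymptotic to
   c |t|^alpha n^(1 - alpha/2) Lam(1/h). Fourier inversion and dominated convergence, with Potter
   bounds for Lam, turn this into the expansion of the density. The Potter bounds are elementary:
   L' = o(L/x) makes x^d L(x) eventually increasing and x^(-d) L(x) eventually decreasing. *)

theory Submission
  imports Defs "HOL-Real_Asymp.Real_Asymp"
begin

text \<open>The three formulas for G_\<alpha> share one form: \<open>heavy_coeff\<close> \<alpha> /
  (2 pi) times \<open>gauss_cos\<close> \<alpha> x, the cosine transform of |t|^\<alpha>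
  exp(-t^2/2). Fourier inversion produces this form; the Dawson, parabolic cylinder and Hermite
  expressions are then identified with it. The integer N with 2 N < \<alpha> \<le> 2 N + 2 shapes
  the proof. The cosine minus its Taylor polynomial of degree 2 N is O(|u|^(2 N + 2)) at 0 and
  O(|u|^(2 N)) at infinity, so its integral against |u|^(-\<alpha> - 1) converges unless \<alpha> is
  the right endpoint. There, for even \<alpha>, the next Taylor term is split off: it yields zeta_L
  up to a bounded error, and zeta_L \<rightarrow> \<infinity> makes it dominate. Dominated
  convergence needs r twice on a fixed interval |u| \<le> e: the estimate |r(u)| \<le> u^2/8 leaves
  a Gaussian factor exp(-t^2/4), and |r(u)| \<le> const |u|^\<alpha> Lam(1/|u|) matches the
  normalisation. For |t| > e sqrt n the integrability of phi keeps |phi| below some q < 1, and that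
  region decays geometrically.\<close>

section \<open>Gaussian and trigonometric integrals\<close>

lemma power_div_fact_le_exp:
  fixes y :: real
  assumes "0 \<le> y"
  shows "y ^ n / fact n \<le> exp y"
proof -
  have "y ^ n / fact n = (\<Sum>k\<in>{n}. y ^ k / fact k)" by simp
  also have "\<dots> \<le> (\<Sum>k. y ^ k / fact k)"
    using assms summable_exp[of y] by (intro sum_le_suminf) (auto simp: divide_inverse mult.commute)
  also have "\<dots> = exp y"
    by (simp add: exp_def divide_inverse mult.commute)
  finally show ?thesis .
qed

text \<open>Reduces integrability of anything with a Gaussian factor and polynomial growth to that
  of 1 / (1 + t^2).\<close>

lemma poly_gauss_bound:
  fixes a :: real
  assumes "0 < a"
  shows "\<exists>C. \<forall>t::real. (1 + \<bar>t\<bar>) ^ n * exp (- a * t\<^sup>2) \<le> C * inverse (1 + t\<^sup>2)"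
proof (intro exI allI)
  fix t :: real
  \<comment> \<open>The two powers beyond n absorb the factor 1 + t^2. The exponential bounds exp (1
    + |t| - a t^2): completing the square puts the maximum at |t| = 1 / (2 a).\<close>
  let ?C = "fact (n + 2) * exp (1 + 1 / (4 * a))"
  have "(1 + \<bar>t\<bar>) ^ (n + 2) / fact (n + 2) \<le> exp (1 + \<bar>t\<bar>)"
    by (rule power_div_fact_le_exp) simp
  then have "(1 + \<bar>t\<bar>) ^ (n + 2) \<le> fact (n + 2) * exp (1 + \<bar>t\<bar>)"
    by (subst (asm) pos_divide_le_eq) (auto simp: mult.commute simp del: fact_Suc)
  then have "(1 + \<bar>t\<bar>) ^ (n + 2) * exp (- a * t\<^sup>2) \<le> fact (n + 2) * exp (1 + \<bar>t\<bar>) * exp (- a * t\<^sup>2)"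
    by (rule mult_right_mono) simp
  also have "\<dots> = fact (n + 2) * exp (1 + \<bar>t\<bar> - a * t\<^sup>2)"
    by (simp add: mult_exp_exp)
  also have "\<dots> \<le> ?C"
  proof -
    have "0 \<le> a * (\<bar>t\<bar> - 1 / (2 * a))\<^sup>2" using assms by simp
    also have "\<dots> = a * t\<^sup>2 - \<bar>t\<bar> + 1 / (4 * a)"
      using assms by (simp add: field_simps power2_eq_square)
    finally show ?thesis by (intro mult_left_mono) auto
  qed
  finally have 1: "(1 + \<bar>t\<bar>) ^ (n + 2) * exp (- a * t\<^sup>2) \<le> ?C" .
  have "(1 + t\<^sup>2) \<le> (1 + \<bar>t\<bar>) ^ 2"
    by (simp add: power2_eq_square algebra_simps)
  then have "(1 + \<bar>t\<bar>) ^ n * exp (- a * t\<^sup>2) * (1 + t\<^sup>2) \<le> (1 + \<bar>t\<bar>) ^ n * exp (- a * t\<^sup>2) * (1 + \<bar>t\<bar>) ^ 2"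
    by (intro mult_left_mono) auto
  also have "\<dots> = (1 + \<bar>t\<bar>) ^ (n + 2) * exp (- a * t\<^sup>2)"
    by (simp only: power_add mult_ac)
  also note 1
  finally show "(1 + \<bar>t\<bar>) ^ n * exp (- a * t\<^sup>2) \<le> ?C * inverse (1 + t\<^sup>2)"
    by (simp add: field_simps add_pos_nonneg del: fact_Suc)
qed

lemma integrable_inverse_1_plus_sq: "integrable lborel (\<lambda>x::real. inverse (1 + x\<^sup>2))"
  using integrable_inverse_1_plus_square by (simp add: set_integrable_def)

lemma integrable_poly_gauss:
  fixes g :: "real \<Rightarrow> 'b::{banach, second_countable_topology}"
  assumes [measurable]: "g \<in> borel_measurable borel"
    and a: "0 < a" and bd: "\<And>t. norm (g t) \<le> C * (1 + \<bar>t\<bar>) ^ n * exp (- a * t\<^sup>2)"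
  shows "integrable lborel g"
proof -
  obtain B where B: "\<And>t::real. (1 + \<bar>t\<bar>) ^ n * exp (- a * t\<^sup>2) \<le> B * inverse (1 + t\<^sup>2)"
    using poly_gauss_bound[OF a] by blast
  show ?thesis
  proof (rule Bochner_Integration.integrable_bound)
    show "integrable lborel (\<lambda>x::real. \<bar>C\<bar> * (B * inverse (1 + x\<^sup>2)))"
      by (intro integrable_mult_right integrable_inverse_1_plus_sq)
    show "AE t in lborel. norm (g t) \<le> norm (\<bar>C\<bar> * (B * inverse (1 + t\<^sup>2)))"
    proof (rule AE_I2)
      fix t :: real
      have "norm (g t) \<le> C * ((1 + \<bar>t\<bar>) ^ n * exp (- a * t\<^sup>2))" using bd[of t] by (simp add: mult.assoc)
      also have "\<dots> \<le> \<bar>C\<bar> * ((1 + \<bar>t\<bar>) ^ n * exp (- a * t\<^sup>2))" by (intro mult_right_mono) auto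
      also have "\<dots> \<le> \<bar>C\<bar> * (B * inverse (1 + t\<^sup>2))" by (intro mult_left_mono B) auto
      finally show "norm (g t) \<le> norm (\<bar>C\<bar> * (B * inverse (1 + t\<^sup>2)))" by simp
    qed
  qed simp
qed

lemma integral_even_real:
  fixes g :: "real \<Rightarrow> real"
  assumes int: "integrable lborel g" and even: "\<And>x. g (- x) = g x"
  shows "(\<integral>x. g x \<partial>lborel) = 2 * (\<integral>x. indicator {0<..} x * g x \<partial>lborel)"
proof -
  have i1: "integrable lborel (\<lambda>x. indicator {0<..} x * g x)"
    using integrable_mult_indicator[OF _ int, of "{0<..}"] by simp
  have i2: "integrable lborel (\<lambda>x. indicator {..<0} x * g x)"
    using integrable_mult_indicator[OF _ int, of "{..<0}"] by simp
  have "(\<integral>x. g x \<partial>lborel) = (\<integral>x. indicator {0<..} x * g x + indicator {..<0} x * g x \<partial>lborel)"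
  proof (rule integral_cong_AE)
    show "g \<in> borel_measurable lborel" using int by (rule borel_measurable_integrable)
    show "(\<lambda>x. indicator {0<..} x * g x + indicator {..<0} x * g x) \<in> borel_measurable lborel"
      by (intro borel_measurable_integrable Bochner_Integration.integrable_add i1 i2)
    show "AE x in lborel. g x = indicator {0<..} x * g x + indicator {..<0} x * g x"
      using AE_lborel_singleton[of "0::real"] by eventually_elim (auto simp: indicator_def)
  qed
  also have "\<dots> = (\<integral>x. indicator {0<..} x * g x \<partial>lborel) + (\<integral>x. indicator {..<0} x * g x \<partial>lborel)"
    by (rule Bochner_Integration.integral_add[OF i1 i2])
  also have "(\<integral>x. indicator {..<0} x * g x \<partial>lborel) = (\<integral>x. indicator {..<0} (-x) * g (-x) \<partial>lborel)"
    by (subst lborel_integral_real_affine[where c = "-1" and t = 0]) auto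
  also have "\<dots> = (\<integral>x. indicator {0<..} x * g x \<partial>lborel)"
    by (intro Bochner_Integration.integral_cong) (auto simp: indicator_def even)
  finally show ?thesis by simp
qed

text \<open>The phase k pi / 2 is what k differentiations in x add to a cosine, so this is the k-th
  derivative of the transform of w. The offset c = 0 gives cosine transforms and c = - pi / 2 gives
  sine transforms, which treats both at once.\<close>

definition trig_moment :: "(real \<Rightarrow> real) \<Rightarrow> real \<Rightarrow> nat \<Rightarrow> real \<Rightarrow> real" where
  "trig_moment w c k x = (\<integral>s. s ^ k * w s * cos (x * s + c + real k * pi / 2) \<partial>lborel)"

lemma integrable_trig_moment:
  fixes w :: "real \<Rightarrow> real" and x c :: real
  assumes "integrable lborel (\<lambda>s. s ^ k * w s)"
  shows "integrable lborel (\<lambda>s. s ^ k * w s * cos (x * s + c))"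
proof (rule Bochner_Integration.integrable_bound[OF assms])
  show "(\<lambda>s. s ^ k * w s * cos (x * s + c)) \<in> borel_measurable lborel"
    using borel_measurable_integrable[OF assms] by measurable
  show "AE s in lborel. norm (s ^ k * w s * cos (x * s + c)) \<le> norm (s ^ k * w s)"
    by (intro AE_I2) (auto simp: abs_mult intro!: mult_left_le)
qed

lemma abs_cos_diff_le: "\<bar>cos a - cos b\<bar> \<le> \<bar>a - b\<bar>" for a b :: real
proof -
  have "\<bar>cos a - cos b\<bar> = 2 * \<bar>sin ((a + b) / 2)\<bar> * \<bar>sin ((b - a) / 2)\<bar>"
    by (simp add: cos_diff_cos abs_mult)
  also have "\<dots> \<le> 2 * 1 * \<bar>(b - a) / 2\<bar>"
    by (intro mult_mono abs_sin_x_le_abs_x) auto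
  finally show ?thesis by simp
qed

text \<open>Differentiation under the integral sign. The cosine is 1-Lipschitz, so its difference
  quotients in x are at most |s| and \<open>s ^ Suc k * w s\<close> dominates; sequences replace the
  limit in x because dominated convergence is applied along them.\<close>

lemma trig_moment_has_derivative:
  assumes w0: "integrable lborel (\<lambda>s. s ^ k * w s)" and w1: "integrable lborel (\<lambda>s. s ^ Suc k * w s)"
  shows "(trig_moment w c k has_real_derivative trig_moment w c (Suc k) x) (at x)"
  unfolding has_field_derivative_iff tendsto_at_iff_sequentially
proof (intro allI impI)
  fix X :: "nat \<Rightarrow> real"
  assume X: "\<forall>i. X i \<in> UNIV - {x}" and lim: "X \<longlonglongrightarrow> x"
  let ?d = "c + real k * pi / 2"
  let ?q = "\<lambda>i s. s ^ k * w s * ((cos (X i * s + ?d) - cos (x * s + ?d)) / (X i - x))"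
  have i: "integrable lborel (\<lambda>s. s ^ k * w s * cos (y * s + ?d))" for y
    by (rule integrable_trig_moment[OF w0])
  have "(\<lambda>i. \<integral>s. ?q i s \<partial>lborel) \<longlonglongrightarrow> (\<integral>s. s ^ Suc k * w s * cos (x * s + c + real (Suc k) * pi / 2) \<partial>lborel)"
  proof (rule integral_dominated_convergence)
    show "(\<lambda>s. s ^ Suc k * w s * cos (x * s + c + real (Suc k) * pi / 2)) \<in> borel_measurable lborel"
      using borel_measurable_integrable[OF w1] by measurable
    show "?q i \<in> borel_measurable lborel" for i
      using borel_measurable_integrable[OF w0] by measurable
    show "integrable lborel (\<lambda>s. \<bar>s ^ Suc k * w s\<bar>)"
      using w1 by (rule integrable_abs)
    show "AE s in lborel. (\<lambda>i. ?q i s) \<longlonglongrightarrow> s ^ Suc k * w s * cos (x * s + c + real (Suc k) * pi / 2)"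
    proof (rule AE_I2)
      fix s
      have "((\<lambda>y. cos (y * s + ?d)) has_real_derivative - sin (x * s + ?d) * s) (at x)"
        by (auto intro!: derivative_eq_intros)
      then have "(\<lambda>i. (cos (X i * s + ?d) - cos (x * s + ?d)) / (X i - x)) \<longlonglongrightarrow> - sin (x * s + ?d) * s"
        using X lim unfolding has_field_derivative_iff tendsto_at_iff_sequentially by (auto simp: o_def)
      then have "(\<lambda>i. ?q i s) \<longlonglongrightarrow> s ^ k * w s * (- sin (x * s + ?d) * s)"
        by (intro tendsto_intros)
      moreover have "cos (x * s + c + real (Suc k) * pi / 2) = - sin (x * s + ?d)"
        using minus_sin_cos_eq[of "x * s + ?d"] by (simp add: field_simps)
      ultimately show "(\<lambda>i. ?q i s) \<longlonglongrightarrow> s ^ Suc k * w s * cos (x * s + c + real (Suc k) * pi / 2)"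
        by (simp add: mult_ac)
    qed
    show "AE s in lborel. norm (?q i s) \<le> \<bar>s ^ Suc k * w s\<bar>" for i
    proof (rule AE_I2)
      fix s
      have "X i - x \<noteq> 0" using X by auto
      moreover have "\<bar>cos (X i * s + ?d) - cos (x * s + ?d)\<bar> \<le> \<bar>s\<bar> * \<bar>X i - x\<bar>"
        using abs_cos_diff_le[of "X i * s + ?d" "x * s + ?d"] by (simp add: abs_mult[symmetric] algebra_simps)
      ultimately have "\<bar>(cos (X i * s + ?d) - cos (x * s + ?d)) / (X i - x)\<bar> \<le> \<bar>s\<bar>"
        by (simp add: abs_divide field_simps)
      then have "\<bar>s ^ k * w s\<bar> * \<bar>(cos (X i * s + ?d) - cos (x * s + ?d)) / (X i - x)\<bar> \<le> \<bar>s ^ k * w s\<bar> * \<bar>s\<bar>"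
        by (intro mult_left_mono) auto
      then show "norm (?q i s) \<le> \<bar>s ^ Suc k * w s\<bar>" by (simp add: abs_mult mult_ac)
    qed
  qed
  moreover have "(\<integral>s. ?q i s \<partial>lborel) = (trig_moment w c k (X i) - trig_moment w c k x) / (X i - x)" for i
  proof -
    have "(\<integral>s. ?q i s \<partial>lborel) = (\<integral>s. (s ^ k * w s * cos (X i * s + ?d) - s ^ k * w s * cos (x * s + ?d)) / (X i - x) \<partial>lborel)"
      by (intro Bochner_Integration.integral_cong) (auto simp: algebra_simps diff_divide_distrib)
    also have "\<dots> = ((\<integral>s. s ^ k * w s * cos (X i * s + ?d) \<partial>lborel) - (\<integral>s. s ^ k * w s * cos (x * s + ?d) \<partial>lborel)) / (X i - x)"
      using i by simp
    finally show ?thesis by (simp add: trig_moment_def add.assoc)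
  qed
  ultimately have "(\<lambda>i. (trig_moment w c k (X i) - trig_moment w c k x) / (X i - x)) \<longlonglongrightarrow> trig_moment w c (Suc k) x"
    unfolding trig_moment_def[of w c "Suc k"] by (simp only:)
  then show "((\<lambda>y. (trig_moment w c k y - trig_moment w c k x) / (y - x)) \<circ> X) \<longlonglongrightarrow> trig_moment w c (Suc k) x"
    by (simp add: o_def)
qed

lemma continuous_trig_moment:
  assumes w0: "integrable lborel (\<lambda>s. s ^ k * w s)"
  shows "isCont (trig_moment w c k) x"
  unfolding continuous_at_sequentially
proof (intro allI impI)
  fix X :: "nat \<Rightarrow> real" assume lim: "X \<longlonglongrightarrow> x"
  let ?d = "c + real k * pi / 2"
  have "(\<lambda>i. \<integral>s. s ^ k * w s * cos (X i * s + ?d) \<partial>lborel) \<longlonglongrightarrow> (\<integral>s. s ^ k * w s * cos (x * s + ?d) \<partial>lborel)"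
  proof (rule integral_dominated_convergence)
    show "integrable lborel (\<lambda>s. \<bar>s ^ k * w s\<bar>)" using w0 by (rule integrable_abs)
    show "AE s in lborel. (\<lambda>i. s ^ k * w s * cos (X i * s + ?d)) \<longlonglongrightarrow> s ^ k * w s * cos (x * s + ?d)"
      using lim by (intro AE_I2 tendsto_intros)
    show "AE s in lborel. norm (s ^ k * w s * cos (X i * s + ?d)) \<le> \<bar>s ^ k * w s\<bar>" for i
      by (intro AE_I2) (auto simp: abs_mult intro!: mult_left_le)
  qed (use borel_measurable_integrable[OF w0] in measurable)
  then show "(trig_moment w c k \<circ> X) \<longlonglongrightarrow> trig_moment w c k x"
    by (simp add: o_def trig_moment_def add.assoc)
qed

lemma deriv_funpow_trig_moment:
  assumes "\<And>k. k \<le> n \<Longrightarrow> integrable lborel (\<lambda>s. s ^ k * w s)"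
  shows "(deriv ^^ n) (trig_moment w c 0) = trig_moment w c n"
  using assms
proof (induction n)
  case (Suc n)
  then have "(deriv ^^ n) (trig_moment w c 0) = trig_moment w c n" by simp
  moreover have "deriv (trig_moment w c n) = trig_moment w c (Suc n)"
    by (intro ext DERIV_imp_deriv trig_moment_has_derivative Suc.prems) auto
  ultimately show ?case by simp
qed simp

section \<open>The coefficient of the heavy-tail correction\<close>

text \<open>2 pi times the inverse Fourier transform of |t|^a exp(-t^2/2), the shape in which the
  singular term of the characteristic function reaches the density.\<close>

definition gauss_cos :: "real \<Rightarrow> real \<Rightarrow> real" where
  "gauss_cos a x = (\<integral>t. \<bar>t\<bar> powr a * exp (- t\<^sup>2 / 2) * cos (x * t) \<partial>lborel)"

text \<open>The constant c in the asymptotics c |t|^a Lam(1/|t|) of the Taylor remainder of the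
  characteristic function. Off the even integers it is the value of \<open>cos_rem_integral\<close>.
  At an even integer the sine vanishes, and c is twice the coefficient of u^a in the cosine series,
  one copy for each tail.\<close>

definition heavy_coeff :: "real \<Rightarrow> real" where
  "heavy_coeff a = (if even_integer a then (-1) ^ (nat \<lfloor>a\<rfloor> div 2) * 2 / Gamma (a + 1)
     else - pi / (sin (pi * a / 2) * Gamma (a + 1)))"

lemma abs_powr_le_poly:
  fixes t a :: real
  assumes "0 \<le> a"
  shows "\<bar>t\<bar> powr a \<le> (1 + \<bar>t\<bar>) ^ nat \<lceil>a\<rceil>"
proof -
  have "\<bar>t\<bar> powr a \<le> (1 + \<bar>t\<bar>) powr a" using assms by (intro powr_mono2) auto
  also have "\<dots> \<le> (1 + \<bar>t\<bar>) powr real (nat \<lceil>a\<rceil>)"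
    using assms by (intro powr_mono) (auto simp: of_nat_nat)
  also have "\<dots> = (1 + \<bar>t\<bar>) ^ nat \<lceil>a\<rceil>" by (rule powr_realpow) simp
  finally show ?thesis .
qed

lemma integrable_gauss_cos:
  fixes a :: real
  assumes "0 \<le> a"
  shows "integrable lborel (\<lambda>t. \<bar>t\<bar> powr a * exp (- t\<^sup>2 / 2) * cos (x * t + c))"
proof (rule integrable_poly_gauss[where a = "1/2" and C = 1 and n = "nat \<lceil>a\<rceil>"])
  fix t :: real
  have "norm (\<bar>t\<bar> powr a * exp (- t\<^sup>2 / 2) * cos (x * t + c)) = \<bar>t\<bar> powr a * exp (- t\<^sup>2 / 2) * \<bar>cos (x * t + c)\<bar>"
    by (simp add: abs_mult)
  also have "\<dots> \<le> (1 + \<bar>t\<bar>) ^ nat \<lceil>a\<rceil> * exp (- t\<^sup>2 / 2) * 1"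
    using assms by (intro mult_mono abs_powr_le_poly) auto
  finally show "norm (\<bar>t\<bar> powr a * exp (- t\<^sup>2 / 2) * cos (x * t + c)) \<le> 1 * (1 + \<bar>t\<bar>) ^ nat \<lceil>a\<rceil> * exp (- (1/2) * t\<^sup>2)"
    by simp
qed auto

lemma gauss_cos_half:
  assumes "0 \<le> a"
  shows "gauss_cos a x = 2 * (\<integral>t. indicator {0<..} t * (t powr a * exp (- t\<^sup>2 / 2) * cos (x * t)) \<partial>lborel)"
proof -
  have "gauss_cos a x = 2 * (\<integral>t. indicator {0<..} t * (\<bar>t\<bar> powr a * exp (- t\<^sup>2 / 2) * cos (x * t)) \<partial>lborel)"
    unfolding gauss_cos_def using integrable_gauss_cos[OF assms, of x 0]
    by (intro integral_even_real) auto
  also have "(\<integral>t. indicator {0<..} t * (\<bar>t\<bar> powr a * exp (- t\<^sup>2 / 2) * cos (x * t)) \<partial>lborel)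
      = (\<integral>t. indicator {0<..} t * (t powr a * exp (- t\<^sup>2 / 2) * cos (x * t)) \<partial>lborel)"
    by (intro Bochner_Integration.integral_cong) (auto simp: indicator_def)
  finally show ?thesis .
qed

lemma integrable_half_gauss_moment:
  "integrable lborel (\<lambda>s::real. s ^ k * (indicator {0<..} s * exp (- s\<^sup>2 / 2)))"
proof (rule integrable_poly_gauss[where a = "1/2" and C = 1 and n = k])
  fix t :: real
  have "norm (t ^ k * (indicator {0<..} t * exp (- t\<^sup>2 / 2))) = \<bar>t\<bar> ^ k * (indicator {0<..} t * exp (- t\<^sup>2 / 2))"
    by (simp add: abs_mult power_abs)
  also have "\<dots> \<le> (1 + \<bar>t\<bar>) ^ k * (1 * exp (- t\<^sup>2 / 2))"
    by (intro mult_mono power_mono) (auto simp: indicator_def)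
  finally show "norm (t ^ k * (indicator {0<..} t * exp (- t\<^sup>2 / 2))) \<le> 1 * (1 + \<bar>t\<bar>) ^ k * exp (- (1/2) * t\<^sup>2)"
    by simp
qed auto

lemma integrable_gauss_moment:
  "integrable lborel (\<lambda>s::real. s ^ k * (exp (- s\<^sup>2 / 2) / c))"
proof (rule integrable_poly_gauss[where a = "1/2" and C = "1 / \<bar>c\<bar>" and n = k])
  fix t :: real
  have "norm (t ^ k * (exp (- t\<^sup>2 / 2) / c)) = \<bar>t\<bar> ^ k * (exp (- t\<^sup>2 / 2) / \<bar>c\<bar>)"
    by (simp add: abs_mult power_abs)
  also have "\<dots> \<le> (1 + \<bar>t\<bar>) ^ k * (exp (- t\<^sup>2 / 2) / \<bar>c\<bar>)"
    by (intro mult_right_mono power_mono) auto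
  finally show "norm (t ^ k * (exp (- t\<^sup>2 / 2) / c)) \<le> 1 / \<bar>c\<bar> * (1 + \<bar>t\<bar>) ^ k * exp (- (1/2) * t\<^sup>2)"
    by simp
qed auto

text \<open>The Gaussian is its own Fourier transform, read off from the characteristic function of
  the standard normal law. Derivatives of \<open>eta\<close> thereby become trigonometric
  moments.\<close>

lemma eta_eq_trig_moment: "eta = trig_moment (\<lambda>s. exp (- s\<^sup>2 / 2) / (2 * pi)) 0 0"
proof
  fix x :: real
  have "of_real (exp (- x\<^sup>2 / 2)) = char std_normal_distribution x"
    by (simp add: char_std_normal_distribution)
  also have "\<dots> = (CLINT s|lborel. std_normal_density s *\<^sub>R iexp (x * s))"
    unfolding char_def by (subst integral_density) auto
  finally have 1: "exp (- x\<^sup>2 / 2) = Re (CLINT s|lborel. std_normal_density s *\<^sub>R iexp (x * s))"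
    by (metis Re_complex_of_real)
  have "integrable lborel (\<lambda>s. std_normal_density s *\<^sub>R iexp (x * s))"
    by (rule Bochner_Integration.integrable_bound[OF integrable_std_normal_moment[of 0]])
       (auto simp del: of_real_mult)
  from integral_Re[OF this] have "exp (- x\<^sup>2 / 2) = (\<integral>s. Re (std_normal_density s *\<^sub>R iexp (x * s)) \<partial>lborel)"
    using 1 by simp
  also have "\<dots> = (\<integral>s. sqrt (2 * pi) * (s ^ 0 * (exp (- s\<^sup>2 / 2) / (2 * pi)) * cos (x * s + 0 + real 0 * pi / 2)) \<partial>lborel)"
  proof (intro Bochner_Integration.integral_cong refl)
    fix s
    have "sqrt (2 * pi) * sqrt (2 * pi) = 2 * pi" by simp
    then show "Re (std_normal_density s *\<^sub>R iexp (x * s)) = sqrt (2 * pi) * (s ^ 0 * (exp (- s\<^sup>2 / 2) / (2 * pi)) * cos (x * s + 0 + real 0 * pi / 2))"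
      by (simp add: std_normal_density_def Re_exp field_simps)
  qed
  also have "\<dots> = sqrt (2 * pi) * trig_moment (\<lambda>s. exp (- s\<^sup>2 / 2) / (2 * pi)) 0 0 x"
    unfolding trig_moment_def by (rule integral_mult_right_zero)
  finally show "eta x = trig_moment (\<lambda>s. exp (- s\<^sup>2 / 2) / (2 * pi)) 0 0 x"
    by (simp add: eta_def field_simps)
qed

text \<open>Differentiating the integral for \<open>eta\<close> 2 k times brings down s^(2 k) and
  shifts the phase by k pi.\<close>

lemma hermite_even_eq:
  "hermite (2 * k) x = (-1) ^ k * gauss_cos (2 * real k) x / (2 * pi * eta x)"
proof -
  have "(deriv ^^ (2 * k)) eta x = trig_moment (\<lambda>s. exp (- s\<^sup>2 / 2) / (2 * pi)) 0 (2 * k) x"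
    unfolding eta_eq_trig_moment by (subst deriv_funpow_trig_moment) (rule integrable_gauss_moment, rule refl)
  also have "\<dots> = (\<integral>s. (-1) ^ k / (2 * pi) * (\<bar>s\<bar> powr (2 * real k) * exp (- s\<^sup>2 / 2) * cos (x * s)) \<partial>lborel)"
    unfolding trig_moment_def
  proof (intro integral_cong_AE)
    \<comment> \<open>The point s = 0 is left out because 0 powr 0 is 0 while 0 ^ 0 is 1.\<close>
    show "AE s in lborel. s ^ (2 * k) * (exp (- s\<^sup>2 / 2) / (2 * pi)) * cos (x * s + 0 + real (2 * k) * pi / 2) =
       (-1) ^ k / (2 * pi) * (\<bar>s\<bar> powr (2 * real k) * exp (- s\<^sup>2 / 2) * cos (x * s))"
      using AE_lborel_singleton[of "0::real"]
    proof eventually_elim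
      case (elim s)
      have "\<bar>s\<bar> powr (2 * real k) = s ^ (2 * k)"
        using elim powr_realpow[of "\<bar>s\<bar>" "2 * k"] by (simp add: power_abs[symmetric] power_mult)
      moreover have "cos (x * s + 0 + real (2 * k) * pi / 2) = (-1) ^ k * cos (x * s)"
        by (simp add: cos_add)
      ultimately show ?case by simp
    qed
  qed auto
  also have "\<dots> = (-1) ^ k / (2 * pi) * gauss_cos (2 * real k) x"
    unfolding gauss_cos_def by (rule integral_mult_right_zero)
  finally show ?thesis
    by (simp add: hermite_def)
qed

text \<open>Integration by parts on the half-line. With offset - pi / 2 the moments of order 0 and 1
  are the sine and cosine integrals, and the constant 1 is the boundary term at 0. This is the
  differential equation that links the sine transform to Dawson's integral.\<close>

lemma half_gauss_sin_ode:
  defines "w \<equiv> (\<lambda>s::real. indicator {0<..} s * exp (- s\<^sup>2 / 2))"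
  shows "trig_moment w (- pi / 2) 1 y = 1 - y * trig_moment w (- pi / 2) 0 y"
proof -
  let ?G = "\<lambda>s::real. - exp (- s\<^sup>2 / 2) * cos (y * s)"
  let ?f1 = "\<lambda>s::real. s ^ 1 * w s * cos (y * s + (- pi / 2 + real 1 * pi / 2))"
  let ?f0 = "\<lambda>s::real. s ^ 0 * w s * cos (y * s + (- pi / 2 + real 0 * pi / 2))"
  let ?g = "\<lambda>s::real. s * exp (- s\<^sup>2 / 2) * cos (y * s) + y * (exp (- s\<^sup>2 / 2) * sin (y * s))"
  have i1: "integrable lborel ?f1" and i0: "integrable lborel ?f0"
    unfolding w_def by (rule integrable_trig_moment[OF integrable_half_gauss_moment])+
  have eq: "indicator {0<..} s *\<^sub>R ?g s = ?f1 s + y * ?f0 s" for s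
    by (auto simp: w_def indicator_def cos_add cos_diff)
  have int: "set_integrable lborel {0<..} ?g"
    unfolding set_integrable_def eq using i0 i1 by auto
  have "(LBINT s=ereal 0..\<infinity>. ?g s) = 0 - (-1)"
  proof (rule interval_integral_FTC_integrable[where F = ?G])
    show "(?G has_vector_derivative ?g s) (at s)" for s
      unfolding has_real_derivative_iff_has_vector_derivative[symmetric]
      by (auto intro!: derivative_eq_intros simp: algebra_simps)
    show "isCont ?g s" for s by (intro continuous_intros) auto
    show "set_integrable lborel (einterval (ereal 0) \<infinity>) ?g"
      using int by (simp add: einterval_def greaterThan_def)
    have "?G \<midarrow>0\<rightarrow> ?G 0" by (intro isContD continuous_intros) auto
    then have "(?G \<longlongrightarrow> -1) (at_right 0)" by (auto intro: filterlim_mono at_le)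
    then show "((?G \<circ> real_of_ereal) \<longlongrightarrow> -1) (at_right (ereal 0))"
      by (simp only: ereal_tendsto_simps)
    have "((\<lambda>s::real. exp (- s\<^sup>2 / 2)) \<longlongrightarrow> 0) at_top" by real_asymp
    then have "(?G \<longlongrightarrow> 0) at_top"
    proof (rule Lim_null_comparison[rotated])
      show "eventually (\<lambda>s. norm (?G s) \<le> exp (- s\<^sup>2 / 2)) at_top"
        by (intro always_eventually allI) (auto simp: abs_mult intro!: mult_left_le)
    qed
    then show "((?G \<circ> real_of_ereal) \<longlongrightarrow> 0) (at_left \<infinity>)"
      by (simp only: ereal_tendsto_simps)
  qed auto
  moreover have "(LBINT s=ereal 0..\<infinity>. ?g s) = (\<integral>s. ?f1 s + y * ?f0 s \<partial>lborel)"
    unfolding eq[symmetric] by (simp add: interval_lebesgue_integral_def set_lebesgue_integral_def einterval_def greaterThan_def)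
  moreover have "\<dots> = (\<integral>s. ?f1 s \<partial>lborel) + y * (\<integral>s. ?f0 s \<partial>lborel)"
    using i0 i1 by (simp only: Bochner_Integration.integral_add integrable_mult_right integral_mult_right_zero)
  ultimately show ?thesis by (simp add: trig_moment_def add.assoc)
qed

lemma has_derivative_dawson: "(dawson has_real_derivative (1 - 2 * z * dawson z)) (at z)"
proof -
  \<comment> \<open>The interval contains 0 as well as z, the latter in its interior, so z of either
    sign is covered and the one-sided derivative is a full one.\<close>
  have "((\<lambda>z. LBINT t=ereal 0..ereal z. exp (t\<^sup>2)) has_vector_derivative exp (z\<^sup>2)) (at z within {- \<bar>z\<bar> - 1..\<bar>z\<bar> + 1})"
    by (rule interval_integral_FTC2) (auto intro!: continuous_intros)
  moreover have "at z within {- \<bar>z\<bar> - 1..\<bar>z\<bar> + 1} = at z"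
    by (rule at_within_interior) (auto simp: interior_atLeastAtMost_real)
  ultimately have [derivative_intros]: "((\<lambda>z. LBINT t=ereal 0..ereal z. exp (t\<^sup>2)) has_real_derivative exp (z\<^sup>2)) (at z)"
    by (simp add: has_real_derivative_iff_has_vector_derivative)
  have "((\<lambda>z. exp (- z\<^sup>2) * (LBINT t=ereal 0..ereal z. exp (t\<^sup>2))) has_real_derivative
     (- 2 * z * exp (- z\<^sup>2)) * (LBINT t=ereal 0..ereal z. exp (t\<^sup>2)) + exp (z\<^sup>2) * exp (- z\<^sup>2)) (at z)"
    by (rule DERIV_mult) (auto intro!: derivative_eq_intros)
  moreover have "exp (z\<^sup>2) * exp (- z\<^sup>2) = 1" by (simp add: mult_exp_exp)
  ultimately show ?thesis by (simp add: dawson_def[abs_def] mult.assoc)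
qed

(* Up to the factor sqrt 2, both sides solve y' = 1 - x y with y(0) = 0. *)
lemma dawson_eq_trig_moment:
  "(\<lambda>y. dawson (y / sqrt 2)) = trig_moment (\<lambda>s. indicator {0<..} s * exp (- s\<^sup>2 / 2) / sqrt 2) (- pi / 2) 0"
proof
  fix x :: real
  let ?w = "\<lambda>s::real. indicator {0<..} s * exp (- s\<^sup>2 / 2)"
  let ?S = "trig_moment ?w (- pi / 2) 0"
  \<comment> \<open>exp (y^2 / 2) is the integrating factor of the equation, so \<open>?F\<close> is
    constant exactly when both functions solve it.\<close>
  let ?F = "\<lambda>y. exp (y\<^sup>2 / 2) * (?S y - sqrt 2 * dawson (y / sqrt 2))"
  have S: "(?S has_real_derivative 1 - y * ?S y) (at y)" for y
    using trig_moment_has_derivative[OF integrable_half_gauss_moment[of 0] integrable_half_gauss_moment[of "Suc 0"], of "- pi / 2" y]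
    half_gauss_sin_ode[of y]
    by (simp only: One_nat_def)
  have D: "((\<lambda>y. dawson (y / sqrt 2)) has_real_derivative (1 - 2 * (y / sqrt 2) * dawson (y / sqrt 2)) * (1 / sqrt 2)) (at y)" for y
    by (rule DERIV_chain'[OF DERIV_cdivide[OF DERIV_ident] has_derivative_dawson])
  have "(?F has_real_derivative 0) (at y)" for y
  proof -
    have "(?F has_real_derivative (y * exp (y\<^sup>2 / 2)) * (?S y - sqrt 2 * dawson (y / sqrt 2))
        + ((1 - y * ?S y) - sqrt 2 * ((1 - 2 * (y / sqrt 2) * dawson (y / sqrt 2)) * (1 / sqrt 2))) * exp (y\<^sup>2 / 2)) (at y)"
      by (intro DERIV_mult DERIV_diff S DERIV_cmult D) (auto intro!: derivative_eq_intros)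
    moreover have "(y * exp (y\<^sup>2 / 2)) * (?S y - sqrt 2 * dawson (y / sqrt 2))
        + ((1 - y * ?S y) - sqrt 2 * ((1 - 2 * (y / sqrt 2) * dawson (y / sqrt 2)) * (1 / sqrt 2))) * exp (y\<^sup>2 / 2) = 0"
      by (simp add: field_simps real_sqrt_mult_self flip: real_sqrt_mult power2_eq_square)
    ultimately show ?thesis by simp
  qed
  then have "?F x = ?F 0" by (intro DERIV_isconst_all) auto
  also have "\<dots> = 0"
    by (simp add: trig_moment_def dawson_def cos_diff)
  finally have "?S x = sqrt 2 * dawson (x / sqrt 2)" by simp
  moreover have "trig_moment (\<lambda>s. indicator {0<..} s * exp (- s\<^sup>2 / 2) / sqrt 2) (- pi / 2) 0 x = ?S x / sqrt 2"
    unfolding trig_moment_def by (subst integral_divide_zero[symmetric]) (simp add: mult_ac)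
  ultimately show "dawson (x / sqrt 2) = trig_moment (\<lambda>s. indicator {0<..} s * exp (- s\<^sup>2 / 2) / sqrt 2) (- pi / 2) 0 x"
    by simp
qed

text \<open>An odd number of derivatives turns the sine transform into a cosine transform: the phase
  - pi / 2 + (2 k + 1) pi / 2 is k pi. The half-line integral is then half of
  \<open>gauss_cos\<close>.\<close>

lemma deriv_dawson_odd:
  "(deriv ^^ (2 * k + 1)) (\<lambda>y. dawson (y / sqrt 2)) x = (-1) ^ k * gauss_cos (2 * real k + 1) x / (2 * sqrt 2)"
proof -
  let ?w = "\<lambda>s::real. indicator {0<..} s * exp (- s\<^sup>2 / 2) / sqrt 2"
  have "(deriv ^^ (2 * k + 1)) (\<lambda>y. dawson (y / sqrt 2)) x = trig_moment ?w (- pi / 2) (2 * k + 1) x"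
    unfolding dawson_eq_trig_moment
    using integrable_divide[OF integrable_half_gauss_moment, of _ "sqrt 2"]
    by (subst deriv_funpow_trig_moment) auto
  also have "\<dots> = (\<integral>s. (-1) ^ k / sqrt 2 * (indicator {0<..} s * (s powr (2 * real k + 1) * exp (- s\<^sup>2 / 2) * cos (x * s))) \<partial>lborel)"
    unfolding trig_moment_def
  proof (intro Bochner_Integration.integral_cong refl)
    fix s :: real
    have "x * s + - pi / 2 + real (2 * k + 1) * pi / 2 = x * s + real k * pi"
      by (simp add: field_simps)
    then have "cos (x * s + - pi / 2 + real (2 * k + 1) * pi / 2) = (-1) ^ k * cos (x * s)"
      by (simp only: cos_add) simp
    moreover have "s powr (2 * real k + 1) = s ^ (2 * k + 1)" if "s > 0"
      using powr_realpow[OF that, of "2 * k + 1"] by (simp add: add.commute)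
    ultimately show "s ^ (2 * k + 1) * ?w s * cos (x * s + - pi / 2 + real (2 * k + 1) * pi / 2)
      = (-1) ^ k / sqrt 2 * (indicator {0<..} s * (s powr (2 * real k + 1) * exp (- s\<^sup>2 / 2) * cos (x * s)))"
      by (cases "s > 0") (simp_all add: indicator_def)
  qed
  also have "\<dots> = (-1) ^ k / sqrt 2 * (gauss_cos (2 * real k + 1) x / 2)"
    by (subst gauss_cos_half) simp_all
  finally show ?thesis by simp
qed

text \<open>Each special function is a cosine or sine integral against t^a exp(-t^2/2). In the
  noninteger case, adding the values at x and - x removes the sine part and leaves a factor cos (a
  pi / 2). It is nonzero because a is no odd integer, and it cancels against sin (a pi) = 2 sin (a
  pi / 2) cos (a pi / 2).\<close>

lemma heavy_G_eq:
  assumes "a > 2"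
  shows "heavy_G a x = heavy_coeff a / (2 * pi) * gauss_cos a x"
proof -
  consider (odd) "odd_integer a" | (even) "\<not> odd_integer a" "even_integer a" | (non) "\<not> odd_integer a" "\<not> even_integer a"
    by blast
  then show ?thesis
  proof cases
    case odd
    then obtain m :: int where m: "odd m" "a = of_int m" by (auto simp: odd_integer_def)
    define k where "k = nat (m div 2)"
    have k: "m = 2 * int k + 1" using m assms unfolding k_def by (auto elim!: oddE)
    have a: "a = 2 * real k + 1" using m(2) k by simp
    have "\<lfloor>a\<rfloor> = m" using m(2) by simp
    then have fl: "nat \<lfloor>a\<rfloor> = 2 * k + 1" using k by simp
    have ne: "\<not> even_integer a"
      using m by (auto simp: even_integer_def)
    have "sin (pi * a / 2) = sin (real k * pi + pi / 2)" by (simp add: a field_simps)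
    also have "\<dots> = (-1) ^ k" by (simp add: sin_add)
    finally have s: "sin (pi * a / 2) = (-1) ^ k" .
    have "heavy_G a x = - sqrt 2 / Gamma (a + 1) * ((-1) ^ k * gauss_cos a x / (2 * sqrt 2))"
      using odd unfolding heavy_G_def fl deriv_dawson_odd by (simp add: a add.commute)
    also have "\<dots> = - ((-1) ^ k) * gauss_cos a x / (2 * Gamma (a + 1))" by simp
    also have "\<dots> = heavy_coeff a / (2 * pi) * gauss_cos a x"
      using ne by (cases "even k") (simp_all add: heavy_coeff_def s)
    finally show ?thesis .
  next
    case even
    then obtain m :: int where m: "even m" "a = of_int m" by (auto simp: even_integer_def)
    define k where "k = nat (m div 2)"
    have k: "m = 2 * int k" using m assms unfolding k_def by (auto elim!: evenE)
    have a: "a = 2 * real k" using m(2) k by simp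
    have "\<lfloor>a\<rfloor> = m" using m(2) by simp
    then have fl: "nat \<lfloor>a\<rfloor> = 2 * k" using k by simp
    have e: "eta x > 0" by (simp add: eta_def)
    have "sqrt (2 / pi) * exp (- x\<^sup>2 / 2) = 2 * eta x"
      by (simp add: eta_def real_sqrt_divide real_sqrt_mult field_simps)
    then have "heavy_G a x = 2 * eta x / Gamma (a + 1) * ((-1) ^ k * gauss_cos a x / (2 * pi * eta x))"
      using even unfolding heavy_G_def fl hermite_even_eq by (simp add: a)
    also have "\<dots> = heavy_coeff a / (2 * pi) * gauss_cos a x"
      using even e by (simp add: heavy_coeff_def fl field_simps)
    finally show ?thesis .
  next
    case non
    let ?I = "\<lambda>z. LBINT t:{0<..}. exp (- t\<^sup>2 / 2) * t powr a * cos (z * t - a * pi / 2)"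
    have i: "integrable lborel (\<lambda>t. indicator {0<..} t * (exp (- t\<^sup>2 / 2) * t powr a * cos (z * t - a * pi / 2)))" for z
    proof -
      have "integrable lborel (\<lambda>t. indicator {0<..} t *\<^sub>R (\<bar>t\<bar> powr a * exp (- t\<^sup>2 / 2) * cos (z * t + (- a * pi / 2))))"
        using assms by (intro integrable_mult_indicator integrable_gauss_cos) auto
      also have "(\<lambda>t. indicator {0<..} t *\<^sub>R (\<bar>t\<bar> powr a * exp (- t\<^sup>2 / 2) * cos (z * t + (- a * pi / 2))))
         = (\<lambda>t. indicator {0<..} t * (exp (- t\<^sup>2 / 2) * t powr a * cos (z * t - a * pi / 2)))"
        by (auto simp: indicator_def)
      finally show ?thesis .
    qed
    have "?I x + ?I (- x) = (\<integral>t. indicator {0<..} t * (exp (- t\<^sup>2 / 2) * t powr a * cos (x * t - a * pi / 2))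
        + indicator {0<..} t * (exp (- t\<^sup>2 / 2) * t powr a * cos ((-x) * t - a * pi / 2)) \<partial>lborel)"
      unfolding set_lebesgue_integral_def real_scaleR_def
      by (rule Bochner_Integration.integral_add[symmetric, OF i i])
    also have "\<dots> = (\<integral>t. 2 * cos (a * pi / 2) * (indicator {0<..} t * (t powr a * exp (- t\<^sup>2 / 2) * cos (x * t))) \<partial>lborel)"
      by (intro Bochner_Integration.integral_cong) (auto simp: cos_diff algebra_simps)
    also have "\<dots> = cos (a * pi / 2) * gauss_cos a x"
      using assms by (simp add: gauss_cos_half)
    finally have I: "?I x + ?I (- x) = cos (a * pi / 2) * gauss_cos a x" .
    have "parabolic_cylinder a x + parabolic_cylinder a (- x) = sqrt (2 / pi) * exp (x\<^sup>2 / 4) * (?I x + ?I (- x))"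
      by (simp add: parabolic_cylinder_def distrib_left)
    then have pc: "parabolic_cylinder a x + parabolic_cylinder a (- x) = sqrt (2 / pi) * exp (x\<^sup>2 / 4) * (cos (a * pi / 2) * gauss_cos a x)"
      unfolding I .
    have c0: "cos (a * pi / 2) \<noteq> 0"
    proof
      assume "cos (a * pi / 2) = 0"
      then obtain i :: int where "odd i" "a * pi / 2 = of_int i * (pi / 2)" by (auto simp: cos_zero_iff_int)
      then have "a = of_int i" by simp
      with \<open>odd i\<close> non show False by (auto simp: odd_integer_def)
    qed
    have s2: "sin (a * pi) = 2 * sin (a * pi / 2) * cos (a * pi / 2)"
      using sin_double[of "a * pi / 2"] by simp
    have sq: "sqrt (pi / 2) * sqrt (2 / pi) = 1"
      by (simp flip: real_sqrt_mult)
    have "heavy_G a x = - (sqrt (pi / 2) * sqrt (2 / pi)) * (exp (- x\<^sup>2 / 4) * exp (x\<^sup>2 / 4)) / (Gamma (a + 1) * sin (a * pi)) * (cos (a * pi / 2) * gauss_cos a x)"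
      using non by (simp add: heavy_G_def pc)
    also have "exp (- x\<^sup>2 / 4) * exp (x\<^sup>2 / 4) = 1" by (simp add: mult_exp_exp)
    also have "- (sqrt (pi / 2) * sqrt (2 / pi)) * 1 / (Gamma (a + 1) * sin (a * pi)) * (cos (a * pi / 2) * gauss_cos a x)
       = - gauss_cos a x / (2 * sin (a * pi / 2) * Gamma (a + 1))"
      unfolding sq s2 using c0 by (simp add: field_simps)
    also have "\<dots> = heavy_coeff a / (2 * pi) * gauss_cos a x"
      using non by (simp add: heavy_coeff_def mult.commute)
    finally show ?thesis .
  qed
qed

section \<open>The Taylor remainder of the cosine\<close>

text \<open>Passage from gauge integrals to Lebesgue integrals; nonnegativity supplies the absolute
  convergence.\<close>

lemma has_bochner_integral_nonneg_HK:
  fixes f :: "real \<Rightarrow> real"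
  assumes "(f has_integral I) S" and nn: "\<And>x. x \<in> S \<Longrightarrow> 0 \<le> f x" and "0 \<le> I"
    and m: "(\<lambda>x. indicator S x * f x) \<in> borel_measurable borel"
  shows "has_bochner_integral lborel (\<lambda>x. indicator S x * f x) I"
proof (rule has_bochner_integral_nn_integral)
  show "(\<integral>\<^sup>+ x. ennreal (indicator S x * f x) \<partial>lborel) = ennreal I"
    using nn_integral_has_integral_lebesgue[OF nn assms(1)] by simp
qed (use m nn \<open>0 \<le> I\<close> in \<open>auto simp: indicator_def\<close>)

text \<open>The exponent p > -1 gives convergence at 0 and q < -1 at infinity. The minimum lets a
  function with one estimate for small u and another for large u be dominated without a case
  split.\<close>

lemma integrable_min_powr:
  fixes p q :: real
  assumes "-1 < p" "q < -1"
  shows "integrable lborel (\<lambda>u::real. min (\<bar>u\<bar> powr p) (\<bar>u\<bar> powr q))"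
proof -
  define H where "H = (\<lambda>u::real. indicator {0..1} u * u powr p + indicator {1..} u * u powr q)"
  have H: "integrable lborel H"
    unfolding H_def
  proof (rule Bochner_Integration.integrable_add)
    show "integrable lborel (\<lambda>u::real. indicator {0..1} u * u powr p)"
      by (rule integrable.intros, rule has_bochner_integral_nonneg_HK[OF has_integral_powr_from_0])
        (use assms in auto)
    show "integrable lborel (\<lambda>u::real. indicator {1..} u * u powr q)"
      by (rule integrable.intros, rule has_bochner_integral_nonneg_HK[OF has_integral_powr_to_inf])
        (use assms in \<open>auto simp: field_simps\<close>)
  qed
  have H': "integrable lborel (\<lambda>u. H (- u))"
    using lborel_integrable_real_affine[OF H, of "-1" 0] by simp
  show ?thesis
  proof (rule Bochner_Integration.integrable_bound[OF Bochner_Integration.integrable_add[OF H H']])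
    show "AE u in lborel. norm (min (\<bar>u\<bar> powr p) (\<bar>u\<bar> powr q)) \<le> norm (H u + H (- u))"
    proof (rule AE_I2)
      fix u :: real
      have nn: "H u \<ge> 0" "H (- u) \<ge> 0" by (auto simp: H_def)
      have "min (\<bar>u\<bar> powr p) (\<bar>u\<bar> powr q) \<le> H \<bar>u\<bar>"
        by (cases "\<bar>u\<bar> \<le> 1") (auto simp: H_def indicator_def min_le_iff_disj)
      also have "\<dots> \<le> H u + H (- u)" using nn by (auto simp: abs_if)
      finally show "norm (min (\<bar>u\<bar> powr p) (\<bar>u\<bar> powr q)) \<le> norm (H u + H (- u))"
        by simp
    qed
  qed auto
qed

lemma Fubini_lborel:
  fixes F :: "real \<Rightarrow> real \<Rightarrow> real"
  assumes m: "case_prod F \<in> borel_measurable (lborel \<Otimes>\<^sub>M lborel)"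
    and i1: "\<And>x. integrable lborel (F x)"
    and i2: "integrable lborel (\<lambda>x. \<integral>y. \<bar>F x y\<bar> \<partial>lborel)"
  shows "(\<integral>y. (\<integral>x. F x y \<partial>lborel) \<partial>lborel) = (\<integral>x. (\<integral>y. F x y \<partial>lborel) \<partial>lborel)"
  by (rule lborel_pair.Fubini_integral, rule lborel_pair.Fubini_integrable[OF m]) (use i1 i2 in auto)

lemma Gamma_integral_scaled:
  fixes a u :: real
  assumes "-1 < a" "0 < u"
  shows "has_bochner_integral lborel (\<lambda>s. indicator {0<..} s * (s powr a * exp (- (u * s)))) (Gamma (a + 1) * u powr (- a - 1))"
proof -
  have "has_bochner_integral lborel (\<lambda>t. indicator {0..} t * (t powr ((a + 1) - 1) / exp t)) (Gamma (a + 1))"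
    by (rule has_bochner_integral_nonneg_HK[OF Gamma_integral_real]) (use assms in \<open>auto simp: Gamma_real_nonneg\<close>)
  then have "has_bochner_integral lborel (\<lambda>t. indicator {0..} (0 + u * t) * ((0 + u * t) powr ((a + 1) - 1) / exp (0 + u * t))) (Gamma (a + 1) /\<^sub>R \<bar>u\<bar>)"
    using assms by (subst (asm) lborel_has_bochner_integral_real_affine_iff[where c = u and t = 0]) auto
  then have "has_bochner_integral lborel (\<lambda>t. u powr (- a) * (indicator {0..} (0 + u * t) * ((0 + u * t) powr ((a + 1) - 1) / exp (0 + u * t)))) (u powr (- a) * (Gamma (a + 1) /\<^sub>R \<bar>u\<bar>))"
    by (rule has_bochner_integral_mult_right)
  also have "u powr (- a) * (Gamma (a + 1) /\<^sub>R \<bar>u\<bar>) = Gamma (a + 1) * u powr (- a - 1)"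
    using assms by (simp add: powr_diff powr_minus field_simps)
  also have "(\<lambda>t. u powr (- a) * (indicator {0..} (0 + u * t) * ((0 + u * t) powr ((a + 1) - 1) / exp (0 + u * t))))
     = (\<lambda>s. indicator {0<..} s * (s powr a * exp (- (u * s))))"
    using assms by (intro ext)
      (auto simp: indicator_def powr_mult powr_minus exp_minus field_simps zero_le_mult_iff)
  finally show ?thesis .
qed

definition cos_rem :: "nat \<Rightarrow> real \<Rightarrow> real" where
  "cos_rem N u = cos u - (\<Sum>k\<le>N. (-1) ^ k * u ^ (2 * k) / fact (2 * k))"

lemma sum_cos_coeff_even:
  "(\<Sum>m<2 * n. cos_coeff m * u ^ m) = (\<Sum>k<n. (-1) ^ k * u ^ (2 * k) / fact (2 * k))"
  by (induction n) (auto simp: cos_coeff_def)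

lemma cos_rem_le1: "\<bar>cos_rem N u\<bar> \<le> \<bar>u\<bar> ^ (2 * N + 2)"
proof -
  obtain t where t: "cos u = (\<Sum>m<2 * Suc N. cos_coeff m * u ^ m) + cos (t + 1 / 2 * real (2 * Suc N) * pi) / fact (2 * Suc N) * u ^ (2 * Suc N)"
    using Maclaurin_cos_expansion[of u "2 * Suc N"] by blast
  have "cos_rem N u = cos (t + 1 / 2 * real (2 * Suc N) * pi) / fact (2 * Suc N) * u ^ (2 * Suc N)"
    unfolding cos_rem_def t sum_cos_coeff_even lessThan_Suc_atMost by simp
  then have "\<bar>cos_rem N u\<bar> = \<bar>cos (t + 1 / 2 * real (2 * Suc N) * pi)\<bar> / fact (2 * Suc N) * \<bar>u\<bar> ^ (2 * Suc N)"
    by (simp add: abs_mult power_abs)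
  also have "\<dots> \<le> 1 / fact (2 * Suc N) * \<bar>u\<bar> ^ (2 * Suc N)"
    by (intro mult_right_mono divide_right_mono) auto
  also have "\<dots> \<le> 1 * \<bar>u\<bar> ^ (2 * Suc N)"
    using fact_ge_1[of "2 * Suc N", where 'a = real] by (intro mult_right_mono) (auto simp del: fact_Suc)
  finally show ?thesis by simp
qed

lemma cos_rem_Suc: "cos_rem (Suc N) u = cos_rem N u - (-1) ^ Suc N * u ^ (2 * Suc N) / fact (2 * Suc N)"
  by (simp add: cos_rem_def)

text \<open>The last Taylor term is split off, and what is left is bounded by
  \<open>cos_rem_le1\<close> for the preceding index.\<close>

lemma cos_rem_le2: "\<bar>cos_rem N u\<bar> \<le> 2 * \<bar>u\<bar> ^ (2 * N)"
proof (cases N)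
  case 0
  then show ?thesis using abs_cos_le_one[of u] by (simp add: cos_rem_def)
next
  case (Suc M)
  have "\<bar>cos_rem N u\<bar> \<le> \<bar>cos_rem M u\<bar> + \<bar>(-1) ^ Suc M * u ^ (2 * Suc M) / fact (2 * Suc M)\<bar>"
    unfolding Suc cos_rem_Suc by (rule abs_triangle_ineq4)
  also have "\<bar>(-1) ^ Suc M * u ^ (2 * Suc M) / fact (2 * Suc M)\<bar> = 1 / fact (2 * Suc M) * \<bar>u\<bar> ^ (2 * Suc M)"
    by (simp add: abs_mult power_abs)
  also have "\<dots> \<le> 1 * \<bar>u\<bar> ^ (2 * Suc M)"
    using fact_ge_1[of "2 * Suc M", where 'a = real] by (intro mult_right_mono) (auto simp del: fact_Suc)
  also have "\<bar>cos_rem M u\<bar> \<le> \<bar>u\<bar> ^ (2 * Suc M)" using cos_rem_le1[of M u] by simp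
  finally show ?thesis using Suc by simp
qed

lemma cos_rem_measurable [measurable]: "cos_rem N \<in> borel_measurable borel"
  unfolding cos_rem_def[abs_def] by measurable

lemma cos_rem_minus [simp]: "cos_rem N (- u) = cos_rem N u"
  by (simp add: cos_rem_def)

text \<open>The first exponent is the effective one near 0, the second at infinity; the free
  exponent e makes room for the Potter correction of the power.\<close>

lemma cos_rem_powr_bound:
  "\<bar>cos_rem N u\<bar> * \<bar>u\<bar> powr e \<le> 2 * min (\<bar>u\<bar> powr (2 * real N + 2 + e)) (\<bar>u\<bar> powr (2 * real N + e))"
proof (cases "u = 0")
  case False
  have 1: "\<bar>u\<bar> powr (2 * real N + 2 + e) = \<bar>u\<bar> ^ (2 * N + 2) * \<bar>u\<bar> powr e"
    using False powr_realpow[of "\<bar>u\<bar>" "2 * N + 2"] powr_add[of "\<bar>u\<bar>" "real (2 * N + 2)" e] by (simp add: add_ac)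
  have 2: "\<bar>u\<bar> powr (2 * real N + e) = \<bar>u\<bar> ^ (2 * N) * \<bar>u\<bar> powr e"
    using False powr_realpow[of "\<bar>u\<bar>" "2 * N"] powr_add[of "\<bar>u\<bar>" "real (2 * N)" e] by (simp add: add_ac)
  have "\<bar>cos_rem N u\<bar> * \<bar>u\<bar> powr e \<le> \<bar>u\<bar> ^ (2 * N + 2) * \<bar>u\<bar> powr e"
    by (intro mult_right_mono cos_rem_le1) auto
  moreover have "\<bar>cos_rem N u\<bar> * \<bar>u\<bar> powr e \<le> 2 * \<bar>u\<bar> ^ (2 * N) * \<bar>u\<bar> powr e"
    by (intro mult_right_mono cos_rem_le2) auto
  moreover have "0 \<le> \<bar>u\<bar> ^ (2 * N + 2) * \<bar>u\<bar> powr e" by simp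
  ultimately have "\<bar>cos_rem N u\<bar> * \<bar>u\<bar> powr e \<le> 2 * (\<bar>u\<bar> ^ (2 * N + 2) * \<bar>u\<bar> powr e)"
    "\<bar>cos_rem N u\<bar> * \<bar>u\<bar> powr e \<le> 2 * (\<bar>u\<bar> ^ (2 * N) * \<bar>u\<bar> powr e)"
    by linarith+
  then show ?thesis unfolding 1[symmetric] 2[symmetric] by (auto simp: min_def)
qed auto

lemma integrable_cos_rem_powr:
  assumes "2 * real N < a" "a < 2 * real N + 2"
  shows "integrable lborel (\<lambda>u. cos_rem N u * \<bar>u\<bar> powr (- a - 1))"
proof (rule Bochner_Integration.integrable_bound)
  show "integrable lborel (\<lambda>u::real. 2 * min (\<bar>u\<bar> powr (2 * real N + 2 + (- a - 1))) (\<bar>u\<bar> powr (2 * real N + (- a - 1))))"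
    using assms by (intro integrable_mult_right integrable_min_powr) auto
  show "AE u in lborel. norm (cos_rem N u * \<bar>u\<bar> powr (- a - 1)) \<le>
      norm (2 * min (\<bar>u\<bar> powr (2 * real N + 2 + (- a - 1))) (\<bar>u\<bar> powr (2 * real N + (- a - 1))))"
  proof (rule AE_I2)
    fix u :: real
    show "norm (cos_rem N u * \<bar>u\<bar> powr (- a - 1)) \<le>
      norm (2 * min (\<bar>u\<bar> powr (2 * real N + 2 + (- a - 1))) (\<bar>u\<bar> powr (2 * real N + (- a - 1))))"
      using cos_rem_powr_bound[of N u "- a - 1"] by (simp add: abs_mult)
  qed
qed auto

text \<open>The substitution v = s^2 in the Gamma integral of parameter b / 2. The change of
  variables is stated for absolute integrability on a set, hence the passage to the completed
  measure and the way back by nonnegativity.\<close>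

lemma gauss_powr_integral:
  fixes b w :: real
  assumes "0 < b" "0 < w"
  shows "has_bochner_integral lborel (\<lambda>s. indicator {0<..} s * (s powr (b - 1) * exp (- (w * s\<^sup>2)))) (Gamma (b / 2) / 2 * w powr (- b / 2))"
proof -
  let ?f = "\<lambda>v::real. v powr (b / 2 - 1) * exp (- (w * v))"
  let ?I = "Gamma (b / 2) * w powr (- b / 2)"
  have Ipos: "0 \<le> ?I" using assms by (simp add: Gamma_real_nonneg)
  have h0: "has_bochner_integral lborel (\<lambda>v. indicator {0<..} v * ?f v) ?I"
    using Gamma_integral_scaled[of "b / 2 - 1" w] assms by simp
  have "set_integrable lborel {0<..} ?f"
    using integrable.intros[OF h0] by (simp add: set_integrable_def)
  then have h1: "?f absolutely_integrable_on {0<..}"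
    by (auto simp: set_integrable_def integrable_completion)
  have "integral {0<..} ?f = (LINT v:{0<..}|lebesgue. ?f v)"
    by (rule set_lebesgue_integral_eq_integral(2)[OF h1, symmetric])
  also have "\<dots> = (\<integral>v. indicator {0<..} v * ?f v \<partial>lborel)"
    unfolding set_lebesgue_integral_def by (subst integral_completion) auto
  also have "\<dots> = ?I" using h0 by (rule has_bochner_integral_integral_eq)
  finally have h2: "integral {0<..} ?f = ?I" .
  have img: "(\<lambda>s::real. s\<^sup>2) ` {0<..} = {0<..}"
  proof safe
    fix y :: real assume "y > 0"
    then have "y = (sqrt y)\<^sup>2" "sqrt y > 0" by auto
    then show "y \<in> (\<lambda>s. s\<^sup>2) ` {0<..}" by blast
  qed auto
  have "(\<lambda>s. \<bar>2 * s\<bar> * ?f (s\<^sup>2)) absolutely_integrable_on {0<..} \<and> integral {0<..} (\<lambda>s. \<bar>2 * s\<bar> * ?f (s\<^sup>2)) = ?I"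
  proof (rule has_absolute_integral_change_of_variables_1'[where S = "{0<..}" and g = "\<lambda>s. s\<^sup>2" and g' = "\<lambda>s. 2 * s" and f = ?f and b = ?I, THEN iffD2])
    show "inj_on (\<lambda>s::real. s\<^sup>2) {0<..}" by (auto simp: inj_on_def power2_eq_iff)
    show "?f absolutely_integrable_on (\<lambda>s. s\<^sup>2) ` {0<..} \<and> integral ((\<lambda>s. s\<^sup>2) ` {0<..}) ?f = ?I"
      unfolding img using h1 h2 by simp
  qed (auto intro!: derivative_eq_intros)
  then have i1: "(\<lambda>s. \<bar>2 * s\<bar> * ?f (s\<^sup>2)) absolutely_integrable_on {0<..}"
    and i2: "integral {0<..} (\<lambda>s. \<bar>2 * s\<bar> * ?f (s\<^sup>2)) = ?I"
    by (rule conjunct1, rule conjunct2)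
  have "((\<lambda>s. \<bar>2 * s\<bar> * ?f (s\<^sup>2)) has_integral ?I) {0<..}"
    unfolding i2[symmetric] by (rule integrable_integral[OF set_lebesgue_integral_eq_integral(1)[OF i1]])
  then have "has_bochner_integral lborel (\<lambda>s. indicator {0<..} s * (\<bar>2 * s\<bar> * ?f (s\<^sup>2))) ?I"
  proof (rule has_bochner_integral_nonneg_HK[OF _ _ Ipos])
    show "(\<lambda>s. indicator {0<..} s * (\<bar>2 * s\<bar> * ?f (s\<^sup>2))) \<in> borel_measurable borel"
      by measurable
  qed simp
  then have "has_bochner_integral lborel (\<lambda>s. 1 / 2 * (indicator {0<..} s * (\<bar>2 * s\<bar> * ?f (s\<^sup>2)))) (1 / 2 * ?I)"
    by (rule has_bochner_integral_mult_right)
  also have "(\<lambda>s. 1 / 2 * (indicator {0<..} s * (\<bar>2 * s\<bar> * ?f (s\<^sup>2)))) = (\<lambda>s. indicator {0<..} s * (s powr (b - 1) * exp (- (w * s\<^sup>2))))"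
  proof
    fix s :: real
    show "1 / 2 * (indicator {0<..} s * (\<bar>2 * s\<bar> * ?f (s\<^sup>2))) = indicator {0<..} s * (s powr (b - 1) * exp (- (w * s\<^sup>2)))"
    proof (cases "s > 0")
      case True
      then have "s\<^sup>2 = s powr 2" by (simp add: powr_numeral)
      then have "(s\<^sup>2) powr (b / 2 - 1) = s powr (2 * (b / 2 - 1))"
        by (simp only: powr_powr)
      then have "s * (s\<^sup>2) powr (b / 2 - 1) = s powr 1 * s powr (2 * (b / 2 - 1))"
        using True by (simp only: powr_one)
      also have "\<dots> = s powr (b - 1)" by (subst powr_add[symmetric]) (simp add: right_diff_distrib)
      finally have e: "s * (s\<^sup>2) powr (b / 2 - 1) = s powr (b - 1)" .
      have "1 / 2 * (indicator {0<..} s * (\<bar>2 * s\<bar> * ?f (s\<^sup>2))) = (s * (s\<^sup>2) powr (b / 2 - 1)) * exp (- (w * s\<^sup>2))"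
        using True by (simp add: mult.assoc del: powr_powr)
      then show ?thesis unfolding e using True by simp
    qed auto
  qed
  finally show ?thesis by simp
qed

text \<open>Writing 1 / (1 + s^2) as the integral of exp(-(1 + s^2) w) over w > 0 and exchanging the
  integrals gives Gamma(b/2) Gamma(1 - b/2) / 2, to which the reflection formula applies.\<close>

lemma integral_powr_div_1_plus_sq:
  fixes b :: real
  assumes "0 < b" "b < 2"
  shows "(\<integral>s. indicator {0<..} s * (s powr (b - 1) / (1 + s\<^sup>2)) \<partial>lborel) = pi / (2 * sin (pi * b / 2))"
proof -
  define F where "F = (\<lambda>w s::real. indicator {0<..} w * exp (- w) * (indicator {0<..} s * (s powr (b - 1) * exp (- (w * s\<^sup>2)))))"
  have 1: "has_bochner_integral lborel (F w) (indicator {0<..} w * exp (- w) * (Gamma (b / 2) / 2 * w powr (- b / 2)))" for w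
  proof (cases "w > 0")
    case True
    show ?thesis unfolding F_def
      by (intro has_bochner_integral_mult_right gauss_powr_integral True assms)
  qed (simp add: F_def has_bochner_integral_zero)
  have 2: "has_bochner_integral lborel (\<lambda>w. indicator {0<..} w * exp (- w) * (Gamma (b / 2) / 2 * w powr (- b / 2))) (Gamma (b / 2) / 2 * Gamma (1 - b / 2))"
  proof -
    have "has_bochner_integral lborel (\<lambda>w. Gamma (b / 2) / 2 * (indicator {0<..} w * (w powr (- b / 2) * exp (- (1 * w))))) (Gamma (b / 2) / 2 * (Gamma (- b / 2 + 1) * 1 powr (- (- b / 2) - 1)))"
      by (intro has_bochner_integral_mult_right Gamma_integral_scaled) (use assms in auto)
    then show ?thesis by (simp add: mult_ac)
  qed
  have 3: "(\<integral>w. F w s \<partial>lborel) = indicator {0<..} s * (s powr (b - 1) / (1 + s\<^sup>2))" for s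
  proof -
    have p: "1 + s\<^sup>2 > 0" by (simp add: add_pos_nonneg)
    have "has_bochner_integral lborel (\<lambda>w. indicator {0<..} s * s powr (b - 1) * (indicator {0<..} w * (w powr 0 * exp (- ((1 + s\<^sup>2) * w)))))
       (indicator {0<..} s * s powr (b - 1) * (Gamma (0 + 1) * (1 + s\<^sup>2) powr (- 0 - 1)))"
      by (intro has_bochner_integral_mult_right Gamma_integral_scaled p) auto
    also have "(\<lambda>w. indicator {0<..} s * s powr (b - 1) * (indicator {0<..} w * (w powr 0 * exp (- ((1 + s\<^sup>2) * w))))) = (\<lambda>w. F w s)"
      by (intro ext) (auto simp: F_def indicator_def distrib_right exp_diff exp_minus field_simps)
    also have "indicator {0<..} s * s powr (b - 1) * (Gamma (0 + 1) * (1 + s\<^sup>2) powr (- 0 - 1)) = indicator {0<..} s * (s powr (b - 1) / (1 + s\<^sup>2))"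
      using p by (simp add: powr_minus_divide)
    finally have "has_bochner_integral lborel (\<lambda>w. F w s) (indicator {0<..} s * (s powr (b - 1) / (1 + s\<^sup>2)))" .
    then show ?thesis by (rule has_bochner_integral_integral_eq)
  qed
  have "(\<integral>s. (\<integral>w. F w s \<partial>lborel) \<partial>lborel) = (\<integral>w. (\<integral>s. F w s \<partial>lborel) \<partial>lborel)"
  proof (rule Fubini_lborel)
    show "case_prod F \<in> borel_measurable (lborel \<Otimes>\<^sub>M lborel)"
      unfolding F_def by measurable
    show "integrable lborel (F w)" for w using 1 by (rule integrable.intros)
    have "\<bar>F w s\<bar> = F w s" for w s by (simp add: F_def)
    then show "integrable lborel (\<lambda>w. \<integral>s. \<bar>F w s\<bar> \<partial>lborel)"
      using 2 by (simp add: has_bochner_integral_integral_eq[OF 1] has_bochner_integral_iff)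
  qed
  also have "\<dots> = Gamma (b / 2) / 2 * Gamma (1 - b / 2)"
    using 2 by (simp add: has_bochner_integral_integral_eq[OF 1] has_bochner_integral_iff)
  also have "\<dots> = pi / (2 * sin (pi * b / 2))"
  proof -
    have "of_real (Gamma (b / 2) * Gamma (1 - b / 2)) = Gamma (of_real (b / 2)) * Gamma (1 - of_real (b / 2) :: complex)"
    proof -
      have "1 - complex_of_real (b / 2) = of_real (1 - b / 2)" by simp
      then show ?thesis by (simp only: Gamma_complex_of_real of_real_mult)
    qed
    also have "\<dots> = of_real pi / sin (of_real pi * of_real (b / 2))" by (rule Gamma_reflection_complex)
    also have "\<dots> = of_real (pi / sin (pi * b / 2))"
      by (simp flip: of_real_mult sin_of_real)
    finally have "Gamma (b / 2) * Gamma (1 - b / 2) = pi / sin (pi * b / 2)" by (simp only: of_real_eq_iff)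
    then show ?thesis by simp
  qed
  finally show ?thesis unfolding 3 .
qed

lemma cos_laplace:
  fixes s :: real
  assumes "0 < s"
  shows "has_bochner_integral lborel (\<lambda>u. indicator {0<..} u * (cos u * exp (- (u * s)))) (s / (1 + s\<^sup>2))"
proof -
  have pos: "1 + s\<^sup>2 > 0" by (simp add: add_pos_nonneg)
  let ?g = "\<lambda>u::real. cos u * exp (- (u * s))"
  let ?G = "\<lambda>u::real. exp (- (u * s)) * (sin u - s * cos u) / (1 + s\<^sup>2)"
  have int: "set_integrable lborel {0<..} ?g"
    using integrable_I0i_exp_mscale[OF assms] unfolding set_integrable_def
    by (rule Bochner_Integration.integrable_bound) (auto simp: abs_mult indicator_def intro!: mult_left_le_one_le)
  have int': "set_integrable lborel (einterval (ereal 0) \<infinity>) ?g"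
    using int by (simp add: einterval_def greaterThan_def)
  have "(LBINT u=ereal 0..\<infinity>. ?g u) = 0 - (- s / (1 + s\<^sup>2))"
  proof (rule interval_integral_FTC_integrable[where F = ?G])
    show "(?G has_vector_derivative ?g u) (at u)" for u
    proof -
      have "(?G has_real_derivative (exp (- (u * s)) * (- s) * (sin u - s * cos u) + (cos u + s * sin u) * exp (- (u * s))) / (1 + s\<^sup>2)) (at u)"
        by (intro DERIV_cdivide DERIV_mult) (auto intro!: derivative_eq_intros)
      also have "(exp (- (u * s)) * (- s) * (sin u - s * cos u) + (cos u + s * sin u) * exp (- (u * s))) / (1 + s\<^sup>2) = ?g u"
        using pos by (simp add: field_simps power2_eq_square)
      finally show ?thesis by (simp add: has_real_derivative_iff_has_vector_derivative)
    qed
    show "isCont ?g u" for u by (intro continuous_intros)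
    have "?G \<midarrow>0\<rightarrow> ?G 0" by (intro isContD continuous_intros) (use pos in auto)
    then have "(?G \<longlongrightarrow> - s / (1 + s\<^sup>2)) (at_right 0)" by (auto intro: filterlim_mono at_le)
    then show "((?G \<circ> real_of_ereal) \<longlongrightarrow> - s / (1 + s\<^sup>2)) (at_right (ereal 0))"
      by (simp only: ereal_tendsto_simps)
    have "((\<lambda>u::real. exp (- (u * s))) \<longlongrightarrow> 0) at_top"
      using assms by real_asymp
    then have "((\<lambda>u::real. exp (- (u * s)) * (1 + s) / (1 + s\<^sup>2)) \<longlongrightarrow> 0) at_top"
      by (intro tendsto_divide_zero tendsto_mult_left_zero)
    then have "(?G \<longlongrightarrow> 0) at_top"
    proof (rule Lim_null_comparison[rotated])
      show "eventually (\<lambda>u. norm (?G u) \<le> exp (- (u * s)) * (1 + s) / (1 + s\<^sup>2)) at_top"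
      proof (intro always_eventually allI)
        fix u :: real
        have "\<bar>sin u - s * cos u\<bar> \<le> \<bar>sin u\<bar> + \<bar>s * cos u\<bar>" by (rule abs_triangle_ineq4)
        also have "\<dots> \<le> 1 + s" using assms by (auto simp: abs_mult intro!: add_mono mult_left_le)
        finally have "exp (- (u * s)) * \<bar>sin u - s * cos u\<bar> / (1 + s\<^sup>2) \<le> exp (- (u * s)) * (1 + s) / (1 + s\<^sup>2)"
          using pos by (intro divide_right_mono mult_left_mono) auto
        then show "norm (?G u) \<le> exp (- (u * s)) * (1 + s) / (1 + s\<^sup>2)" using pos by (simp add: abs_mult)
      qed
    qed
    then show "((?G \<circ> real_of_ereal) \<longlongrightarrow> 0) (at_left \<infinity>)"
      by (simp only: ereal_tendsto_simps)
  qed (use int' in auto)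
  then have "(\<integral>u. indicator {0<..} u * ?g u \<partial>lborel) = s / (1 + s\<^sup>2)"
    by (simp add: interval_lebesgue_integral_def set_lebesgue_integral_def einterval_def greaterThan_def)
  with int show ?thesis by (simp add: has_bochner_integral_iff set_integrable_def)
qed

text \<open>The Laplace transforms of the Taylor terms of the cosine are the terms of the geometric
  expansion of s / (1 + s^2) in powers of 1 / s^2, so what remains is the remainder of a geometric
  series.\<close>

lemma cos_rem_laplace:
  fixes s :: real
  assumes "0 < s"
  shows "has_bochner_integral lborel (\<lambda>u. indicator {0<..} u * (cos_rem N u * exp (- (u * s))))
    ((-1) ^ Suc N * s powr (- 2 * real N - 1) / (1 + s\<^sup>2))"
proof (induction N)
  case 0
  have pos: "1 + s\<^sup>2 > 0" by (simp add: add_pos_nonneg)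
  have "has_bochner_integral lborel (\<lambda>u. indicator {0<..} u * (cos u * exp (- (u * s))) - indicator {0<..} u * (u powr 0 * exp (- (s * u)))) (s / (1 + s\<^sup>2) - Gamma (0 + 1) * s powr (- 0 - 1))"
    by (intro has_bochner_integral_diff cos_laplace Gamma_integral_scaled assms) simp
  also have "(\<lambda>u. indicator {0<..} u * (cos u * exp (- (u * s))) - indicator {0<..} u * (u powr 0 * exp (- (s * u)))) = (\<lambda>u. indicator {0<..} u * (cos_rem 0 u * exp (- (u * s))))"
    by (intro ext) (auto simp: indicator_def cos_rem_def algebra_simps)
  also have "s / (1 + s\<^sup>2) - Gamma (0 + 1) * s powr (- 0 - 1) = (-1) ^ Suc 0 * s powr (- 2 * real 0 - 1) / (1 + s\<^sup>2)"
    using assms pos by (simp add: powr_minus_divide field_simps power2_eq_square)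
  finally show ?case .
next
  case (Suc N)
  have pos: "1 + s\<^sup>2 > 0" by (simp add: add_pos_nonneg)
  let ?c = "(-1) ^ Suc N / fact (2 * Suc N) :: real"
  have "has_bochner_integral lborel (\<lambda>u. indicator {0<..} u * (cos_rem N u * exp (- (u * s))) - ?c * (indicator {0<..} u * (u powr real (2 * Suc N) * exp (- (s * u)))))
     ((-1) ^ Suc N * s powr (- 2 * real N - 1) / (1 + s\<^sup>2) - ?c * (Gamma (real (2 * Suc N) + 1) * s powr (- real (2 * Suc N) - 1)))"
    by (intro has_bochner_integral_diff has_bochner_integral_mult_right Suc.IH Gamma_integral_scaled assms) simp
  also have "(\<lambda>u. indicator {0<..} u * (cos_rem N u * exp (- (u * s))) - ?c * (indicator {0<..} u * (u powr real (2 * Suc N) * exp (- (s * u)))))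
     = (\<lambda>u. indicator {0<..} u * (cos_rem (Suc N) u * exp (- (u * s))))"
  proof
    fix u :: real
    show "indicator {0<..} u * (cos_rem N u * exp (- (u * s))) - ?c * (indicator {0<..} u * (u powr real (2 * Suc N) * exp (- (s * u))))
     = indicator {0<..} u * (cos_rem (Suc N) u * exp (- (u * s)))"
    proof (cases "u > 0")
      case True
      then have "u powr real (2 * Suc N) = u ^ (2 * Suc N)" by (rule powr_realpow)
      then show ?thesis using True unfolding cos_rem_Suc by (simp add: algebra_simps del: fact_Suc)
    qed auto
  qed
  also have "(-1) ^ Suc N * s powr (- 2 * real N - 1) / (1 + s\<^sup>2) - ?c * (Gamma (real (2 * Suc N) + 1) * s powr (- real (2 * Suc N) - 1))
     = (-1) ^ Suc (Suc N) * s powr (- 2 * real (Suc N) - 1) / (1 + s\<^sup>2)"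
  proof -
    have g: "Gamma (real (2 * Suc N) + 1) = fact (2 * Suc N)"
      using Gamma_fact[of "2 * Suc N", where 'a = real] by (simp add: add_ac)
    define z where "z = s powr (- 2 * real (Suc N) - 1)"
    have e: "- 2 * real N - 1 = 2 + (- 2 * real (Suc N) - 1)" by simp
    have p: "s powr (- 2 * real N - 1) = s\<^sup>2 * z"
      unfolding e powr_add z_def using assms by (simp only: powr_numeral)
    have e2: "- real (2 * Suc N) - 1 = - 2 * real (Suc N) - 1" by simp
    have p2: "s powr (- real (2 * Suc N) - 1) = z" unfolding z_def e2 ..
    have "(-1) ^ Suc N * (s\<^sup>2 * z) / (1 + s\<^sup>2) - ?c * (fact (2 * Suc N) * z) = (-1) ^ Suc N * ((s\<^sup>2 * z) / (1 + s\<^sup>2) - z)"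
      by (simp add: algebra_simps del: fact_Suc)
    also have "\<dots> = (-1) ^ Suc N * (- z / (1 + s\<^sup>2))" using pos by (simp add: field_simps)
    finally show ?thesis unfolding g p p2 z_def[symmetric] by (simp del: fact_Suc)
  qed
  finally show ?case .
qed

(* Writing Gamma(a + 1) u^(-a-1) as the integral of s^a e^(-us) and exchanging the integrals leaves the
   Laplace transform of the Taylor remainder, a monomial divided by 1 + s^2. *)
theorem cos_rem_integral:
  assumes "2 * real N < a" "a < 2 * real N + 2"
  shows "(\<integral>u. cos_rem N u * \<bar>u\<bar> powr (- a - 1) \<partial>lborel) = - pi / (sin (pi * a / 2) * Gamma (a + 1))"
proof -
  have apos: "a > 0" using assms by linarith
  define F where "F = (\<lambda>u s::real. indicator {0<..} u * cos_rem N u * (indicator {0<..} s * (s powr a * exp (- (u * s)))))"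
  have 1: "has_bochner_integral lborel (F u) (indicator {0<..} u * cos_rem N u * (Gamma (a + 1) * u powr (- a - 1)))" for u
  proof (cases "u > 0")
    case True
    show ?thesis unfolding F_def
      using apos True by (intro has_bochner_integral_mult_right Gamma_integral_scaled) auto
  qed (simp add: F_def has_bochner_integral_zero)
  have abs1: "(\<integral>s. \<bar>F u s\<bar> \<partial>lborel) = \<bar>cos_rem N u\<bar> * indicator {0<..} u * (Gamma (a + 1) * u powr (- a - 1))" for u
  proof (cases "u > 0")
    case True
    have "has_bochner_integral lborel (\<lambda>s. \<bar>cos_rem N u\<bar> * (indicator {0<..} s * (s powr a * exp (- (u * s))))) (\<bar>cos_rem N u\<bar> * (Gamma (a + 1) * u powr (- a - 1)))"
      using apos True by (intro has_bochner_integral_mult_right Gamma_integral_scaled) auto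
    moreover have "\<bar>F u s\<bar> = \<bar>cos_rem N u\<bar> * (indicator {0<..} s * (s powr a * exp (- (u * s))))" for s
      using True by (simp add: F_def abs_mult)
    ultimately show ?thesis using True by (simp add: has_bochner_integral_iff)
  qed (simp add: F_def)
  note int = integrable_cos_rem_powr[OF assms]
  have int2: "integrable lborel (\<lambda>u. Gamma (a + 1) * (indicator {0<..} u *\<^sub>R \<bar>cos_rem N u * \<bar>u\<bar> powr (- a - 1)\<bar>))"
    by (intro integrable_mult_right integrable_mult_indicator integrable_abs int) auto
  have "Gamma (a + 1) * (\<integral>u. indicator {0<..} u * (cos_rem N u * \<bar>u\<bar> powr (- a - 1)) \<partial>lborel) = (\<integral>u. Gamma (a + 1) * (indicator {0<..} u * (cos_rem N u * \<bar>u\<bar> powr (- a - 1))) \<partial>lborel)"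
    by simp
  also have "\<dots> = (\<integral>u. (\<integral>s. F u s \<partial>lborel) \<partial>lborel)"
    unfolding has_bochner_integral_integral_eq[OF 1]
    by (intro Bochner_Integration.integral_cong) (auto simp: indicator_def)
  also have "\<dots> = (\<integral>s. (\<integral>u. F u s \<partial>lborel) \<partial>lborel)"
  proof (rule Fubini_lborel[symmetric])
    show "case_prod F \<in> borel_measurable (lborel \<Otimes>\<^sub>M lborel)"
      unfolding F_def by measurable
    show "integrable lborel (F u)" for u using 1 by (rule integrable.intros)
    show "integrable lborel (\<lambda>u. \<integral>s. \<bar>F u s\<bar> \<partial>lborel)"
    proof -
      have "(\<lambda>u. \<integral>s. \<bar>F u s\<bar> \<partial>lborel) = (\<lambda>u. Gamma (a + 1) * (indicator {0<..} u *\<^sub>R \<bar>cos_rem N u * \<bar>u\<bar> powr (- a - 1)\<bar>))"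
        unfolding abs1 by (intro ext) (auto simp: indicator_def abs_mult)
      then show ?thesis using int2 by (simp only:)
    qed
  qed
  also have "\<dots> = (\<integral>s. (-1) ^ Suc N * (indicator {0<..} s * (s powr ((a - 2 * real N) - 1) / (1 + s\<^sup>2))) \<partial>lborel)"
  proof (intro Bochner_Integration.integral_cong refl)
    fix s :: real
    show "(\<integral>u. F u s \<partial>lborel) = (-1) ^ Suc N * (indicator {0<..} s * (s powr ((a - 2 * real N) - 1) / (1 + s\<^sup>2)))"
    proof (cases "s > 0")
      case True
      have "has_bochner_integral lborel (\<lambda>u. s powr a * (indicator {0<..} u * (cos_rem N u * exp (- (u * s))))) (s powr a * ((-1) ^ Suc N * s powr (- 2 * real N - 1) / (1 + s\<^sup>2)))"
        by (intro has_bochner_integral_mult_right cos_rem_laplace True)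
      also have "(\<lambda>u. s powr a * (indicator {0<..} u * (cos_rem N u * exp (- (u * s))))) = (\<lambda>u. F u s)"
        using True by (auto simp: F_def mult_ac)
      finally have "(\<integral>u. F u s \<partial>lborel) = s powr a * ((-1) ^ Suc N * s powr (- 2 * real N - 1) / (1 + s\<^sup>2))"
        by (rule has_bochner_integral_integral_eq)
      also have "\<dots> = (-1) ^ Suc N * ((s powr a * s powr (- 2 * real N - 1)) / (1 + s\<^sup>2))" by simp
      also have "s powr a * s powr (- 2 * real N - 1) = s powr ((a - 2 * real N) - 1)"
        by (simp add: powr_add[symmetric] algebra_simps)
      finally show ?thesis using True by simp
    qed (simp add: F_def)
  qed
  \<comment> \<open>The exponent a - 2 N lies in (0, 2), the range of convergence. Shifting the sine
    by N pi yields (-1)^N, which combines with (-1)^(N + 1) to a single minus sign for every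
    N.\<close>
  also have "\<dots> = (-1) ^ Suc N * (pi / (2 * sin (pi * (a - 2 * real N) / 2)))"
    by (subst integral_mult_right_zero, subst integral_powr_div_1_plus_sq) (use assms in auto)
  also have "sin (pi * (a - 2 * real N) / 2) = (-1) ^ N * sin (pi * a / 2)"
  proof -
    have "pi * (a - 2 * real N) / 2 = pi * a / 2 - real N * pi" by (simp add: field_simps)
    then show ?thesis by (simp only: sin_diff) simp
  qed
  also have "(-1) ^ Suc N * (pi / (2 * ((-1) ^ N * sin (pi * a / 2)))) = - (pi / (2 * sin (pi * a / 2)))"
    by (cases "even N") auto
  finally have G: "Gamma (a + 1) * (\<integral>u. indicator {0<..} u * (cos_rem N u * \<bar>u\<bar> powr (- a - 1)) \<partial>lborel) = - (pi / (2 * sin (pi * a / 2)))" .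
  have Gp: "Gamma (a + 1) > 0" using apos by (intro Gamma_real_pos) auto
  have "(\<integral>u. cos_rem N u * \<bar>u\<bar> powr (- a - 1) \<partial>lborel) = 2 * (\<integral>u. indicator {0<..} u * (cos_rem N u * \<bar>u\<bar> powr (- a - 1)) \<partial>lborel)"
    by (rule integral_even_real[OF int]) simp
  also have "(\<integral>u. indicator {0<..} u * (cos_rem N u * \<bar>u\<bar> powr (- a - 1)) \<partial>lborel) = - (pi / (2 * sin (pi * a / 2))) / Gamma (a + 1)"
    unfolding G[symmetric] using Gp by (intro nonzero_mult_div_cancel_left[symmetric]) auto
  finally show ?thesis by simp
qed

section \<open>Slow variation\<close>

text \<open>Slow variation together with Potter bounds, the common interface of L and zeta_L. The
  bound is demanded for every u > 0, even where u s is small, since it serves as a dominating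
  function in u. The absolute value is there because zeta_L is not positive on (0, 1).\<close>

definition slow_scale :: "(real \<Rightarrow> real) \<Rightarrow> bool" where
  "slow_scale \<Lambda> \<longleftrightarrow> slowly_varying \<Lambda> \<and>
     (\<forall>d>0. \<exists>C>0. \<exists>s0>0. \<forall>s\<ge>s0. 0 < \<Lambda> s \<and> (\<forall>u>0. \<bar>\<Lambda> (u * s)\<bar> \<le> C * (u powr d + u powr (- d)) * \<Lambda> s))"

lemma slow_scale_potter:
  assumes "slow_scale \<Lambda>" "d > 0"
  obtains C s0 where "C > 0" "s0 > 0" "\<And>s. s \<ge> s0 \<Longrightarrow> 0 < \<Lambda> s"
    "\<And>s u. s \<ge> s0 \<Longrightarrow> 0 < u \<Longrightarrow> \<bar>\<Lambda> (u * s)\<bar> \<le> C * (u powr d + u powr (- d)) * \<Lambda> s"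
  using assms unfolding slow_scale_def by metis

text \<open>The Potter bound read backwards: u = s0 / s compares the fixed value at s0 with the
  value at s and so bounds the latter from below by a multiple of s^(-e/2). Half of the decay s^(-e)
  is left over.\<close>

lemma slow_scale_powr_tendsto_0:
  assumes "slow_scale \<Lambda>" "e > 0"
  shows "((\<lambda>s. s powr (- e) / \<Lambda> s) \<longlongrightarrow> 0) at_top"
proof -
  obtain C s0 where C: "C > 0" "s0 > 0" "\<And>s. s \<ge> s0 \<Longrightarrow> 0 < \<Lambda> s"
    "\<And>s u. s \<ge> s0 \<Longrightarrow> 0 < u \<Longrightarrow> \<bar>\<Lambda> (u * s)\<bar> \<le> C * (u powr (e/2) + u powr (- (e/2))) * \<Lambda> s"
    using slow_scale_potter[OF assms(1), of "e / 2"] assms(2) by auto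
  have l0: "\<Lambda> s0 > 0" using C by auto
  let ?B = "2 * C * s0 powr (- (e/2)) / \<Lambda> s0"
  have bd: "s powr (- e) / \<Lambda> s \<le> ?B * s powr (- (e / 2))" if s: "s \<ge> s0" for s
  proof -
    have sp: "s > 0" using s C by simp
    have ls: "\<Lambda> s > 0" using C s by auto
    have "\<Lambda> s0 \<le> C * ((s0 / s) powr (e/2) + (s0 / s) powr (- (e/2))) * \<Lambda> s"
      using C(4)[OF s, of "s0 / s"] sp C by simp
    also have "(s0 / s) powr (e/2) \<le> (s / s0) powr (e/2)"
      using sp C s assms(2) by (intro powr_mono2) (auto simp: field_simps intro: mult_mono)
    also have "(s0 / s) powr (- (e/2)) = (s / s0) powr (e/2)"
      using sp C by (simp add: powr_minus powr_divide)
    also have "C * ((s / s0) powr (e/2) + (s / s0) powr (e/2)) * \<Lambda> s = 2 * C * s0 powr (- (e/2)) * (s powr (e/2) * \<Lambda> s)"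
      using sp C by (simp add: powr_minus powr_divide field_simps)
    finally have "\<Lambda> s0 \<le> 2 * C * s0 powr (- (e/2)) * (s powr (e/2) * \<Lambda> s)"
      using C ls by (simp add: mult_right_mono mult_left_mono)
    then have "1 / \<Lambda> s \<le> ?B * s powr (e / 2)"
      using ls l0 by (simp add: field_simps)
    then have "s powr (- e) * (1 / \<Lambda> s) \<le> s powr (- e) * (?B * s powr (e / 2))"
      by (intro mult_left_mono) auto
    also have "\<dots> = ?B * (s powr (- e) * s powr (e / 2))" by (simp only: mult_ac)
    also have "s powr (- e) * s powr (e / 2) = s powr (- (e / 2))"
      by (simp add: powr_add[symmetric])
    finally show ?thesis by simp
  qed
  have "((\<lambda>s. s powr (- (e / 2))) \<longlongrightarrow> 0) at_top"
    using assms(2) by (intro tendsto_neg_powr filterlim_ident) auto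
  then have "((\<lambda>s. ?B * s powr (- (e / 2))) \<longlongrightarrow> 0) at_top"
    by (rule tendsto_mult_right_zero)
  then show ?thesis
  proof (rule Lim_null_comparison[rotated])
    show "eventually (\<lambda>s. norm (s powr (- e) / \<Lambda> s) \<le> ?B * s powr (- (e / 2))) at_top"
      using eventually_ge_at_top[of s0]
    proof eventually_elim
      case (elim s)
      then show ?case using bd[OF elim] C(3)[OF elim] by simp
    qed
  qed
qed

lemma slow_scale_of_little_o_deriv:
  fixes L :: "real \<Rightarrow> real"
  assumes sv: "slowly_varying L" and nn: "\<And>u. 0 \<le> u \<Longrightarrow> 0 \<le> L u"
    and K: "\<And>u. 0 \<le> u \<Longrightarrow> L u \<le> K"
    and diff: "\<And>u. u > 0 \<Longrightarrow> L differentiable (at u)"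
    and der: "deriv L \<in> o[at_top](\<lambda>u. L u / u)"
  shows "slow_scale L"
  unfolding slow_scale_def
proof (intro conjI sv allI impI)
  fix d :: real assume d: "d > 0"
  \<comment> \<open>Since x / 0 = 0, the quotient for c = 1 is 0 wherever L vanishes. Its limit 1
    therefore makes L eventually nonzero, hence positive.\<close>
  have "((\<lambda>t. L (1 * t) / L t) \<longlongrightarrow> 1) at_top"
    using sv unfolding slowly_varying_def by (metis zero_less_one)
  then have "eventually (\<lambda>t. L (1 * t) / L t > 0) at_top"
    by (rule order_tendstoD) simp
  then have "eventually (\<lambda>t. 0 < L t \<and> \<bar>deriv L t\<bar> \<le> d * \<bar>L t / t\<bar>) at_top"
    using landau_o.smallD[OF der d] eventually_gt_at_top[of 0]
  proof eventually_elim
    case (elim t)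
    then have "L t \<noteq> 0" by auto
    with elim nn[of t] show ?case by auto
  qed
  then obtain x1 where x1: "\<And>t. t \<ge> x1 \<Longrightarrow> 0 < L t \<and> \<bar>deriv L t\<bar> \<le> d * \<bar>L t / t\<bar>"
    by (auto simp: eventually_at_top_linorder)
  define x0 where "x0 = max x1 1"
  have x0: "x0 > 0" and pos: "\<And>t. t \<ge> x0 \<Longrightarrow> 0 < L t"
    and dl: "\<And>t. t \<ge> x0 \<Longrightarrow> t * \<bar>deriv L t\<bar> \<le> d * L t"
  proof -
    show "x0 > 0" by (auto simp: x0_def)
    show "0 < L t" if "t \<ge> x0" for t using that x1 by (auto simp: x0_def)
    show "t * \<bar>deriv L t\<bar> \<le> d * L t" if t: "t \<ge> x0" for t
    proof -
      have "t > 0" using t by (auto simp: x0_def)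
      moreover have "\<bar>deriv L t\<bar> \<le> d * \<bar>L t / t\<bar>" "0 < L t" using x1[of t] t by (auto simp: x0_def)
      ultimately show ?thesis by (simp add: field_simps)
    qed
  qed
  have L': "(L has_real_derivative deriv L t) (at t)" if "t > 0" for t
    using diff[OF that] by (simp add: DERIV_deriv_iff_real_differentiable)
  have mono: "a powr p * L a \<le> b powr p * L b" if "x0 \<le> a" "a \<le> b" "p = d" for a b p
  proof (rule DERIV_nonneg_imp_nondecreasing[OF \<open>a \<le> b\<close>])
    fix t assume t: "a \<le> t" "t \<le> b"
    then have tp: "t > 0" using that x0 by linarith
    have "((\<lambda>t. t powr p * L t) has_real_derivative (p * t powr (p - 1)) * L t + deriv L t * t powr p) (at t)"
      by (intro DERIV_mult L' tp) (auto intro!: derivative_eq_intros simp: tp)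
    moreover have "(p * t powr (p - 1)) * L t + deriv L t * t powr p = t powr (p - 1) * (d * L t + t * deriv L t)"
      using tp that by (simp add: powr_diff field_simps)
    moreover have "d * L t + t * deriv L t \<ge> 0"
    proof -
      have "- (t * deriv L t) \<le> t * \<bar>deriv L t\<bar>" using tp by (simp add: abs_if)
      then show ?thesis using dl[of t] t that by linarith
    qed
    ultimately show "\<exists>y. ((\<lambda>t. t powr p * L t) has_real_derivative y) (at t) \<and> 0 \<le> y"
      by (metis mult_nonneg_nonneg powr_ge_zero)
  qed
  have anti: "b powr p * L b \<le> a powr p * L a" if "x0 \<le> a" "a \<le> b" "p = - d" for a b p
  proof (rule DERIV_nonpos_imp_nonincreasing[OF \<open>a \<le> b\<close>])
    fix t assume t: "a \<le> t" "t \<le> b"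
    then have tp: "t > 0" using that x0 by linarith
    have "((\<lambda>t. t powr p * L t) has_real_derivative (p * t powr (p - 1)) * L t + deriv L t * t powr p) (at t)"
      by (intro DERIV_mult L' tp) (auto intro!: derivative_eq_intros simp: tp)
    moreover have "(p * t powr (p - 1)) * L t + deriv L t * t powr p = t powr (p - 1) * (- d * L t + t * deriv L t)"
      using tp that by (simp add: powr_diff field_simps)
    moreover have "- d * L t + t * deriv L t \<le> 0"
    proof -
      have "t * deriv L t \<le> t * \<bar>deriv L t\<bar>" using tp by (simp add: abs_if)
      then show ?thesis using dl[of t] t that by linarith
    qed
    ultimately show "\<exists>y. ((\<lambda>t. t powr p * L t) has_real_derivative y) (at t) \<and> y \<le> 0"
      by (metis mult_nonneg_nonpos powr_ge_zero)
  qed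
  \<comment> \<open>K / L x0 handles u s < x0, where nothing but L \<le> K is known. There the
    monotonicity of x^d L(x) on [x0, s] gives L x0 \<le> u^(-d) L s, and multiplying by K / L x0
    turns this into a bound of K.\<close>
  define C where "C = 1 + K / L x0"
  have K0: "0 \<le> K" using nn[of 0] K[of 0] by linarith
  have Lx0: "0 < L x0" using pos by simp
  have C1: "1 \<le> C" and Ck_on: "K / L x0 \<le> C" using K0 Lx0 by (auto simp: C_def)
  have main: "\<bar>L (u * s)\<bar> \<le> C * (u powr d + u powr (- d)) * L s" if s: "s \<ge> x0" and u: "u > 0" for s u
  proof -
    have sp: "s > 0" and Ls: "L s > 0" using s x0 pos by auto
    have ab: "\<bar>L (u * s)\<bar> = L (u * s)" using nn[of "u * s"] u sp by simp
    consider "u * s < x0" | "u * s \<ge> x0" "u \<ge> 1" | "u * s \<ge> x0" "u < 1" by linarith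
    then have "L (u * s) \<le> C * u powr d * L s \<or> L (u * s) \<le> C * u powr (- d) * L s"
    proof cases
      case 1
      have "x0 powr d * L x0 \<le> s powr d * L s" using mono[of x0 s d] s by simp
      also have "\<dots> \<le> (x0 / u) powr d * L s"
        using 1 u sp d Ls by (intro mult_right_mono powr_mono2) (auto simp: field_simps)
      also have "\<dots> = x0 powr d * (u powr (- d) * L s)"
        using u x0 by (simp add: powr_divide powr_minus field_simps)
      finally have "L x0 \<le> u powr (- d) * L s" using x0 by simp
      then have "K / L x0 * L x0 \<le> K / L x0 * (u powr (- d) * L s)"
        using K0 Lx0 by (intro mult_left_mono) auto
      also have "\<dots> \<le> C * (u powr (- d) * L s)" using Ck_on Ls by (intro mult_right_mono) auto
      finally have "K \<le> C * u powr (- d) * L s" using Lx0 by (simp add: mult_ac)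
      then show ?thesis using K[of "u * s"] u sp by simp
    next
      case 2
      have "(u * s) powr (- d) * L (u * s) \<le> s powr (- d) * L s"
        using anti[of s "u * s" "- d"] s 2 sp by simp
      then have "u powr (- d) * L (u * s) \<le> L s" using u sp by (simp add: powr_mult)
      then have "L (u * s) \<le> 1 * (u powr d * L s)" using u by (simp add: powr_minus field_simps)
      also have "\<dots> \<le> C * (u powr d * L s)" using C1 Ls by (intro mult_right_mono) auto
      finally show ?thesis by (simp add: mult_ac)
    next
      case 3
      have "(u * s) powr d * L (u * s) \<le> s powr d * L s"
        using mono[of "u * s" s d] s 3 sp by simp
      then have "u powr d * L (u * s) \<le> L s" using u sp by (simp add: powr_mult)
      then have "L (u * s) \<le> 1 * (u powr (- d) * L s)" using u by (simp add: powr_minus field_simps)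
      also have "\<dots> \<le> C * (u powr (- d) * L s)" using C1 Ls by (intro mult_right_mono) auto
      finally show ?thesis by (simp add: mult_ac)
    qed
    moreover have "0 \<le> C * u powr d * L s" "0 \<le> C * u powr (- d) * L s" using C1 Ls by auto
    ultimately show ?thesis unfolding ab by (simp add: distrib_left distrib_right) linarith
  qed
  show "\<exists>C>0. \<exists>s0>0. \<forall>s\<ge>s0. 0 < L s \<and> (\<forall>u>0. \<bar>L (u * s)\<bar> \<le> C * (u powr d + u powr - d) * L s)"
    using C1 x0 pos main by (intro exI[of _ C] exI[of _ x0] conjI allI impI) auto
qed

lemma zeta_sv_has_derivative:
  assumes cont: "\<And>u. u > 0 \<Longrightarrow> isCont L u" and x: "x > 0"
  shows "(zeta_sv L has_real_derivative L x / x) (at x)"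
proof -
  define a b where "a = min 1 x / 2" and "b = max 1 x + 1"
  have ab: "0 < a" "a \<le> 1" "1 \<le> b" "a < x" "x < b" using x by (auto simp: a_def b_def)
  have "((\<lambda>x. LBINT u=ereal 1..ereal x. L u / u) has_vector_derivative L x / x) (at x within {a..b})"
    using ab by (intro interval_integral_FTC2) (auto intro!: continuous_at_imp_continuous_on continuous_intros cont)
  moreover have "at x within {a..b} = at x"
    by (rule at_within_interior) (use ab in auto)
  ultimately show ?thesis
    by (simp add: has_real_derivative_iff_has_vector_derivative zeta_sv_def[abs_def])
qed

text \<open>The derivative L(u) / u lies between 0 and K / u, so zeta_L and K ln - zeta_L are both
  nondecreasing.\<close>

lemma zeta_sv_diff_bound:
  assumes cont: "\<And>u. u > 0 \<Longrightarrow> isCont L u"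
    and nn: "\<And>u. 0 \<le> u \<Longrightarrow> 0 \<le> L u" and K: "\<And>u. 0 \<le> u \<Longrightarrow> L u \<le> K"
    and x: "x > 0" and c: "c > 0"
  shows "\<bar>zeta_sv L (c * x) - zeta_sv L x\<bar> \<le> K * \<bar>ln c\<bar>"
proof -
  have le: "0 \<le> zeta_sv L b - zeta_sv L a \<and> zeta_sv L b - zeta_sv L a \<le> K * (ln b - ln a)" if ab: "0 < a" "a \<le> b" for a b
  proof -
    have "zeta_sv L a \<le> zeta_sv L b"
    proof (rule DERIV_nonneg_imp_nondecreasing[OF ab(2)])
      fix t assume "a \<le> t" "t \<le> b"
      then have "t > 0" using ab by simp
      then show "\<exists>y. (zeta_sv L has_real_derivative y) (at t) \<and> 0 \<le> y"
        using zeta_sv_has_derivative[OF cont] nn[of t] by (intro exI[of _ "L t / t"]) auto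
    qed
    moreover have "K * ln a - zeta_sv L a \<le> K * ln b - zeta_sv L b"
    proof (rule DERIV_nonneg_imp_nondecreasing[OF ab(2)])
      fix t assume "a \<le> t" "t \<le> b"
      then have t: "t > 0" using ab by simp
      have "((\<lambda>t. K * ln t - zeta_sv L t) has_real_derivative K * (1 / t) - L t / t) (at t)"
        using t by (intro DERIV_diff DERIV_cmult DERIV_ln_divide zeta_sv_has_derivative cont) auto
      moreover have "0 \<le> K * (1 / t) - L t / t"
        using K[of t] t by (simp add: divide_right_mono)
      ultimately show "\<exists>y. ((\<lambda>t. K * ln t - zeta_sv L t) has_real_derivative y) (at t) \<and> 0 \<le> y" by blast
    qed
    ultimately show ?thesis by (simp add: algebra_simps)
  qed
  show ?thesis
  proof (cases "c \<ge> 1")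
    case True
    have "ln (c * x) - ln x = ln c" using x c by (simp add: ln_mult)
    moreover have "x \<le> c * x" using True x by simp
    ultimately show ?thesis using le[of x "c * x"] x True by auto
  next
    case False
    have "ln x - ln (c * x) = - ln c" using x c by (simp add: ln_mult)
    moreover have "c * x \<le> x" using False x by simp
    moreover have "ln c < 0" using False c by simp
    ultimately show ?thesis using le[of "c * x" x] x c by auto
  qed
qed

text \<open>Replacing s by u s changes zeta_L by at most K |ln u|, while zeta_L itself tends to
  infinity; this gives slow variation. The Potter bound follows from |ln u| \<le> (u^d + u^(-d)) / d
  once zeta_L exceeds 1.\<close>

lemma slow_scale_zeta_sv:
  assumes cont: "\<And>u. u > 0 \<Longrightarrow> isCont L u"
    and nn: "\<And>u. 0 \<le> u \<Longrightarrow> 0 \<le> L u" and K: "\<And>u. 0 \<le> u \<Longrightarrow> L u \<le> K"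
    and lim: "filterlim (zeta_sv L) at_top at_top"
  shows "slow_scale (zeta_sv L)"
  unfolding slow_scale_def
proof (intro conjI allI impI)
  have db: "\<bar>zeta_sv L (c * x) - zeta_sv L x\<bar> \<le> K * \<bar>ln c\<bar>" if "x > 0" "c > 0" for x c
    by (rule zeta_sv_diff_bound[OF cont nn K]) (use that in auto)
  have K0: "0 \<le> K" using nn[of 0] K[of 0] by linarith
  show "slowly_varying (zeta_sv L)"
    unfolding slowly_varying_def
  proof (intro allI impI)
    fix c :: real assume c: "c > 0"
    have "((\<lambda>t. K * \<bar>ln c\<bar> / zeta_sv L t) \<longlongrightarrow> 0) at_top"
      by (intro real_tendsto_divide_at_top[OF tendsto_const] lim)
    then have "((\<lambda>t. zeta_sv L (c * t) / zeta_sv L t - 1) \<longlongrightarrow> 0) at_top"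
    proof (rule Lim_null_comparison[rotated])
      show "\<forall>\<^sub>F t in at_top. norm (zeta_sv L (c * t) / zeta_sv L t - 1) \<le> K * \<bar>ln c\<bar> / zeta_sv L t"
        using eventually_gt_at_top[of 0] lim[unfolded filterlim_at_top_dense, rule_format, of 0]
      proof eventually_elim
        case (elim t)
        have "norm (zeta_sv L (c * t) / zeta_sv L t - 1) = \<bar>zeta_sv L (c * t) - zeta_sv L t\<bar> / zeta_sv L t"
          using elim by (simp add: field_simps)
        then show ?case using db[OF elim(1) c] elim by (simp add: divide_right_mono)
      qed
    qed
    then show "((\<lambda>t. zeta_sv L (c * t) / zeta_sv L t) \<longlongrightarrow> 1) at_top"
      by (simp add: LIM_zero_iff)
  qed
  fix d :: real assume d: "d > 0"
  have "eventually (\<lambda>s. 1 < zeta_sv L s \<and> 0 < s) at_top"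
    using lim[unfolded filterlim_at_top_dense, rule_format, of 1] eventually_gt_at_top[of 0]
    by eventually_elim auto
  then obtain s1 where s1: "\<And>s. s \<ge> s1 \<Longrightarrow> 1 < zeta_sv L s \<and> 0 < s" by (auto simp: eventually_at_top_linorder)
  define s0 where "s0 = max s1 1"
  have lnb: "\<bar>ln u\<bar> \<le> (u powr d + u powr (- d)) / d" if u: "u > 0" for u
  proof -
    have "d * ln u = ln (u powr d)" "- d * ln u = ln (u powr (- d))" using u by (auto simp: ln_powr)
    moreover have "ln (u powr d) \<le> u powr d" by (rule ln_bound) (use u in simp)
    moreover have "ln (u powr (- d)) \<le> u powr (- d)" by (rule ln_bound) (use u in simp)
    moreover have "0 \<le> u powr d" "0 \<le> u powr (- d)" by auto
    moreover have "d * \<bar>ln u\<bar> = d * ln u \<or> d * \<bar>ln u\<bar> = - d * ln u" by (auto simp: abs_if)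
    ultimately have "d * \<bar>ln u\<bar> \<le> u powr d + u powr (- d)" by linarith
    then show ?thesis using d by (simp add: field_simps)
  qed
  have one: "1 \<le> u powr d + u powr (- d)" if u: "u > 0" for u
  proof -
    have "1 \<le> u powr d \<or> 1 \<le> u powr (- d)"
      using d u by (cases "u \<ge> 1") (auto simp: ge_one_powr_ge_zero powr_minus one_le_inverse_iff intro: powr_le1)
    moreover have "0 \<le> u powr d" "0 \<le> u powr (- d)" by auto
    ultimately show ?thesis by linarith
  qed
  define C where "C = 1 + K / d"
  have "\<bar>zeta_sv L (u * s)\<bar> \<le> C * (u powr d + u powr (- d)) * zeta_sv L s" if s: "s \<ge> s0" and u: "u > 0" for s u
  proof -
    have z: "1 < zeta_sv L s" "0 < s" using s s1 by (auto simp: s0_def)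
    have "\<bar>zeta_sv L (u * s)\<bar> \<le> zeta_sv L s + K * \<bar>ln u\<bar>" using db[OF z(2) u] z by linarith
    also have "\<dots> \<le> 1 * zeta_sv L s + K * ((u powr d + u powr (- d)) / d) * zeta_sv L s"
    proof -
      have "K * \<bar>ln u\<bar> \<le> K * ((u powr d + u powr (- d)) / d)"
        using lnb[OF u] K0 by (intro mult_left_mono) auto
      also have "\<dots> = K * ((u powr d + u powr (- d)) / d) * 1" by simp
      also have "\<dots> \<le> K * ((u powr d + u powr (- d)) / d) * zeta_sv L s"
        using K0 d z by (intro mult_left_mono mult_nonneg_nonneg divide_nonneg_pos) (auto intro: add_nonneg_nonneg)
      finally show ?thesis by simp
    qed
    also have "\<dots> \<le> (u powr d + u powr (- d)) * zeta_sv L s + K * ((u powr d + u powr (- d)) / d) * zeta_sv L s"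
      using one[OF u] z by (intro add_right_mono mult_right_mono) auto
    also have "\<dots> = C * (u powr d + u powr (- d)) * zeta_sv L s" using d by (simp add: C_def field_simps)
    finally show ?thesis .
  qed
  moreover have "C > 0" using K0 d by (auto simp: C_def intro: add_pos_nonneg)
  moreover have "s0 > 0" by (simp add: s0_def)
  moreover have "0 < zeta_sv L s" if "s \<ge> s0" for s using s1[of s] that by (auto simp: s0_def)
  ultimately show "\<exists>C>0. \<exists>s0>0. \<forall>s\<ge>s0. 0 < zeta_sv L s \<and> (\<forall>u>0. \<bar>zeta_sv L (u * s)\<bar> \<le> C * (u powr d + u powr - d) * zeta_sv L s)"
    by blast
qed

section \<open>Heavy tails and the characteristic function near zero\<close>

text \<open>The analytic setting without any probability. Moments of f up to order 2 N are finite,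
  and the choice of the half-open interval puts an even integer \<alpha> at its right end.\<close>

locale heavy_tail =
  fixes \<alpha> K :: real and L f :: "real \<Rightarrow> real" and N :: nat
  assumes N: "2 * real N < \<alpha>" "\<alpha> \<le> 2 * real N + 2"
    and L_nonneg: "\<And>u. 0 \<le> u \<Longrightarrow> 0 \<le> L u" and L_le: "\<And>u. 0 \<le> u \<Longrightarrow> L u \<le> K"
    and f_eq: "\<And>x. f x = (1 + \<bar>x\<bar>) powr (- (\<alpha> + 1)) * L \<bar>x\<bar>"
    and f_measurable [measurable]: "f \<in> borel_measurable borel"
begin

lemma alpha_pos: "\<alpha> > 0" using N(1) by linarith

lemma K_nonneg: "0 \<le> K" using L_nonneg[of 0] L_le[of 0] by linarith

lemma f_nonneg: "0 \<le> f x" by (simp add: f_eq L_nonneg)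

lemma f_even: "f (- x) = f x" by (simp add: f_eq)

text \<open>Expresses L on the half-line through f, from which measurability is inherited.\<close>

lemma L_eq: "0 \<le> x \<Longrightarrow> L x = (1 + x) powr (\<alpha> + 1) * f x"
  using powr_add[of "1 + x" "\<alpha> + 1" "- (\<alpha> + 1)"] by (simp add: f_eq)

lemma f_le: "f x \<le> K * (1 + \<bar>x\<bar>) powr (- (\<alpha> + 1))"
  unfolding f_eq by (subst mult.commute) (intro mult_right_mono L_le, auto)

lemma integrable_powr_f:
  assumes "0 \<le> p" "p < \<alpha>"
  shows "integrable lborel (\<lambda>x. \<bar>x\<bar> powr p * f x)"
proof (rule Bochner_Integration.integrable_bound)
  show "integrable lborel (\<lambda>u::real. K * min (\<bar>u\<bar> powr 0) (\<bar>u\<bar> powr (p - (\<alpha> + 1))))"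
    using assms by (intro integrable_mult_right integrable_min_powr) auto
  show "AE u in lborel. norm (\<bar>u\<bar> powr p * f u) \<le> norm (K * min (\<bar>u\<bar> powr 0) (\<bar>u\<bar> powr (p - (\<alpha> + 1))))"
  proof (rule AE_I2)
    fix u :: real
    have "\<bar>u\<bar> powr p * f u \<le> K * (\<bar>u\<bar> powr p * (1 + \<bar>u\<bar>) powr (- (\<alpha> + 1)))"
      using mult_left_mono[OF f_le[of u], of "\<bar>u\<bar> powr p"] by (simp add: mult_ac)
    also have "\<dots> \<le> K * min (\<bar>u\<bar> powr 0) (\<bar>u\<bar> powr (p - (\<alpha> + 1)))"
    proof (intro mult_left_mono K_nonneg min.boundedI)
      show "\<bar>u\<bar> powr p * (1 + \<bar>u\<bar>) powr (- (\<alpha> + 1)) \<le> \<bar>u\<bar> powr 0"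
      proof (cases "u = 0")
        case False
        have "\<bar>u\<bar> powr p * (1 + \<bar>u\<bar>) powr (- (\<alpha> + 1)) \<le> (1 + \<bar>u\<bar>) powr p * (1 + \<bar>u\<bar>) powr (- (\<alpha> + 1))"
          using assms by (intro mult_right_mono powr_mono2) auto
        also have "\<dots> = (1 + \<bar>u\<bar>) powr (p - (\<alpha> + 1))" by (simp add: powr_add[symmetric] algebra_simps)
        also have "\<dots> \<le> (1 + \<bar>u\<bar>) powr 0" using assms by (intro powr_mono) auto
        also have "\<dots> = 1" by (rule powr_zero_eq_one[THEN trans]) auto
        finally show ?thesis using False by simp
      qed simp
      show "\<bar>u\<bar> powr p * (1 + \<bar>u\<bar>) powr (- (\<alpha> + 1)) \<le> \<bar>u\<bar> powr (p - (\<alpha> + 1))"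
      proof (cases "u = 0")
        case False
        have "\<bar>u\<bar> powr p * (1 + \<bar>u\<bar>) powr (- (\<alpha> + 1)) \<le> \<bar>u\<bar> powr p * \<bar>u\<bar> powr (- (\<alpha> + 1))"
          using alpha_pos False by (intro mult_left_mono powr_mono2') auto
        then show ?thesis by (simp add: powr_add[symmetric] algebra_simps)
      qed simp
    qed
    finally show "norm (\<bar>u\<bar> powr p * f u) \<le> norm (K * min (\<bar>u\<bar> powr 0) (\<bar>u\<bar> powr (p - (\<alpha> + 1))))"
      using f_nonneg[of u] by simp
  qed
qed auto

lemma integrable_power_f:
  assumes "real k < \<alpha>"
  shows "integrable lborel (\<lambda>x. x ^ k * f x)"
proof (rule Bochner_Integration.integrable_bound[OF integrable_powr_f[of "real k"]])
  show "AE x in lborel. norm (x ^ k * f x) \<le> norm (\<bar>x\<bar> powr real k * f x)"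
    using AE_lborel_singleton[of "0::real"]
  proof eventually_elim
    case (elim x)
    then show ?case using f_nonneg[of x] by (simp add: abs_mult powr_realpow power_abs)
  qed
qed (use assms in auto)

definition tail_rem :: "real \<Rightarrow> real" where
  "tail_rem t = (\<integral>x. cos_rem N (t * x) * f x \<partial>lborel)"

lemma trig_moment_eq_tail_rem:
  "trig_moment f 0 0 t = (\<Sum>k\<le>N. (-1) ^ k * (\<integral>x. x ^ (2 * k) * f x \<partial>lborel) / fact (2 * k) * t ^ (2 * k)) + tail_rem t"
proof -
  have ip: "integrable lborel (\<lambda>x. (-1) ^ k * t ^ (2 * k) / fact (2 * k) * (x ^ (2 * k) * f x))" if "k \<le> N" for k
    using that N by (intro integrable_mult_right integrable_power_f) auto
  have ic: "integrable lborel (\<lambda>x. x ^ 0 * f x * cos (t * x + 0))"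
    by (rule integrable_trig_moment[OF integrable_power_f]) (use alpha_pos in simp)
  have "tail_rem t = (\<integral>x. x ^ 0 * f x * cos (t * x + 0) - (\<Sum>k\<le>N. (-1) ^ k * t ^ (2 * k) / fact (2 * k) * (x ^ (2 * k) * f x)) \<partial>lborel)"
    unfolding tail_rem_def
  proof (intro Bochner_Integration.integral_cong refl)
    fix x
    show "cos_rem N (t * x) * f x = x ^ 0 * f x * cos (t * x + 0) - (\<Sum>k\<le>N. (-1) ^ k * t ^ (2 * k) / fact (2 * k) * (x ^ (2 * k) * f x))"
      unfolding cos_rem_def left_diff_distrib sum_distrib_right by (simp add: power_mult_distrib mult_ac)
  qed
  also have "\<dots> = (\<integral>x. x ^ 0 * f x * cos (t * x + 0) \<partial>lborel) - (\<Sum>k\<le>N. (\<integral>x. (-1) ^ k * t ^ (2 * k) / fact (2 * k) * (x ^ (2 * k) * f x) \<partial>lborel))"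
    using ip ic by (subst Bochner_Integration.integral_diff) (auto intro!: Bochner_Integration.integrable_sum simp: Bochner_Integration.integral_sum)
  also have "(\<integral>x. x ^ 0 * f x * cos (t * x + 0) \<partial>lborel) = trig_moment f 0 0 t"
    by (simp add: trig_moment_def)
  also have "(\<Sum>k\<le>N. (\<integral>x. (-1) ^ k * t ^ (2 * k) / fact (2 * k) * (x ^ (2 * k) * f x) \<partial>lborel)) = (\<Sum>k\<le>N. (-1) ^ k * (\<integral>x. x ^ (2 * k) * f x \<partial>lborel) / fact (2 * k) * t ^ (2 * k))"
    by (intro sum.cong refl) (simp only: integral_mult_right_zero, simp)
  finally show ?thesis by simp
qed

lemma tail_rem_scaled:
  assumes s: "s > 0"
  shows "tail_rem (1 / s) * s powr \<alpha> = (\<integral>u. cos_rem N u * (f (u * s) * s powr (\<alpha> + 1)) \<partial>lborel)"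
proof -
  have "tail_rem (1 / s) = s * (\<integral>u. cos_rem N u * f (u * s) \<partial>lborel)"
    unfolding tail_rem_def using s
    by (subst lborel_integral_real_affine[where c = s and t = 0]) (auto simp: mult.commute)
  then have "tail_rem (1 / s) * s powr \<alpha> = (s powr \<alpha> * s) * (\<integral>u. cos_rem N u * f (u * s) \<partial>lborel)"
    by (simp only: mult_ac)
  also have "s powr \<alpha> * s = s powr (\<alpha> + 1)" using s by (simp add: powr_add)
  also have "s powr (\<alpha> + 1) * (\<integral>u. cos_rem N u * f (u * s) \<partial>lborel) = (\<integral>u. s powr (\<alpha> + 1) * (cos_rem N u * f (u * s)) \<partial>lborel)"
    by simp
  finally show ?thesis by (simp only: mult_ac)
qed

text \<open>For s \<rightarrow> \<infinity> the right-hand side is the pure power |u|^(-\<alpha> -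
  1) times a value of L comparable with L s; the shift of |u| by 1 / s only lowers it.\<close>

lemma f_scaled:
  assumes s: "s > 0"
  shows "f (u * s) * s powr (\<alpha> + 1) = (1 / s + \<bar>u\<bar>) powr (- \<alpha> - 1) * L (\<bar>u\<bar> * s)"
proof -
  have "1 + \<bar>u * s\<bar> = s * (1 / s + \<bar>u\<bar>)" using s by (simp add: abs_mult field_simps)
  then have "(1 + \<bar>u * s\<bar>) powr (- (\<alpha> + 1)) = s powr (- (\<alpha> + 1)) * (1 / s + \<bar>u\<bar>) powr (- \<alpha> - 1)"
    using s by (simp add: powr_mult)
  moreover have "s powr (- (\<alpha> + 1)) * s powr (\<alpha> + 1) = 1"
    using s by (simp add: powr_add[symmetric])
  ultimately show ?thesis using s by (simp add: f_eq abs_mult mult_ac)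
qed

lemma f_scaled_le:
  assumes s: "s > 0" and u: "u \<noteq> 0"
  shows "f (u * s) * s powr (\<alpha> + 1) \<le> \<bar>u\<bar> powr (- \<alpha> - 1) * L (\<bar>u\<bar> * s)"
  unfolding f_scaled[OF s] using s u alpha_pos
  by (intro mult_right_mono powr_mono2' L_nonneg) auto

text \<open>Dominated convergence after scaling: slow variation gives the pointwise limit, the
  Potter bound the domination, and \<open>cos_rem_integral\<close> the value.\<close>

lemma tail_rem_noneven:
  assumes "\<alpha> \<noteq> 2 * real N + 2" and sc: "slow_scale L"
  shows "((\<lambda>s. tail_rem (1 / s) * s powr \<alpha> / L s) \<longlongrightarrow> - pi / (sin (pi * \<alpha> / 2) * Gamma (\<alpha> + 1))) at_top"
proof -
  have N2: "\<alpha> < 2 * real N + 2" using assms N by simp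
  \<comment> \<open>Half the distance from \<alpha> to the nearer of 2 N and 2 N + 2, so that
    \<alpha> - d and \<alpha> + d both stay in the interval where the Taylor remainder is
    integrable.\<close>
  define d where "d = min (\<alpha> - 2 * real N) (2 * real N + 2 - \<alpha>) / 2"
  have d: "d > 0" "d < \<alpha> - 2 * real N" "d < 2 * real N + 2 - \<alpha>" using N(1) N2 by (auto simp: d_def)
  obtain C s0 where C: "C > 0" "s0 > 0" "\<And>s. s \<ge> s0 \<Longrightarrow> 0 < L s"
    "\<And>s u. s \<ge> s0 \<Longrightarrow> 0 < u \<Longrightarrow> \<bar>L (u * s)\<bar> \<le> C * (u powr d + u powr (- d)) * L s"
    using slow_scale_potter[OF sc d(1)] by auto
  define g where "g = (\<lambda>s u. cos_rem N u * (f (u * s) * s powr (\<alpha> + 1)) / L s)"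
  define m where "m = (\<lambda>e u::real. 2 * min (\<bar>u\<bar> powr (2 * real N + 2 + e)) (\<bar>u\<bar> powr (2 * real N + e)))"
  have "((\<lambda>s. \<integral>u. g s u \<partial>lborel) \<longlongrightarrow> (\<integral>u. cos_rem N u * \<bar>u\<bar> powr (- \<alpha> - 1) \<partial>lborel)) at_top"
  proof (rule integral_dominated_convergence_at_top[where w = "\<lambda>u. C * (m (- \<alpha> - 1 + d) u + m (- \<alpha> - 1 - d) u)"])
    show "integrable lborel (\<lambda>u. C * (m (- \<alpha> - 1 + d) u + m (- \<alpha> - 1 - d) u))"
      unfolding m_def using d
      by (intro integrable_mult_right Bochner_Integration.integrable_add integrable_min_powr) auto
    show "AE u in lborel. ((\<lambda>s. g s u) \<longlongrightarrow> cos_rem N u * \<bar>u\<bar> powr (- \<alpha> - 1)) at_top"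
      using AE_lborel_singleton[of "0::real"]
    proof eventually_elim
      case (elim u)
      have 1: "((\<lambda>s. L (\<bar>u\<bar> * s) / L s) \<longlongrightarrow> 1) at_top"
        using sc elim by (auto simp: slow_scale_def slowly_varying_def)
      have "((\<lambda>s::real. 1 / s + \<bar>u\<bar>) \<longlongrightarrow> 0 + \<bar>u\<bar>) at_top"
        by (intro tendsto_add tendsto_const tendsto_divide_0[OF tendsto_const]) (auto intro: filterlim_at_top_imp_at_infinity filterlim_ident)
      then have 2: "((\<lambda>s. (1 / s + \<bar>u\<bar>) powr (- \<alpha> - 1)) \<longlongrightarrow> \<bar>u\<bar> powr (- \<alpha> - 1)) at_top"
        using elim by (intro tendsto_powr tendsto_const) auto
      have "((\<lambda>s. cos_rem N u * (1 / s + \<bar>u\<bar>) powr (- \<alpha> - 1) * (L (\<bar>u\<bar> * s) / L s)) \<longlongrightarrow> cos_rem N u * \<bar>u\<bar> powr (- \<alpha> - 1) * 1) at_top"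
        by (intro tendsto_mult tendsto_const 1 2)
      moreover have "\<forall>\<^sub>F s in at_top. cos_rem N u * (1 / s + \<bar>u\<bar>) powr (- \<alpha> - 1) * (L (\<bar>u\<bar> * s) / L s) = g s u"
        using eventually_gt_at_top[of "0::real"]
        by eventually_elim (simp add: g_def f_scaled)
      ultimately show ?case by (simp add: filterlim_cong)
    qed
    show "\<forall>\<^sub>F s in at_top. AE u in lborel. norm (g s u) \<le> C * (m (- \<alpha> - 1 + d) u + m (- \<alpha> - 1 - d) u)"
      using eventually_ge_at_top[of s0]
    proof eventually_elim
      case (elim s)
      have sp: "s > 0" and Ls: "L s > 0" using C elim by auto
      show ?case using AE_lborel_singleton[of "0::real"]
      proof eventually_elim
        case (elim u)
        have "f (u * s) * s powr (\<alpha> + 1) / L s \<le> \<bar>u\<bar> powr (- \<alpha> - 1) * L (\<bar>u\<bar> * s) / L s"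
          using Ls by (intro divide_right_mono f_scaled_le sp elim) auto
        also have "\<dots> \<le> \<bar>u\<bar> powr (- \<alpha> - 1) * (C * (\<bar>u\<bar> powr d + \<bar>u\<bar> powr (- d)))"
        proof -
          have "L (\<bar>u\<bar> * s) \<le> C * (\<bar>u\<bar> powr d + \<bar>u\<bar> powr (- d)) * L s"
            using C(4)[OF \<open>s \<ge> s0\<close>, of "\<bar>u\<bar>"] elim by auto
          then have "L (\<bar>u\<bar> * s) / L s \<le> C * (\<bar>u\<bar> powr d + \<bar>u\<bar> powr (- d))"
            using Ls by (simp add: field_simps)
          then show ?thesis unfolding times_divide_eq_right[symmetric] by (intro mult_left_mono) auto
        qed
        also have "\<dots> = C * (\<bar>u\<bar> powr (- \<alpha> - 1 + d) + \<bar>u\<bar> powr (- \<alpha> - 1 - d))"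
          using powr_add[of "\<bar>u\<bar>" "- \<alpha> - 1" d] powr_add[of "\<bar>u\<bar>" "- \<alpha> - 1" "- d"] by (simp add: distrib_left mult_ac)
        finally have "\<bar>cos_rem N u\<bar> * (f (u * s) * s powr (\<alpha> + 1) / L s) \<le> \<bar>cos_rem N u\<bar> * (C * (\<bar>u\<bar> powr (- \<alpha> - 1 + d) + \<bar>u\<bar> powr (- \<alpha> - 1 - d)))"
          by (intro mult_left_mono) auto
        also have "\<dots> = C * (\<bar>cos_rem N u\<bar> * \<bar>u\<bar> powr (- \<alpha> - 1 + d) + \<bar>cos_rem N u\<bar> * \<bar>u\<bar> powr (- \<alpha> - 1 - d))"
          by (simp add: algebra_simps)
        also have "\<dots> \<le> C * (m (- \<alpha> - 1 + d) u + m (- \<alpha> - 1 - d) u)"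
          unfolding m_def using C(1) by (intro mult_left_mono add_mono cos_rem_powr_bound) auto
        finally show ?case using Ls f_nonneg[of "u * s"] by (simp add: g_def abs_mult)
      qed
    qed
  qed (auto simp: g_def m_def)
  moreover have "\<forall>\<^sub>F s in at_top. (\<integral>u. g s u \<partial>lborel) = tail_rem (1 / s) * s powr \<alpha> / L s"
    using eventually_gt_at_top[of "0::real"]
    by eventually_elim (simp add: g_def tail_rem_scaled)
  ultimately show ?thesis
    using cos_rem_integral[OF N(1) N2] by (simp add: filterlim_cong)
qed

text \<open>In the variable x = u s this is the integral of x^\<alpha> f(x) over (0, s]. The part up
  to 1 is at most K. Beyond 1 the integrand is (x / (1 + x))^(\<alpha> + 1) L(x) / x, which differs
  from L(x) / x by O(x^(-2)), so the error is bounded uniformly in s.\<close>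

lemma tail_integral_even:
  assumes \<alpha>: "\<alpha> = 2 * real N + 2" and s: "s \<ge> 1"
  shows "\<bar>(\<integral>u. indicator {0<..1} u * (u powr \<alpha> * (f (u * s) * s powr (\<alpha> + 1))) \<partial>lborel) - zeta_sv L s\<bar>
    \<le> K + (\<integral>x. K * (\<alpha> + 1) * min (\<bar>x\<bar> powr 0) (\<bar>x\<bar> powr - 2) \<partial>lborel)"
proof -
  have sp: "s > 0" using s by simp
  define A where "A = (\<lambda>x. indicator {0<..1} x * (x powr \<alpha> * f x))"
  define B where "B = (\<lambda>x. indicator {1<..s} x * (x powr \<alpha> * f x))"
  define Z where "Z = (\<lambda>x. indicator {1<..<s} x * (L x / x))"
  have xf: "x powr \<alpha> * f x \<le> K" if "x > 0" for x
  proof -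
    have "x powr \<alpha> * f x \<le> x powr \<alpha> * (K * (1 + \<bar>x\<bar>) powr (- (\<alpha> + 1)))"
      by (intro mult_left_mono f_le) auto
    also have "\<dots> \<le> (1 + x) powr \<alpha> * (K * (1 + x) powr (- (\<alpha> + 1)))"
      using that alpha_pos K_nonneg by (simp add: mult_right_mono powr_mono2)
    also have "\<dots> = K * (1 + x) powr (- 1)"
      using powr_add[of "1 + x" \<alpha> "- (\<alpha> + 1)"] by simp
    also have "\<dots> \<le> K * 1"
      using that K_nonneg by (intro mult_left_mono) (auto simp: powr_minus_divide)
    finally show ?thesis by simp
  qed
  have iK: "integrable lborel (\<lambda>x::real. indicator {a..b} x * K)" for a b
    by (intro integrable_mult_left integrable_real_indicator) (auto simp: emeasure_lborel_Icc_eq)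
  have iA: "integrable lborel A" unfolding A_def
    by (rule Bochner_Integration.integrable_bound[OF iK[of 0 1]])
       (use xf f_nonneg K_nonneg in \<open>auto simp: indicator_def\<close>)
  have iB: "integrable lborel B" unfolding B_def
    by (rule Bochner_Integration.integrable_bound[OF iK[of 0 s]])
       (use xf f_nonneg K_nonneg in \<open>auto simp: indicator_def\<close>)
  have Z_eq: "Z = (\<lambda>x. indicator {1<..<s} x * ((1 + \<bar>x\<bar>) powr (\<alpha> + 1) * f x / x))"
    by (intro ext) (auto simp: Z_def indicator_def L_eq)
  have mZ [measurable]: "Z \<in> borel_measurable borel" unfolding Z_eq by measurable
  have Lx: "L x / x \<le> K" if "x \<ge> 1" for x
  proof -
    have "L x / x \<le> L x / 1" using that L_nonneg[of x] by (intro divide_left_mono) auto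
    then show ?thesis using L_le[of x] that by simp
  qed
  have iZ: "integrable lborel Z"
  proof (rule Bochner_Integration.integrable_bound[OF iK[of 0 s]])
    show "AE x in lborel. norm (Z x) \<le> norm (indicator {0..s} x * K)"
      using Lx L_nonneg K_nonneg by (auto simp: Z_def indicator_def)
  qed measurable
  have zeta: "zeta_sv L s = (\<integral>x. Z x \<partial>lborel)"
    using s by (simp add: zeta_sv_def interval_lebesgue_integral_def set_lebesgue_integral_def Z_def einterval_def greaterThanLessThan_def greaterThan_def lessThan_def Int_def)
  have e1: "(\<integral>u. indicator {0<..1} u * (u powr \<alpha> * (f (u * s) * s powr (\<alpha> + 1))) \<partial>lborel) = (\<integral>x. A x + B x \<partial>lborel)"
  proof -
    have "(\<integral>x. A x + B x \<partial>lborel) = (\<integral>x. indicator {0<..s} x * (x powr \<alpha> * f x) \<partial>lborel)"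
      using s by (intro Bochner_Integration.integral_cong) (auto simp: A_def B_def indicator_def)
    also have "\<dots> = (\<integral>u. s * (indicator {0<..s} (s * u) * ((s * u) powr \<alpha> * f (s * u))) \<partial>lborel)"
      using sp by (subst lborel_integral_real_affine[where c = s and t = 0]) auto
    also have "\<dots> = (\<integral>u. indicator {0<..1} u * (u powr \<alpha> * (f (u * s) * s powr (\<alpha> + 1))) \<partial>lborel)"
    proof (intro Bochner_Integration.integral_cong refl)
      fix u
      show "s * (indicator {0<..s} (s * u) * ((s * u) powr \<alpha> * f (s * u))) = indicator {0<..1} u * (u powr \<alpha> * (f (u * s) * s powr (\<alpha> + 1)))"
        using sp by (cases "u > 0") (auto simp: indicator_def zero_less_mult_iff powr_mult powr_add mult_ac)
    qed
    finally show ?thesis by simp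
  qed
  have A_le: "\<bar>\<integral>x. A x \<partial>lborel\<bar> \<le> K"
  proof -
    have "\<bar>\<integral>x. A x \<partial>lborel\<bar> \<le> (\<integral>x. \<bar>A x\<bar> \<partial>lborel)" by (rule integral_abs_bound)
    also have "\<dots> \<le> (\<integral>x. indicator {0..1::real} x * K \<partial>lborel)"
      by (rule Bochner_Integration.integral_mono[OF integrable_abs[OF iA] iK])
        (use xf f_nonneg K_nonneg in \<open>auto simp: A_def indicator_def\<close>)
    also have "\<dots> = K" by simp
    finally show ?thesis .
  qed
  let ?m = "\<lambda>x::real. K * (\<alpha> + 1) * min (\<bar>x\<bar> powr 0) (\<bar>x\<bar> powr - 2)"
  have im: "integrable lborel ?m" by (intro integrable_mult_right integrable_min_powr) auto
  have BZ: "\<bar>\<integral>x. B x - Z x \<partial>lborel\<bar> \<le> (\<integral>x. ?m x \<partial>lborel)"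
  proof -
    have "\<bar>\<integral>x. B x - Z x \<partial>lborel\<bar> \<le> (\<integral>x. \<bar>B x - Z x\<bar> \<partial>lborel)" by (rule integral_abs_bound)
    also have "\<dots> \<le> (\<integral>x. ?m x \<partial>lborel)"
    proof (rule integral_mono_AE)
      show "integrable lborel (\<lambda>x. \<bar>B x - Z x\<bar>)" by (intro integrable_abs Bochner_Integration.integrable_diff iB iZ)
      \<comment> \<open>The point s belongs to the support of \<open>B\<close> but not to the open
        interval of \<open>Z\<close>; it is removed as a null set.\<close>
      show "AE x in lborel. \<bar>B x - Z x\<bar> \<le> ?m x"
        using AE_lborel_singleton[of s]
      proof eventually_elim
        case (elim x)
        have m0: "0 \<le> ?m x" using K_nonneg alpha_pos by simp
        show ?case
        proof (cases "1 < x \<and> x < s")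
          case True
          then have x: "x > 1" by simp
          define y where "y = 1 / (1 + x)"
          have y: "0 < y" "y < 1" using x by (auto simp: y_def)
          have "x powr \<alpha> * f x = (x powr \<alpha> * (1 + x) powr (- (\<alpha> + 1))) * L x"
            using x by (simp add: f_eq)
          also have "x powr \<alpha> * (1 + x) powr (- (\<alpha> + 1)) = (x / (1 + x)) powr (\<alpha> + 1) / x"
          proof -
            have "x powr (p - 1) * (1 + x) powr (- p) = (x / (1 + x)) powr p / x" for p
              using x by (simp add: powr_divide powr_minus_divide powr_diff)
            from this[of "\<alpha> + 1"] show ?thesis by simp
          qed
          also have "x / (1 + x) = 1 - y" using x by (simp add: y_def field_simps)
          finally have e: "B x - Z x = ((1 - y) powr (\<alpha> + 1) - 1) * (L x / x)"
            using True by (simp add: B_def Z_def field_simps)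
          \<comment> \<open>For even \<alpha> the exponent \<alpha> + 1 is the natural number 2 N +
            3, and Bernoulli's inequality applies.\<close>
          have b1: "\<bar>(1 - y) powr (\<alpha> + 1) - 1\<bar> \<le> (\<alpha> + 1) * y"
          proof -
            have "\<alpha> + 1 = real (2 * N + 3)" using \<alpha> by simp
            then have p: "(1 - y) powr (\<alpha> + 1) = (1 + (- y)) ^ (2 * N + 3)" using y by (simp only: powr_realpow) simp
            have "1 + real (2 * N + 3) * (- y) \<le> (1 + (- y)) ^ (2 * N + 3)"
              using y by (intro Bernoulli_inequality) auto
            moreover have "(1 + (- y)) ^ (2 * N + 3) \<le> 1" using y by (intro power_le_one) auto
            ultimately show ?thesis unfolding p using \<alpha> by (simp add: abs_le_iff algebra_simps)
          qed
          have b2: "\<bar>L x / x\<bar> \<le> K / x" using x L_nonneg[of x] L_le[of x] by (simp add: divide_right_mono)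
          have "0 \<le> (\<alpha> + 1) * y" using y alpha_pos by simp
          then have "\<bar>B x - Z x\<bar> \<le> (\<alpha> + 1) * y * (K / x)"
            unfolding e abs_mult[of "_ - _"] by (rule mult_mono[OF b1 b2]) simp
          also have "\<dots> \<le> (\<alpha> + 1) * (1 / x) * (K / x)"
            using x K_nonneg alpha_pos by (intro mult_right_mono mult_left_mono) (auto simp: y_def field_simps)
          also have "\<dots> = K * (\<alpha> + 1) * (\<bar>x\<bar> powr - 2)"
            using x by (simp add: powr_minus_divide powr_numeral power2_eq_square)
          also have "\<bar>x\<bar> powr - 2 = min (\<bar>x\<bar> powr 0) (\<bar>x\<bar> powr - 2)"
            using x powr_mono[of "- 2" 0 "\<bar>x\<bar>"] by (simp add: min_def)
          finally show ?thesis .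
        next
          case False
          then have "B x = 0" "Z x = 0" using elim by (auto simp: B_def Z_def indicator_def)
          then show ?thesis using m0 by simp
        qed
      qed
    qed (rule im)
    finally show ?thesis .
  qed
  have "(\<integral>x. A x + B x \<partial>lborel) - (\<integral>x. Z x \<partial>lborel) = (\<integral>x. A x \<partial>lborel) + (\<integral>x. B x - Z x \<partial>lborel)"
    using iA iB iZ by simp
  then show ?thesis unfolding e1 zeta using A_le BZ by linarith
qed

text \<open>\<open>e0\<close> is the coefficient of u^\<alpha> in the cosine series. Removing that
  term on |u| \<le> 1 improves the order of the remainder at 0, and the cut-off preserves its decay
  at infinity, so \<open>\<rho>\<close> contributes a bounded amount. The removed term contributes 2
  \<open>e0\<close> zeta_L up to a bounded amount, the factor 2 coming from the two tails. Dividing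
  by zeta_L \<rightarrow> \<infinity> leaves 2 \<open>e0\<close>.\<close>

lemma tail_rem_even:
  assumes \<alpha>: "\<alpha> = 2 * real N + 2" and lim: "filterlim (zeta_sv L) at_top at_top"
  shows "((\<lambda>s. tail_rem (1 / s) * s powr \<alpha> / zeta_sv L s) \<longlongrightarrow> (-1) ^ Suc N * 2 / Gamma (\<alpha> + 1)) at_top"
proof -
  define e0 :: real where "e0 = (-1) ^ Suc N / fact (2 * N + 2)"
  have G: "Gamma (\<alpha> + 1) = fact (2 * N + 2)"
    using Gamma_fact[of "2 * N + 2", where 'a = real] \<alpha> by (simp add: add_ac)
  define \<rho> where "\<rho> = (\<lambda>u. cos_rem N u - e0 * (indicator {-1..1} u * \<bar>u\<bar> powr \<alpha>))"
  let ?m = "\<lambda>u::real. 2 * K * min (\<bar>u\<bar> powr 1) (\<bar>u\<bar> powr - 3)"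
  have im: "integrable lborel ?m" by (intro integrable_mult_right integrable_min_powr) auto
  have u_pow: "\<bar>u\<bar> powr \<alpha> = u ^ (2 * N + 2)" if "u \<noteq> 0" for u
    using powr_realpow[of "\<bar>u\<bar>" "2 * N + 2"] that \<alpha> by (simp add: power_abs[symmetric] add_ac power_even_abs)
  have \<rho>_bd: "\<bar>\<rho> u\<bar> * \<bar>u\<bar> powr (- \<alpha> - 1) \<le> 2 * min (\<bar>u\<bar> powr 1) (\<bar>u\<bar> powr - 3)" if u: "u \<noteq> 0" for u
  proof (cases "\<bar>u\<bar> \<le> 1")
    case True
    have "\<rho> u = cos_rem (Suc N) u"
      using True u_pow[OF u] by (simp add: \<rho>_def cos_rem_Suc e0_def indicator_def abs_le_iff)
    then have "\<bar>\<rho> u\<bar> * \<bar>u\<bar> powr (- \<alpha> - 1) \<le> 2 * min (\<bar>u\<bar> powr (2 * real (Suc N) + 2 + (- \<alpha> - 1))) (\<bar>u\<bar> powr (2 * real (Suc N) + (- \<alpha> - 1)))"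
      using cos_rem_powr_bound[of "Suc N" u "- \<alpha> - 1"] by simp
    also have "\<dots> \<le> 2 * \<bar>u\<bar> powr 1" using \<alpha> by simp
    also have "\<bar>u\<bar> powr 1 = min (\<bar>u\<bar> powr 1) (\<bar>u\<bar> powr - 3)"
      using powr_mono'[of "- 3" 1 "\<bar>u\<bar>"] True by simp
    finally show ?thesis .
  next
    case False
    have "\<rho> u = cos_rem N u" using False by (auto simp: \<rho>_def indicator_def)
    then have "\<bar>\<rho> u\<bar> * \<bar>u\<bar> powr (- \<alpha> - 1) \<le> 2 * min (\<bar>u\<bar> powr (2 * real N + 2 + (- \<alpha> - 1))) (\<bar>u\<bar> powr (2 * real N + (- \<alpha> - 1)))"
      using cos_rem_powr_bound[of N u "- \<alpha> - 1"] by simp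
    also have "\<dots> \<le> 2 * \<bar>u\<bar> powr - 3" using \<alpha> by simp
    also have "\<bar>u\<bar> powr - 3 = min (\<bar>u\<bar> powr 1) (\<bar>u\<bar> powr - 3)"
      using powr_mono[of "- 3" 1 "\<bar>u\<bar>"] False by simp
    finally show ?thesis .
  qed
  define B where "B = (\<integral>u. ?m u \<partial>lborel)"
  define B' where "B' = K + (\<integral>x. K * (\<alpha> + 1) * min (\<bar>x\<bar> powr 0) (\<bar>x\<bar> powr - 2) \<partial>lborel)"
  have main: "\<bar>tail_rem (1 / s) * s powr \<alpha> - 2 * e0 * zeta_sv L s\<bar> \<le> B + 2 * \<bar>e0\<bar> * B'" if s: "s \<ge> 1" for s
  proof -
    have sp: "s > 0" using s by simp
    let ?F = "\<lambda>u. f (u * s) * s powr (\<alpha> + 1)"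
    let ?P = "\<lambda>u. indicator {-1..1} u * (\<bar>u\<bar> powr \<alpha> * ?F u)"
    have F0: "0 \<le> ?F u" for u using f_nonneg by simp
    have F_le: "?F u \<le> \<bar>u\<bar> powr (- \<alpha> - 1) * K" if "u \<noteq> 0" for u
      using f_scaled_le[OF sp that] L_le[of "\<bar>u\<bar> * s"] sp
      by (meson abs_ge_zero less_imp_le mult_left_mono mult_nonneg_nonneg order_trans powr_ge_zero)
    have \<rho>F: "AE u in lborel. \<bar>\<rho> u * ?F u\<bar> \<le> ?m u"
      using AE_lborel_singleton[of "0::real"]
    proof eventually_elim
      case (elim u)
      have "\<bar>\<rho> u * ?F u\<bar> = \<bar>\<rho> u\<bar> * ?F u" using f_nonneg by (simp add: abs_mult)
      also have "\<dots> \<le> \<bar>\<rho> u\<bar> * (\<bar>u\<bar> powr (- \<alpha> - 1) * K)" using F_le[OF elim] by (intro mult_left_mono) auto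
      also have "\<dots> = K * (\<bar>\<rho> u\<bar> * \<bar>u\<bar> powr (- \<alpha> - 1))" by simp
      also have "\<dots> \<le> K * (2 * min (\<bar>u\<bar> powr 1) (\<bar>u\<bar> powr - 3))" by (intro mult_left_mono \<rho>_bd elim K_nonneg)
      finally show ?case by simp
    qed
    have i1: "integrable lborel (\<lambda>u. \<rho> u * ?F u)"
      by (rule Bochner_Integration.integrable_bound[OF im])
        (use \<rho>F K_nonneg in \<open>auto simp: \<rho>_def elim!: eventually_mono\<close>)
    have iP: "integrable lborel ?P"
    proof (rule Bochner_Integration.integrable_bound)
      have "integrable lborel (\<lambda>u. f (0 + s * u))"
        using integrable_power_f[of 0] alpha_pos sp by (intro lborel_integrable_real_affine) auto
      then show "integrable lborel ?F" by (intro integrable_mult_left) (simp add: mult.commute)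
      show "AE u in lborel. norm (?P u) \<le> norm (?F u)"
      proof (rule AE_I2)
        fix u
        have "\<bar>u\<bar> powr \<alpha> \<le> 1" if "\<bar>u\<bar> \<le> 1" using that alpha_pos by (intro powr_le1) auto
        then have "indicator {-1..1} u * \<bar>u\<bar> powr \<alpha> \<le> 1" by (auto simp: indicator_def abs_le_iff)
        then have "(indicator {-1..1} u * \<bar>u\<bar> powr \<alpha>) * ?F u \<le> 1 * ?F u" using F0 by (intro mult_right_mono) auto
        then show "norm (?P u) \<le> norm (?F u)" using f_nonneg by (simp add: abs_mult mult.assoc)
      qed
    qed measurable
    have "tail_rem (1 / s) * s powr \<alpha> = (\<integral>u. e0 * ?P u + \<rho> u * ?F u \<partial>lborel)"
      unfolding tail_rem_scaled[OF sp]
      by (intro Bochner_Integration.integral_cong) (auto simp: \<rho>_def algebra_simps)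
    also have "\<dots> = e0 * (\<integral>u. ?P u \<partial>lborel) + (\<integral>u. \<rho> u * ?F u \<partial>lborel)"
      using i1 iP by simp
    finally have 1: "tail_rem (1 / s) * s powr \<alpha> = e0 * (\<integral>u. ?P u \<partial>lborel) + (\<integral>u. \<rho> u * ?F u \<partial>lborel)" .
    have "(\<integral>u. ?P u \<partial>lborel) = 2 * (\<integral>u. indicator {0<..} u * ?P u \<partial>lborel)"
      by (rule integral_even_real[OF iP]) (auto simp: indicator_def f_even)
    also have "(\<integral>u. indicator {0<..} u * ?P u \<partial>lborel) = (\<integral>u. indicator {0<..1} u * (u powr \<alpha> * ?F u) \<partial>lborel)"
      by (intro Bochner_Integration.integral_cong) (auto simp: indicator_def)
    finally have 2: "(\<integral>u. ?P u \<partial>lborel) = 2 * (\<integral>u. indicator {0<..1} u * (u powr \<alpha> * ?F u) \<partial>lborel)" .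
    have 3: "\<bar>\<integral>u. \<rho> u * ?F u \<partial>lborel\<bar> \<le> B"
    proof -
      have "\<bar>\<integral>u. \<rho> u * ?F u \<partial>lborel\<bar> \<le> (\<integral>u. \<bar>\<rho> u * ?F u\<bar> \<partial>lborel)" by (rule integral_abs_bound)
      also have "\<dots> \<le> B" unfolding B_def by (rule integral_mono_AE[OF integrable_abs[OF i1] im \<rho>F])
      finally show ?thesis .
    qed
    define J where "J = (\<integral>u. indicator {0<..1} u * (u powr \<alpha> * ?F u) \<partial>lborel)"
    have 4: "\<bar>J - zeta_sv L s\<bar> \<le> B'"
      using tail_integral_even[OF \<alpha> s] by (simp only: J_def B'_def)
    have "tail_rem (1 / s) * s powr \<alpha> - 2 * e0 * zeta_sv L s = 2 * e0 * (J - zeta_sv L s) + (\<integral>u. \<rho> u * ?F u \<partial>lborel)"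
      unfolding 1 2 J_def[symmetric] by (simp add: algebra_simps)
    also have "\<bar>\<dots>\<bar> \<le> \<bar>2 * e0 * (J - zeta_sv L s)\<bar> + \<bar>\<integral>u. \<rho> u * ?F u \<partial>lborel\<bar>" by (rule abs_triangle_ineq)
    also have "\<bar>2 * e0 * (J - zeta_sv L s)\<bar> = 2 * \<bar>e0\<bar> * \<bar>J - zeta_sv L s\<bar>" by (simp add: abs_mult)
    also have "\<dots> \<le> 2 * \<bar>e0\<bar> * B'" using 4 by (intro mult_left_mono) auto
    finally show ?thesis using 3 by simp
  qed
  have "((\<lambda>s. (B + 2 * \<bar>e0\<bar> * B') / zeta_sv L s) \<longlongrightarrow> 0) at_top"
    by (intro real_tendsto_divide_at_top[OF tendsto_const] lim)
  then have "((\<lambda>s. tail_rem (1 / s) * s powr \<alpha> / zeta_sv L s - 2 * e0) \<longlongrightarrow> 0) at_top"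
  proof (rule Lim_null_comparison[rotated])
    show "\<forall>\<^sub>F s in at_top. norm (tail_rem (1 / s) * s powr \<alpha> / zeta_sv L s - 2 * e0) \<le> (B + 2 * \<bar>e0\<bar> * B') / zeta_sv L s"
      using eventually_ge_at_top[of 1] lim[unfolded filterlim_at_top_dense, rule_format, of 0]
    proof eventually_elim
      case (elim s)
      have "tail_rem (1 / s) * s powr \<alpha> / zeta_sv L s - 2 * e0 = (tail_rem (1 / s) * s powr \<alpha> - 2 * e0 * zeta_sv L s) / zeta_sv L s"
        using elim by (simp add: diff_divide_distrib)
      then show ?case using main[OF elim(1)] elim by (simp add: divide_right_mono)
    qed
  qed
  then have "((\<lambda>s. tail_rem (1 / s) * s powr \<alpha> / zeta_sv L s) \<longlongrightarrow> 2 * e0) at_top"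
    by (rule LIM_zero_cancel)
  moreover have "2 * e0 = (-1) ^ Suc N * 2 / Gamma (\<alpha> + 1)" unfolding G e0_def by simp
  ultimately show ?thesis by (simp only:)
qed

end

section \<open>Taylor expansions and logarithms\<close>

text \<open>k-fold continuous differentiability, by recursion on an unspecified derivative. Closure
  under products, inverses and logarithms is then an induction, and no formula for a higher
  derivative is written down.\<close>

primrec Ck_on :: "nat \<Rightarrow> real set \<Rightarrow> (real \<Rightarrow> real) \<Rightarrow> bool" where
  "Ck_on 0 S h \<longleftrightarrow> continuous_on S h"
| "Ck_on (Suc k) S h \<longleftrightarrow> (\<exists>h'. (\<forall>x\<in>S. (h has_real_derivative h' x) (at x)) \<and> Ck_on k S h')"

lemma Ck_on_SucD: "Ck_on (Suc k) S h \<Longrightarrow> Ck_on k S h"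
proof (induction k arbitrary: h)
  case 0
  then obtain h' where "\<forall>x\<in>S. (h has_real_derivative h' x) (at x)" by auto
  then show ?case using DERIV_isCont by (auto intro!: continuous_at_imp_continuous_on)
next
  case (Suc k)
  obtain h' where "\<forall>x\<in>S. (h has_real_derivative h' x) (at x)" "Ck_on (Suc k) S h'"
    using Suc.prems unfolding Ck_on.simps(2)[of "Suc k"] by blast
  then show ?case using Suc.IH[of h'] by auto
qed

lemma Ck_on_const: "Ck_on k S (\<lambda>_. c)"
proof (induction k arbitrary: c)
  case (Suc k)
  then show ?case using DERIV_const by (auto intro!: exI[of _ "\<lambda>_. 0"])
qed simp

lemma Ck_on_add: "Ck_on k S g \<Longrightarrow> Ck_on k S h \<Longrightarrow> Ck_on k S (\<lambda>x. g x + h x)"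
proof (induction k arbitrary: g h)
  case (Suc k)
  then obtain g' h' where "\<forall>x\<in>S. (g has_real_derivative g' x) (at x)" "Ck_on k S g'"
      "\<forall>x\<in>S. (h has_real_derivative h' x) (at x)" "Ck_on k S h'" by auto
  then show ?case using Suc.IH by (auto intro!: exI[of _ "\<lambda>x. g' x + h' x"] DERIV_add)
qed (auto intro: continuous_on_add)

lemma Ck_on_mult: "Ck_on k S g \<Longrightarrow> Ck_on k S h \<Longrightarrow> Ck_on k S (\<lambda>x. g x * h x)"
proof (induction k arbitrary: g h)
  case (Suc k)
  then obtain g' h' where 1: "\<forall>x\<in>S. (g has_real_derivative g' x) (at x)" "Ck_on k S g'"
      "\<forall>x\<in>S. (h has_real_derivative h' x) (at x)" "Ck_on k S h'" by auto
  have "Ck_on k S g" "Ck_on k S h" using Suc.prems by (auto dest!: Ck_on_SucD simp del: Ck_on.simps)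
  then have "Ck_on k S (\<lambda>x. g' x * h x + h' x * g x)" using 1 Suc.IH by (intro Ck_on_add) auto
  moreover have "\<forall>x\<in>S. ((\<lambda>x. g x * h x) has_real_derivative g' x * h x + h' x * g x) (at x)"
    using 1 by (auto intro!: DERIV_mult)
  ultimately show ?case by auto
qed (auto intro: continuous_on_mult)

lemma Ck_on_inverse: "Ck_on k S g \<Longrightarrow> (\<And>x. x \<in> S \<Longrightarrow> g x \<noteq> 0) \<Longrightarrow> Ck_on k S (\<lambda>x. inverse (g x))"
proof (induction k)
  case (Suc k)
  then obtain g' where 1: "\<forall>x\<in>S. (g has_real_derivative g' x) (at x)" "Ck_on k S g'" by auto
  have "Ck_on k S (\<lambda>x. inverse (g x))" using Suc by (auto dest!: Ck_on_SucD simp del: Ck_on.simps)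
  then have "Ck_on k S (\<lambda>x. - 1 * (inverse (g x) * g' x * inverse (g x)))"
    using 1 by (intro Ck_on_mult Ck_on_const)
  moreover have "\<forall>x\<in>S. ((\<lambda>x. inverse (g x)) has_real_derivative - 1 * (inverse (g x) * g' x * inverse (g x))) (at x)"
    using 1 Suc.prems(2) by (auto intro!: derivative_eq_intros)
  ultimately show ?case by (auto simp del: mult_minus1)
qed (auto intro: continuous_on_inverse)

text \<open>One derivative suffices: g' / g is already covered by the closure under products and
  inverses.\<close>

lemma Ck_on_ln:
  assumes "Ck_on k S g" "\<And>x. x \<in> S \<Longrightarrow> g x > 0"
  shows "Ck_on k S (\<lambda>x. ln (g x))"
proof (cases k)
  case 0
  then show ?thesis using assms by (force intro!: continuous_on_ln)
next
  case (Suc j)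
  then obtain g' where 1: "\<forall>x\<in>S. (g has_real_derivative g' x) (at x)" "Ck_on j S g'" using assms by auto
  have "Ck_on j S g" using assms(1) unfolding Suc by (rule Ck_on_SucD)
  then have "Ck_on j S (\<lambda>x. g' x * inverse (g x))"
    using 1 assms(2) by (intro Ck_on_mult Ck_on_inverse) force+
  moreover have "\<forall>x\<in>S. ((\<lambda>x. ln (g x)) has_real_derivative g' x * inverse (g x)) (at x)"
    using 1 assms(2) by (auto intro!: derivative_eq_intros simp: divide_inverse)
  ultimately show ?thesis using Suc by auto
qed

lemma Ck_on_trig_moment:
  assumes "\<And>j. j \<le> k + m \<Longrightarrow> integrable lborel (\<lambda>s. s ^ j * w s)"
  shows "Ck_on k S (trig_moment w c m)"
  using assms
proof (induction k arbitrary: m)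
  case 0
  then show ?case by (auto intro!: continuous_at_imp_continuous_on continuous_trig_moment)
next
  case (Suc k)
  have "Ck_on k S (trig_moment w c (Suc m))" by (rule Suc.IH) (use Suc.prems in auto)
  moreover have "(trig_moment w c m has_real_derivative trig_moment w c (Suc m) x) (at x)" for x
    by (rule trig_moment_has_derivative) (rule Suc.prems; simp)+
  ultimately show ?case by auto
qed

lemma Ck_on_derivs:
  assumes "Ck_on n S h"
  obtains diff where "diff 0 = h" "\<And>m x. m < n \<Longrightarrow> x \<in> S \<Longrightarrow> (diff m has_real_derivative diff (Suc m) x) (at x)"
    "continuous_on S (diff n)"
  using assms
proof (induction n arbitrary: h thesis)
  case 0
  then show ?case by (intro 0(1)[of "\<lambda>_. h"]) auto
next
  case (Suc n)
  obtain h' where h': "\<forall>x\<in>S. (h has_real_derivative h' x) (at x)" "Ck_on n S h'" using Suc.prems by auto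
  obtain diff where d: "diff 0 = h'" "\<And>m x. m < n \<Longrightarrow> x \<in> S \<Longrightarrow> (diff m has_real_derivative diff (Suc m) x) (at x)"
    "continuous_on S (diff n)" using Suc.IH[OF _ h'(2)] by blast
  show ?case
  proof (rule Suc.prems(1)[of "\<lambda>m. case m of 0 \<Rightarrow> h | Suc m \<Rightarrow> diff m"])
    fix m x assume "m < Suc n" "x \<in> S"
    then show "((case m of 0 \<Rightarrow> h | Suc m \<Rightarrow> diff m) has_real_derivative (case Suc m of 0 \<Rightarrow> h | Suc m \<Rightarrow> diff m) x) (at x)"
      using h' d by (cases m) auto
  qed (use d in auto)
qed

text \<open>Carries the real derivatives over to the iterated complex-valued derivative in
  \<open>cumulant\<close>. The set is open because each iteration needs agreement in a
  neighbourhood, not just at x.\<close>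

lemma funpow_vector_derivative:
  fixes H :: "real \<Rightarrow> complex"
  assumes S: "open S" and H: "\<And>x. x \<in> S \<Longrightarrow> H x = of_real (diff 0 x)"
    and d: "\<And>m x. m < n \<Longrightarrow> x \<in> S \<Longrightarrow> (diff m has_real_derivative diff (Suc m) x) (at x)"
    and m: "m \<le> n" and x: "x \<in> S"
  shows "((\<lambda>h \<theta>. vector_derivative h (at \<theta>)) ^^ m) H x = of_real (diff m x)"
  using m x
proof (induction m arbitrary: x)
  case 0
  then show ?case using H by simp
next
  case (Suc m)
  have "((\<lambda>x. of_real (diff m x) :: complex) has_vector_derivative of_real (diff (Suc m) x)) (at x)"
    by (rule has_vector_derivative_of_real) (use d Suc.prems in \<open>auto simp: has_real_derivative_iff_has_vector_derivative[symmetric]\<close>)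
  then have "(((\<lambda>h \<theta>. vector_derivative h (at \<theta>)) ^^ m) H has_vector_derivative of_real (diff (Suc m) x)) (at x)"
    by (rule has_vector_derivative_transform_within_open[OF _ S \<open>x \<in> S\<close>]) (use Suc in auto)
  then show ?case by (simp add: vector_derivative_at)
qed

text \<open>The Lagrange remainder of order n together with continuity of the n-th derivative at 0.
  An estimate with n + 1 derivatives would be out of reach, since for \<alpha> close to 2 N the
  moment of order 2 N + 1 can be infinite.\<close>

lemma Taylor_Peano:
  fixes diff :: "nat \<Rightarrow> real \<Rightarrow> real"
  assumes S: "open S" "0 \<in> S"
    and d: "\<And>m x. m < n \<Longrightarrow> x \<in> S \<Longrightarrow> (diff m has_real_derivative diff (Suc m) x) (at x)"
    and cont: "continuous_on S (diff n)"
  shows "((\<lambda>t. (diff 0 t - (\<Sum>m\<le>n. diff m 0 / fact m * t ^ m)) / t ^ n) \<longlongrightarrow> 0) (at 0)"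
proof (rule LIM_I)
  fix r :: real assume r: "r > 0"
  have "isCont (diff n) 0" using cont S continuous_on_eq_continuous_at by blast
  then obtain e1 where e1: "e1 > 0" "\<And>x. \<bar>x\<bar> < e1 \<Longrightarrow> \<bar>diff n x - diff n 0\<bar> < r"
    using r by (force simp: continuous_at_eps_delta dist_real_def)
  obtain e2 where e2: "e2 > 0" "\<And>x. \<bar>x\<bar> < e2 \<Longrightarrow> x \<in> S"
    using S by (metis open_dist dist_real_def diff_zero)
  show "\<exists>s>0. \<forall>x. x \<noteq> 0 \<and> norm (x - 0) < s \<longrightarrow> norm ((diff 0 x - (\<Sum>m\<le>n. diff m 0 / fact m * x ^ m)) / x ^ n - 0) < r"
  proof (intro exI[of _ "min e1 e2"] conjI allI impI)
    fix x :: real assume x: "x \<noteq> 0 \<and> norm (x - 0) < min e1 e2"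
    have "\<exists>t. \<bar>t\<bar> \<le> \<bar>x\<bar> \<and> diff 0 x = (\<Sum>m<n. diff m 0 / fact m * x ^ m) + diff n t / fact n * x ^ n"
      by (rule Maclaurin_bi_le) (use x e2 d in force)+
    then obtain t where t: "\<bar>t\<bar> \<le> \<bar>x\<bar>" "diff 0 x = (\<Sum>m<n. diff m 0 / fact m * x ^ m) + diff n t / fact n * x ^ n" by blast
    have "diff 0 x - (\<Sum>m\<le>n. diff m 0 / fact m * x ^ m) = (diff n t - diff n 0) / fact n * x ^ n"
      unfolding t(2) by (simp only: lessThan_Suc_atMost[symmetric] sum.lessThan_Suc) (simp add: diff_divide_distrib left_diff_distrib)
    then have "norm ((diff 0 x - (\<Sum>m\<le>n. diff m 0 / fact m * x ^ m)) / x ^ n - 0) = \<bar>diff n t - diff n 0\<bar> / fact n"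
      using x by simp
    also have "\<dots> \<le> \<bar>diff n t - diff n 0\<bar> / 1" by (intro divide_left_mono) (auto simp: fact_ge_1)
    also have "\<dots> < r" using e1(2)[of t] t(1) x by simp
    finally show "norm ((diff 0 x - (\<Sum>m\<le>n. diff m 0 / fact m * x ^ m)) / x ^ n - 0) < r" .
  qed (use e1 e2 in auto)
qed

text \<open>Uniqueness of Taylor coefficients, with 1 / s in place of t. Once the coefficients below
  m vanish, division by t^m gives an expression that tends to \<open>c m\<close>; by hypothesis it
  also tends to 0.\<close>

lemma polynomial_small_imp_zero:
  fixes c :: "nat \<Rightarrow> real"
  assumes lim: "((\<lambda>s. (\<Sum>m\<le>n. c m * (1 / s) ^ m) * s ^ n) \<longlongrightarrow> 0) at_top" and m: "m \<le> n"
  shows "c m = 0"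
  using m
proof (induction m rule: less_induct)
  case (less m)
  let ?P = "\<lambda>s. \<Sum>m\<le>n. c m * (1 / s) ^ m"
  have inv: "((\<lambda>s::real. (1 / s)) \<longlongrightarrow> 0) at_top" by real_asymp
  have "((\<lambda>s. (?P s * s ^ n) * (1 / s) ^ (n - m)) \<longlongrightarrow> 0 * 0 ^ (n - m)) at_top"
    by (intro tendsto_mult lim tendsto_power inv)
  then have 1: "((\<lambda>s. (?P s * s ^ n) * (1 / s) ^ (n - m)) \<longlongrightarrow> 0) at_top" by simp
  have "((\<lambda>s. \<Sum>j\<in>{m..n}. c j * (1 / s) ^ (j - m)) \<longlongrightarrow> (\<Sum>j\<in>{m..n}. c j * 0 ^ (j - m))) at_top"
    by (intro tendsto_sum tendsto_mult tendsto_const tendsto_power inv)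
  also have "(\<Sum>j\<in>{m..n}. c j * 0 ^ (j - m)) = (\<Sum>j\<in>{m..n}. if j = m then c m else 0)"
    by (intro sum.cong refl) auto
  also have "\<dots> = c m" using less.prems by simp
  finally have 2: "((\<lambda>s. \<Sum>j\<in>{m..n}. c j * (1 / s) ^ (j - m)) \<longlongrightarrow> c m) at_top" .
  have "\<forall>\<^sub>F s in at_top. (\<Sum>j\<in>{m..n}. c j * (1 / s) ^ (j - m)) = (?P s * s ^ n) * (1 / s) ^ (n - m)"
    using eventually_gt_at_top[of 0]
  proof eventually_elim
    case (elim s)
    have "?P s = (\<Sum>j\<in>{m..n}. c j * (1 / s) ^ j)"
    proof (intro sum.mono_neutral_right)
      show "\<forall>j\<in>{..n} - {m..n}. c j * (1 / s) ^ j = 0"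
      proof
        fix j assume "j \<in> {..n} - {m..n}"
        then have "j < m" by auto
        then show "c j * (1 / s) ^ j = 0" using less.IH[of j] less.prems by simp
      qed
    qed auto
    moreover have "s ^ n * (1 / s) ^ (n - m) = s ^ m"
      using elim less.prems by (simp add: power_one_over power_diff field_simps)
    ultimately have "(?P s * s ^ n) * (1 / s) ^ (n - m) = (\<Sum>j\<in>{m..n}. c j * (1 / s) ^ j) * s ^ m"
      by (simp only: mult.assoc)
    also have "\<dots> = (\<Sum>j\<in>{m..n}. c j * (1 / s) ^ (j - m))"
      unfolding sum_distrib_right using elim
      by (intro sum.cong refl) (auto simp: power_one_over power_diff)
    finally show ?case by simp
  qed
  with 2 have "((\<lambda>s. (?P s * s ^ n) * (1 / s) ^ (n - m)) \<longlongrightarrow> c m) at_top"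
    by (rule Lim_transform_eventually)
  with 1 show ?case using tendsto_unique trivial_limit_at_top_linorder by blast
qed

text \<open>The degree bound D is kept apart from the degree itself, so that the constant is a sum
  over a fixed range when p depends on a parameter.\<close>

lemma poly_trunc_bound:
  fixes p :: "'a::real_normed_field poly"
  assumes D: "degree p \<le> D" and h: "norm h \<le> 1"
  shows "norm (poly p h - (\<Sum>i<M. poly.coeff p i * h ^ i)) \<le> norm h ^ M * (\<Sum>i\<le>D. norm (poly.coeff p i))"
proof -
  let ?n = "max D M"
  have "poly p h = (\<Sum>i\<le>?n. poly.coeff p i * h ^ i)"
    unfolding poly_altdef using D by (intro sum.mono_neutral_left) (auto simp: coeff_eq_0)
  also have "{..?n} = {..<M} \<union> {M..?n}" by auto
  also have "(\<Sum>i\<in>{..<M} \<union> {M..?n}. poly.coeff p i * h ^ i) = (\<Sum>i<M. poly.coeff p i * h ^ i) + (\<Sum>i\<in>{M..?n}. poly.coeff p i * h ^ i)"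
    by (rule sum.union_disjoint) auto
  finally have "norm (poly p h - (\<Sum>i<M. poly.coeff p i * h ^ i)) = norm (\<Sum>i\<in>{M..?n}. poly.coeff p i * h ^ i)" by simp
  also have "\<dots> \<le> (\<Sum>i\<in>{M..?n}. norm (poly.coeff p i) * norm h ^ M)"
  proof (rule order_trans[OF norm_sum], intro sum_mono)
    fix i assume "i \<in> {M..?n}"
    then show "norm (poly.coeff p i * h ^ i) \<le> norm (poly.coeff p i) * norm h ^ M"
      unfolding norm_mult norm_power using h by (intro mult_left_mono power_decreasing) auto
  qed
  also have "\<dots> = norm h ^ M * (\<Sum>i\<in>{M..?n}. norm (poly.coeff p i))"
    by (simp add: sum_distrib_left mult.commute)
  also have "(\<Sum>i\<in>{M..?n}. norm (poly.coeff p i)) \<le> (\<Sum>i\<le>?n. norm (poly.coeff p i))"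
    by (intro sum_mono2) auto
  also have "(\<Sum>i\<le>?n. norm (poly.coeff p i)) = (\<Sum>i\<le>D. norm (poly.coeff p i))"
    using D by (intro sum.mono_neutral_right) (auto intro!: coeff_eq_0)
  finally show ?thesis by (simp add: mult_left_mono)
qed

text \<open>The derivative of the left-hand expression is a geometric sum that collapses to - y^N /
  (1 - y), which is at most 2 |y|^N in absolute value for |y| \<le> 1 / 2.\<close>

lemma ln_one_minus_bound:
  fixes y :: real
  assumes y: "\<bar>y\<bar> \<le> 1 / 2"
  shows "\<bar>ln (1 - y) + (\<Sum>k=1..N. y ^ k / real k)\<bar> \<le> 2 * \<bar>y\<bar> ^ Suc N"
proof -
  let ?g = "\<lambda>y::real. ln (1 - y) + (\<Sum>k=1..N. y ^ k / real k)"
  have d: "(?g has_real_derivative - (z ^ N / (1 - z))) (at z)" if z: "\<bar>z\<bar> \<le> 1 / 2" for z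
  proof -
    have z1: "1 - z > 0" using z by linarith
    have "(?g has_real_derivative - 1 / (1 - z) + (\<Sum>k=1..N. real k * z ^ (k - 1) / real k)) (at z)"
      using z1 by (auto intro!: derivative_eq_intros DERIV_sum simp: divide_inverse)
    also have "(\<Sum>k=1..N. real k * z ^ (k - 1) / real k) = (\<Sum>k<N. z ^ k)"
      by (rule sum.reindex_bij_witness[of _ "\<lambda>k. Suc k" "\<lambda>k. k - 1"]) auto
    also have "(\<Sum>k<N. z ^ k) = (1 - z ^ N) / (1 - z)" using z1 by (simp add: sum_gp_strict)
    also have "- 1 / (1 - z) + (1 - z ^ N) / (1 - z) = - (z ^ N / (1 - z))"
      by (simp add: diff_divide_distrib)
    finally show ?thesis .
  qed
  have "norm (?g y - ?g 0) \<le> (2 * \<bar>y\<bar> ^ N) * norm (y - 0)"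
  proof (rule field_differentiable_bound[where S = "{-\<bar>y\<bar>..\<bar>y\<bar>}" and f' = "\<lambda>z. - (z ^ N / (1 - z))"])
    fix z assume "z \<in> {-\<bar>y\<bar>..\<bar>y\<bar>}"
    then have z: "\<bar>z\<bar> \<le> \<bar>y\<bar>" by auto
    show "(?g has_real_derivative - (z ^ N / (1 - z))) (at z within {-\<bar>y\<bar>..\<bar>y\<bar>})"
      using z y by (intro has_field_derivative_at_within[OF d]) linarith
    have "1 / 2 \<le> 1 - z" using z y by (auto simp: abs_le_iff)
    then have "\<bar>z\<bar> ^ N / (1 - z) \<le> \<bar>y\<bar> ^ N / (1 / 2)" using z by (intro frac_le power_mono) auto
    then show "norm (- (z ^ N / (1 - z))) \<le> 2 * \<bar>y\<bar> ^ N" using \<open>1 / 2 \<le> 1 - z\<close> by (simp add: power_abs)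
  qed auto
  moreover have "?g 0 = 0" by (auto intro!: sum.neutral)
  ultimately show ?thesis by (simp add: mult_ac)
qed

text \<open>The Potter bound at the fixed base point s0 with u = s / s0: growth of order at most
  s^(e/2).\<close>

lemma slow_scale_times_powr_tendsto_0:
  assumes "slow_scale \<Lambda>" "e > 0"
  shows "((\<lambda>s. \<Lambda> s * s powr (- e)) \<longlongrightarrow> 0) at_top"
proof -
  obtain C s0 where C: "C > 0" "s0 > 0" "\<And>s. s \<ge> s0 \<Longrightarrow> 0 < \<Lambda> s"
    "\<And>s u. s \<ge> s0 \<Longrightarrow> 0 < u \<Longrightarrow> \<bar>\<Lambda> (u * s)\<bar> \<le> C * (u powr (e/2) + u powr (- (e/2))) * \<Lambda> s"
    using slow_scale_potter[OF assms(1), of "e / 2"] assms(2) by auto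
  have "((\<lambda>s. C * ((s / s0) powr (e/2) + (s / s0) powr (- (e/2))) * \<Lambda> s0 * s powr (- e)) \<longlongrightarrow> 0) at_top"
    using assms(2) C by real_asymp
  then show ?thesis
  proof (rule Lim_null_comparison[rotated])
    show "\<forall>\<^sub>F s in at_top. norm (\<Lambda> s * s powr (- e)) \<le> C * ((s / s0) powr (e/2) + (s / s0) powr (- (e/2))) * \<Lambda> s0 * s powr (- e)"
      using eventually_gt_at_top[of 0]
    proof eventually_elim
      case (elim s)
      show ?case using C(4)[of s0 "s / s0"] C(2) elim by (simp add: abs_mult mult_right_mono)
    qed
  qed
qed

section \<open>Coefficients of powers of polynomials\<close>

lemma coeff_power_cong:
  fixes p q :: "'a::comm_semiring_1 poly"
  assumes "\<And>i. i \<le> m \<Longrightarrow> poly.coeff p i = poly.coeff q i" "i \<le> m"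
  shows "poly.coeff (p ^ k) i = poly.coeff (q ^ k) i"
  using assms(2)
proof (induction k arbitrary: i)
  case (Suc k)
  then show ?case using assms(1) by (auto simp: coeff_mult intro!: sum.cong)
qed simp

lemma coeff_power_less:
  fixes p :: "'a::comm_semiring_1 poly"
  assumes "poly.coeff p 0 = 0" "i < k"
  shows "poly.coeff (p ^ k) i = 0"
  using assms(2)
proof (induction k arbitrary: i)
  case (Suc k)
  have "poly.coeff (p ^ Suc k) i = (\<Sum>j\<le>i. poly.coeff p j * poly.coeff (p ^ k) (i - j))"
    by (simp add: coeff_mult)
  also have "\<dots> = 0"
  proof (intro sum.neutral ballI)
    fix j assume "j \<in> {..i}"
    then show "poly.coeff p j * poly.coeff (p ^ k) (i - j) = 0"
      using Suc assms(1) by (cases "j = 0") auto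
  qed
  finally show ?case .
qed simp

lemma coeff_power_odd:
  fixes p :: "'a::comm_semiring_1 poly"
  assumes "\<And>i. odd i \<Longrightarrow> poly.coeff p i = 0" "odd i"
  shows "poly.coeff (p ^ k) i = 0"
  using assms(2)
proof (induction k arbitrary: i)
  case 0
  then show ?case by (cases i) auto
next
  case (Suc k)
  have "poly.coeff (p ^ Suc k) i = (\<Sum>j\<le>i. poly.coeff p j * poly.coeff (p ^ k) (i - j))"
    by (simp add: coeff_mult)
  also have "\<dots> = 0"
  proof (intro sum.neutral ballI)
    fix j assume "j \<in> {..i}"
    then have "odd j \<or> odd (i - j)" using Suc.prems by auto
    then show "poly.coeff p j * poly.coeff (p ^ k) (i - j) = 0"
      using Suc.IH[of "i - j"] assms(1)[of j] by (cases "odd j") auto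
  qed
  finally show ?case .
qed

section \<open>Cumulants\<close>

text \<open>1 \<le> N reflects \<alpha> > 2: it places the second moment, and with it the Gaussian
  factor, inside the Taylor polynomial of degree 2 N.\<close>

locale heavy_tail_dist = heavy_tail +
  assumes N_pos: "1 \<le> N"
    and mass: "(\<integral>x. f x \<partial>lborel) = 1"
    and second_moment: "(\<integral>x. x\<^sup>2 * f x \<partial>lborel) = 1"
begin

definition phi :: "real \<Rightarrow> real" where
  "phi = trig_moment f 0 0"

definition tcoef :: "nat \<Rightarrow> real" where
  "tcoef k = (-1) ^ k * (\<integral>x. x ^ (2 * k) * f x \<partial>lborel) / fact (2 * k)"

text \<open>As a polynomial in t^2, 1 - \<open>Ypoly\<close> is the Taylor polynomial of the
  characteristic function; the even powers are the only ones because f is symmetric.\<close>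

definition Ypoly :: "real poly" where
  "Ypoly = (\<Sum>k=1..N. monom (- tcoef k) k)"

text \<open>The series of - ln (1 - y) cut after y^N, with y = \<open>Ypoly\<close>. Since y has no
  constant term, the omitted powers are O(t^(2 N + 2)), and the coefficients up to index N are those
  of the full series.\<close>

definition Wpoly :: "real poly" where
  "Wpoly = (\<Sum>k=1..N. smult (1 / real k) (Ypoly ^ k))"

text \<open>The function r of the overview. The sum is added because \<open>Wpoly\<close> expands -
  ln phi, and it stops at t^(2 N) because higher coefficients are not cumulants in general.\<close>

definition log_rem :: "real \<Rightarrow> real" where
  "log_rem t = ln (phi t) + (\<Sum>i<Suc N. poly.coeff Wpoly i * (t\<^sup>2) ^ i)"

lemma phi_eq: "phi t = 1 - poly Ypoly (t\<^sup>2) + tail_rem t"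
proof -
  have "(\<Sum>k\<le>N. tcoef k * t ^ (2 * k)) = tcoef 0 * t ^ (2 * 0) + (\<Sum>k=1..N. tcoef k * t ^ (2 * k))"
    by (simp add: atMost_atLeast0 sum.atLeast_Suc_atMost)
  also have "tcoef 0 = 1" by (simp add: tcoef_def mass)
  also have "(\<Sum>k=1..N. tcoef k * t ^ (2 * k)) = - poly Ypoly (t\<^sup>2)"
    by (simp add: Ypoly_def poly_sum poly_monom power_mult sum_negf)
  finally show ?thesis
    unfolding phi_def trig_moment_eq_tail_rem tcoef_def[symmetric] by simp
qed

lemma coeff_Ypoly: "poly.coeff Ypoly i = (if 1 \<le> i \<and> i \<le> N then - tcoef i else 0)"
  unfolding Ypoly_def coeff_sum coeff_monom by (subst sum.delta) auto

lemma coeff_Ypoly_0: "poly.coeff Ypoly 0 = 0"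
  by (simp add: coeff_Ypoly)

lemma coeff_Wpoly_0: "poly.coeff Wpoly 0 = 0"
  unfolding Wpoly_def coeff_sum by (intro sum.neutral) (auto simp: coeff_power_less[OF coeff_Ypoly_0])

text \<open>This is where the unit variance enters; the coefficient is responsible for the factor
  exp(-t^2/2).\<close>

lemma coeff_Wpoly_1: "poly.coeff Wpoly 1 = 1 / 2"
proof -
  have "poly.coeff Wpoly 1 = (\<Sum>k=1..N. poly.coeff (smult (1 / real k) (Ypoly ^ k)) 1)"
    unfolding Wpoly_def coeff_sum ..
  also have "\<dots> = (\<Sum>k=1..N. if k = 1 then poly.coeff Ypoly 1 else 0)"
    by (intro sum.cong refl) (auto simp: coeff_power_less[OF coeff_Ypoly_0])
  also have "\<dots> = poly.coeff Ypoly 1" using N_pos by simp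
  also have "\<dots> = 1 / 2" using N_pos second_moment by (simp add: coeff_Ypoly tcoef_def power2_eq_square)
  finally show ?thesis .
qed

lemma poly_Wpoly: "poly Wpoly s = (\<Sum>k=1..N. poly Ypoly s ^ k / real k)"
  by (simp add: Wpoly_def poly_sum poly_power)

lemma poly_Ypoly_bound:
  obtains C where "C \<ge> 0" "\<And>t. \<bar>t\<bar> \<le> 1 \<Longrightarrow> \<bar>poly Ypoly (t\<^sup>2)\<bar> \<le> C * t\<^sup>2"
proof
  fix t :: real assume "\<bar>t\<bar> \<le> 1"
  then have "norm (t\<^sup>2) \<le> 1" by (simp add: abs_square_le_1)
  from poly_trunc_bound[OF order_refl this, of Ypoly 1]
  show "\<bar>poly Ypoly (t\<^sup>2)\<bar> \<le> (\<Sum>i\<le>degree Ypoly. norm (poly.coeff Ypoly i)) * t\<^sup>2"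
    by (simp add: coeff_Ypoly_0 mult.commute)
qed (auto intro: sum_nonneg)

text \<open>Two errors of order t^(2 N + 2) add up: the tail of the logarithmic series at y =
  O(t^2), and the coefficients of \<open>Wpoly\<close> beyond index N.\<close>

lemma ln_taylor_poly_bound:
  obtains C d where "d > 0" "\<And>t. \<bar>t\<bar> < d \<Longrightarrow> \<bar>poly Ypoly (t\<^sup>2)\<bar> \<le> 1 / 2"
    "\<And>t. \<bar>t\<bar> < d \<Longrightarrow> \<bar>ln (1 - poly Ypoly (t\<^sup>2)) + (\<Sum>i<Suc N. poly.coeff Wpoly i * (t\<^sup>2) ^ i)\<bar> \<le> C * (t\<^sup>2) ^ Suc N"
proof -
  obtain C where C: "C \<ge> 0" "\<And>t. \<bar>t\<bar> \<le> 1 \<Longrightarrow> \<bar>poly Ypoly (t\<^sup>2)\<bar> \<le> C * t\<^sup>2"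
    by (rule poly_Ypoly_bound) blast
  \<comment> \<open>Chosen so that (C + 1) |t| \<le> 1 / 2; the summand 1 avoids a zero denominator
    when C = 0.\<close>
  define d where "d = min 1 (1 / (2 * (C + 1)))"
  have d: "d > 0" "d \<le> 1" using C by (auto simp: d_def)
  have Yle: "\<bar>poly Ypoly (t\<^sup>2)\<bar> \<le> 1 / 2" if "\<bar>t\<bar> < d" for t
  proof -
    have "\<bar>poly Ypoly (t\<^sup>2)\<bar> \<le> C * t\<^sup>2" using C(2)[of t] that d by simp
    also have "\<dots> \<le> (C + 1) * \<bar>t\<bar>"
    proof -
      have "t\<^sup>2 \<le> \<bar>t\<bar>" using that d power_decreasing[of 1 2 "\<bar>t\<bar>"] by simp
      then show ?thesis using C by (intro mult_mono) auto
    qed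
    also have "\<dots> \<le> (C + 1) * (1 / (2 * (C + 1)))"
      using that C by (intro mult_left_mono) (auto simp: d_def)
    also have "\<dots> = 1 / 2" using C by (simp add: field_simps)
    finally show ?thesis .
  qed
  let ?D = "\<Sum>i\<le>degree Wpoly. norm (poly.coeff Wpoly i)"
  show thesis
  proof (rule that[OF d(1) Yle])
    fix t :: real assume t: "\<bar>t\<bar> < d"
    then have t1: "\<bar>t\<bar> \<le> 1" using d by simp
    then have "norm (t\<^sup>2) \<le> 1" by (simp add: abs_square_le_1)
    from poly_trunc_bound[OF order_refl this, of Wpoly "Suc N"]
    have 1: "\<bar>poly Wpoly (t\<^sup>2) - (\<Sum>i<Suc N. poly.coeff Wpoly i * (t\<^sup>2) ^ i)\<bar> \<le> ?D * (t\<^sup>2) ^ Suc N"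
      by (simp add: mult.commute)
    have 2: "\<bar>ln (1 - poly Ypoly (t\<^sup>2)) + poly Wpoly (t\<^sup>2)\<bar> \<le> 2 * \<bar>poly Ypoly (t\<^sup>2)\<bar> ^ Suc N"
      unfolding poly_Wpoly by (rule ln_one_minus_bound[OF Yle[OF t]])
    also have "\<dots> \<le> 2 * (C * t\<^sup>2) ^ Suc N"
      using C(2)[OF t1] by (intro mult_left_mono power_mono) auto
    also have "\<dots> = 2 * C ^ Suc N * (t\<^sup>2) ^ Suc N" by (simp add: power_mult_distrib)
    finally show "\<bar>ln (1 - poly Ypoly (t\<^sup>2)) + (\<Sum>i<Suc N. poly.coeff Wpoly i * (t\<^sup>2) ^ i)\<bar> \<le> (?D + 2 * C ^ Suc N) * (t\<^sup>2) ^ Suc N"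
      using 1 unfolding distrib_right by linarith
  qed
qed

lemma tail_rem_bound: "\<bar>tail_rem t\<bar> \<le> 2 * t ^ (2 * N) * (\<integral>x. x ^ (2 * N) * f x \<partial>lborel)"
proof -
  have i: "integrable lborel (\<lambda>x. 2 * t ^ (2 * N) * (x ^ (2 * N) * f x))"
    using N by (intro integrable_mult_right integrable_power_f) simp
  have b: "\<bar>cos_rem N (t * x) * f x\<bar> \<le> 2 * t ^ (2 * N) * (x ^ (2 * N) * f x)" for x
  proof -
    have "\<bar>cos_rem N (t * x) * f x\<bar> = \<bar>cos_rem N (t * x)\<bar> * f x" using f_nonneg by (simp add: abs_mult)
    also have "\<dots> \<le> (2 * \<bar>t * x\<bar> ^ (2 * N)) * f x" by (intro mult_right_mono cos_rem_le2 f_nonneg)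
    finally show ?thesis by (simp add: power_mult_distrib power_even_abs)
  qed
  have "\<bar>tail_rem t\<bar> \<le> (\<integral>x. \<bar>cos_rem N (t * x) * f x\<bar> \<partial>lborel)"
    unfolding tail_rem_def by (rule integral_abs_bound)
  also have "\<dots> \<le> (\<integral>x. 2 * t ^ (2 * N) * (x ^ (2 * N) * f x) \<partial>lborel)"
  proof (rule Bochner_Integration.integral_mono[OF _ i b])
    show "integrable lborel (\<lambda>x. \<bar>cos_rem N (t * x) * f x\<bar>)"
      by (rule Bochner_Integration.integrable_bound[OF i]) (use b in \<open>auto intro!: AE_I2 order_trans[OF _ abs_ge_self]\<close>)
  qed
  finally show ?thesis by (simp only: integral_mult_right_zero)
qed

lemma tail_rem_tendsto_0: "((\<lambda>s. tail_rem (1 / s)) \<longlongrightarrow> 0) at_top"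
proof (rule Lim_null_comparison)
  show "\<forall>\<^sub>F s in at_top. norm (tail_rem (1 / s)) \<le> 2 * (1 / s) ^ (2 * N) * (\<integral>x. x ^ (2 * N) * f x \<partial>lborel)"
    using tail_rem_bound by (intro always_eventually) auto
  have inv: "((\<lambda>s::real. (1 / s)) \<longlongrightarrow> 0) at_top" by real_asymp
  have "((\<lambda>s::real. 2 * (1 / s) ^ (2 * N) * (\<integral>x. x ^ (2 * N) * f x \<partial>lborel)) \<longlongrightarrow> 2 * 0 ^ (2 * N) * (\<integral>x. x ^ (2 * N) * f x \<partial>lborel)) at_top"
    by (intro tendsto_mult tendsto_const tendsto_power inv)
  then show "((\<lambda>s::real. 2 * (1 / s) ^ (2 * N) * (\<integral>x. x ^ (2 * N) * f x \<partial>lborel)) \<longlongrightarrow> 0) at_top"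
    using N_pos by (simp add: power_0_left)
qed

text \<open>phi = P (1 + v) with P the Taylor polynomial and v = \<open>tail_rem\<close> / P
  \<rightarrow> 0. In ln P the polynomial part cancels up to O(t^(2 N + 2)), negligible by
  \<open>small\<close>, and ln (1 + v) is asymptotic to v, hence to \<open>tail_rem\<close>.\<close>

lemma log_rem_limit:
  assumes lim: "((\<lambda>s. tail_rem (1 / s) * s powr \<alpha> / \<Lambda> s) \<longlongrightarrow> c) at_top"
    and small: "((\<lambda>s. s powr (\<alpha> - 2 * real N - 2) / \<Lambda> s) \<longlongrightarrow> 0) at_top"
  shows "((\<lambda>s. log_rem (1 / s) * s powr \<alpha> / \<Lambda> s) \<longlongrightarrow> c) at_top"
proof -
  obtain C d where d: "d > 0" "\<And>t. \<bar>t\<bar> < d \<Longrightarrow> \<bar>poly Ypoly (t\<^sup>2)\<bar> \<le> 1 / 2"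
    "\<And>t. \<bar>t\<bar> < d \<Longrightarrow> \<bar>ln (1 - poly Ypoly (t\<^sup>2)) + (\<Sum>i<Suc N. poly.coeff Wpoly i * (t\<^sup>2) ^ i)\<bar> \<le> C * (t\<^sup>2) ^ Suc N"
    by (rule ln_taylor_poly_bound) blast
  define P where "P = (\<lambda>s::real. 1 - poly Ypoly ((1 / s)\<^sup>2))"
  define E where "E = (\<lambda>s. ln (P s) + (\<Sum>i<Suc N. poly.coeff Wpoly i * ((1 / s)\<^sup>2) ^ i))"
  define v where "v = (\<lambda>s. tail_rem (1 / s) / P s)"
  \<comment> \<open>ln (1 + v) / v continued by its limit at 0, so that ln (1 + v) = v g(v) holds
    also where the tail remainder vanishes.\<close>
  define g where "g = (\<lambda>v::real. if v = 0 then 1 else ln (1 + v) / v)"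
  have inv: "((\<lambda>s::real. (1 / s)) \<longlongrightarrow> 0) at_top" by real_asymp
  have P1: "(P \<longlongrightarrow> 1) at_top"
  proof -
    have "((\<lambda>s::real. 1 - poly Ypoly ((1 / s)\<^sup>2)) \<longlongrightarrow> 1 - poly Ypoly (0\<^sup>2)) at_top"
      by (intro tendsto_intros inv)
    then show ?thesis by (simp add: P_def poly_0_coeff_0 coeff_Ypoly_0)
  qed
  have v0: "(v \<longlongrightarrow> 0) at_top"
    using tendsto_divide[OF tail_rem_tendsto_0 P1] by (simp add: v_def)
  have g_cont: "isCont g 0"
  proof -
    have "((\<lambda>v::real. ln (1 + v) / v) \<longlongrightarrow> 1) (at 0)" by real_asymp
    then show ?thesis unfolding isCont_def g_def
      by (subst tendsto_cong[where g = "\<lambda>v::real. ln (1 + v) / v"]) (auto simp: eventually_at_filter)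
  qed
  have "g 0 = 1" by (simp add: g_def)
  then have gv: "((\<lambda>s. g (v s)) \<longlongrightarrow> 1) at_top"
    using isCont_tendsto_compose[OF g_cont v0] by (simp only:)
  have vm: "eventually (\<lambda>s. - 1 < v s) at_top"
    using order_tendstoD(1)[OF v0, of "- 1"] by simp
  have sd: "eventually (\<lambda>s::real. \<bar>1 / s\<bar> < d) at_top"
    using order_tendstoD(2)[OF tendsto_rabs[OF inv], of d] d(1) by simp
  have "((\<lambda>s. E s * s powr \<alpha> / \<Lambda> s) \<longlongrightarrow> 0) at_top"
  proof (rule Lim_null_comparison)
    show "((\<lambda>s. \<bar>C\<bar> * \<bar>s powr (\<alpha> - 2 * real N - 2) / \<Lambda> s\<bar>) \<longlongrightarrow> 0) at_top"
      using tendsto_mult_right_zero[OF tendsto_rabs_zero[OF small]] .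
    show "\<forall>\<^sub>F s in at_top. norm (E s * s powr \<alpha> / \<Lambda> s) \<le> \<bar>C\<bar> * \<bar>s powr (\<alpha> - 2 * real N - 2) / \<Lambda> s\<bar>"
      using sd eventually_gt_at_top[of 0]
    proof eventually_elim
      case (elim s)
      have "\<bar>E s\<bar> \<le> C * ((1 / s)\<^sup>2) ^ Suc N" unfolding E_def P_def by (rule d(3)[OF elim(1)])
      also have "\<dots> \<le> \<bar>C\<bar> * ((1 / s)\<^sup>2) ^ Suc N" by (intro mult_right_mono) auto
      finally have "\<bar>E s\<bar> * s powr \<alpha> \<le> \<bar>C\<bar> * ((1 / s)\<^sup>2) ^ Suc N * s powr \<alpha>" by (intro mult_right_mono) auto
      also have "\<dots> = \<bar>C\<bar> * (((1 / s)\<^sup>2) ^ Suc N * s powr \<alpha>)" by (rule mult.assoc)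
      also have "((1 / s)\<^sup>2) ^ Suc N * s powr \<alpha> = s powr (\<alpha> - 2 * real N - 2)"
      proof -
        have "((1 / s)\<^sup>2) ^ Suc N = (1 / s) ^ (2 * N + 2)"
        proof -
          have "2 * Suc N = 2 * N + 2" by simp
          then show ?thesis by (simp only: power_mult[symmetric])
        qed
        also have "\<dots> = inverse (s ^ (2 * N + 2))"
          by (simp only: power_one_over inverse_eq_divide)
        also have "\<dots> = s powr (- real (2 * N + 2))"
          using elim by (simp only: powr_minus powr_realpow)
        finally show ?thesis by (simp add: powr_add[symmetric] algebra_simps)
      qed
      finally have "\<bar>E s\<bar> * s powr \<alpha> \<le> \<bar>C\<bar> * s powr (\<alpha> - 2 * real N - 2)" .
      then have "\<bar>E s\<bar> * s powr \<alpha> / \<bar>\<Lambda> s\<bar> \<le> \<bar>C\<bar> * s powr (\<alpha> - 2 * real N - 2) / \<bar>\<Lambda> s\<bar>"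
        by (intro divide_right_mono) auto
      then show ?case by (simp add: abs_mult)
    qed
  qed
  moreover have "((\<lambda>s. tail_rem (1 / s) * s powr \<alpha> / \<Lambda> s / P s * g (v s)) \<longlongrightarrow> c / 1 * 1) at_top"
    by (rule tendsto_mult[OF tendsto_divide[OF lim P1] gv]) simp
  ultimately have "((\<lambda>s. E s * s powr \<alpha> / \<Lambda> s + tail_rem (1 / s) * s powr \<alpha> / \<Lambda> s / P s * g (v s)) \<longlongrightarrow> 0 + c / 1 * 1) at_top"
    by (rule tendsto_add)
  moreover have "\<forall>\<^sub>F s in at_top. E s * s powr \<alpha> / \<Lambda> s + tail_rem (1 / s) * s powr \<alpha> / \<Lambda> s / P s * g (v s) = log_rem (1 / s) * s powr \<alpha> / \<Lambda> s"
    using sd vm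
  proof eventually_elim
    case (elim s)
    have P: "P s > 0" using d(2)[OF elim(1)] by (auto simp: P_def abs_le_iff)
    have v: "1 + v s > 0" using elim by simp
    have "phi (1 / s) = P s * (1 + v s)"
    proof -
      have "P s * (1 + v s) = P s + tail_rem (1 / s)" using P by (simp add: v_def distrib_left)
      then show ?thesis by (simp only: phi_eq P_def)
    qed
    then have "ln (phi (1 / s)) = ln (P s) + ln (1 + v s)" using P v by (simp add: ln_mult)
    also have "ln (1 + v s) = v s * g (v s)" by (simp add: g_def)
    finally have "log_rem (1 / s) = E s + v s * g (v s)" by (simp add: log_rem_def E_def)
    then show ?case by (simp add: v_def add_divide_distrib distrib_right distrib_left mult_ac)
  qed
  ultimately show ?thesis by (simp add: filterlim_cong)
qed

text \<open>r(t) = o(t^(2 N)): slow variation cannot compensate the positive power \<alpha> - 2 N.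
  This is the Peano remainder that identifies the cumulants, and as N \<ge> 1 it also gives n r(t /
  sqrt n) \<rightarrow> 0.\<close>

lemma log_rem_small:
  assumes lim: "((\<lambda>s. log_rem (1 / s) * s powr \<alpha> / \<Lambda> s) \<longlongrightarrow> c) at_top" and sc: "slow_scale \<Lambda>"
  shows "((\<lambda>s. log_rem (1 / s) * s ^ (2 * N)) \<longlongrightarrow> 0) at_top"
proof -
  have "((\<lambda>s. (log_rem (1 / s) * s powr \<alpha> / \<Lambda> s) * (\<Lambda> s * s powr (- (\<alpha> - 2 * real N)))) \<longlongrightarrow> c * 0) at_top"
    using N by (intro tendsto_mult lim slow_scale_times_powr_tendsto_0 sc) simp
  moreover have "eventually (\<lambda>s. 0 < \<Lambda> s) at_top"
    using slow_scale_potter[OF sc zero_less_one] by (metis eventually_at_top_linorder)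
  then have "\<forall>\<^sub>F s in at_top. (log_rem (1 / s) * s powr \<alpha> / \<Lambda> s) * (\<Lambda> s * s powr (- (\<alpha> - 2 * real N))) = log_rem (1 / s) * s ^ (2 * N)"
    using eventually_gt_at_top[of 0]
  proof eventually_elim
    case (elim s)
    have "s powr \<alpha> * s powr (- (\<alpha> - 2 * real N)) = s powr real (2 * N)" by (simp add: powr_add[symmetric])
    also have "\<dots> = s ^ (2 * N)" using elim by (intro powr_realpow) auto
    finally show ?case using elim by (simp add: field_simps)
  qed
  ultimately show ?thesis by (simp add: filterlim_cong)
qed

lemma continuous_phi: "isCont phi t"
  unfolding phi_def using alpha_pos by (intro continuous_trig_moment integrable_power_f) simp

lemma phi_0: "phi 0 = 1"
  by (simp add: phi_def trig_moment_def mass)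

text \<open>The Taylor coefficients of - ln phi indexed by powers of t instead of t^2, so that they
  can be matched with the cumulants of every order.\<close>

definition log_coef :: "nat \<Rightarrow> real" where
  "log_coef l = (if even l then poly.coeff Wpoly (l div 2) else 0)"

lemma sum_log_coef: "(\<Sum>i<Suc N. poly.coeff Wpoly i * (t\<^sup>2) ^ i) = (\<Sum>l\<le>2 * N. log_coef l * t ^ l)"
proof -
  have "(\<Sum>l\<le>2 * N. log_coef l * t ^ l) = (\<Sum>l\<in>{l. l \<le> 2 * N \<and> even l}. log_coef l * t ^ l)"
    by (rule sum.mono_neutral_right) (auto simp: log_coef_def)
  also have "\<dots> = (\<Sum>i<Suc N. poly.coeff Wpoly i * (t\<^sup>2) ^ i)"
    by (rule sum.reindex_bij_witness[of _ "\<lambda>i. 2 * i" "\<lambda>l. l div 2"]) (auto simp: log_coef_def power_mult[symmetric])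
  finally show ?thesis by simp
qed

(* Both the cumulants and log_coef are Taylor coefficients of ln phi at 0, so they agree by uniqueness
   of the Taylor polynomial with Peano remainder. *)
lemma cumulant_eq:
  assumes char: "\<And>t. char D t = of_real (phi t)"
    and small: "((\<lambda>s. log_rem (1 / s) * s ^ (2 * N)) \<longlongrightarrow> 0) at_top"
    and l: "l \<le> 2 * N"
  shows "of_real (cumulant D l) * (\<i> * of_real t) ^ l / fact l = (of_real (- log_coef l * t ^ l) :: complex)"
proof -
  \<comment> \<open>On this neighbourhood of 0 the principal logarithm of the characteristic
    function is the real logarithm of phi.\<close>
  define S where "S = {t. phi t > 0}"
  have S: "open S" "0 \<in> S"
    unfolding S_def using continuous_phi
    by (auto intro!: open_Collect_less continuous_at_imp_continuous_on simp: phi_0)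
  have "Ck_on (2 * N) S phi" unfolding phi_def
    using N by (intro Ck_on_trig_moment integrable_power_f) simp
  then have "Ck_on (2 * N) S (\<lambda>t. ln (phi t))" by (rule Ck_on_ln) (simp add: S_def)
  then obtain diff where diff: "diff 0 = (\<lambda>t. ln (phi t))"
    "\<And>m x. m < 2 * N \<Longrightarrow> x \<in> S \<Longrightarrow> (diff m has_real_derivative diff (Suc m) x) (at x)"
    "continuous_on S (diff (2 * N))" using Ck_on_derivs by metis
  have Ln: "Ln (char D x) = of_real (diff 0 x)" if "x \<in> S" for x
    using that by (simp add: char diff(1) S_def Ln_of_real)
  have cum: "cumulant D l = Re (of_real (diff l 0) / \<i> ^ l)"
    unfolding cumulant_def using funpow_vector_derivative[OF S(1) Ln diff(2) l S(2)] by simp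
  have "((\<lambda>t. (diff 0 t - (\<Sum>m\<le>2 * N. diff m 0 / fact m * t ^ m)) / t ^ (2 * N)) \<longlongrightarrow> 0) (at 0)"
    by (rule Taylor_Peano[OF S diff(2,3)])
  moreover have "filterlim (\<lambda>s::real. 1 / s) (at 0) at_top"
    by real_asymp
  ultimately have T: "((\<lambda>s. (diff 0 (1 / s) - (\<Sum>m\<le>2 * N. diff m 0 / fact m * (1 / s) ^ m)) / (1 / s) ^ (2 * N)) \<longlongrightarrow> 0) at_top"
    by (rule filterlim_compose)
  have "((\<lambda>s. log_rem (1 / s) * s ^ (2 * N) - (diff 0 (1 / s) - (\<Sum>m\<le>2 * N. diff m 0 / fact m * (1 / s) ^ m)) / (1 / s) ^ (2 * N)) \<longlongrightarrow> 0 - 0) at_top"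
    by (intro tendsto_diff small T)
  moreover have "log_rem (1 / s) * s ^ (2 * N) - (diff 0 (1 / s) - (\<Sum>m\<le>2 * N. diff m 0 / fact m * (1 / s) ^ m)) / (1 / s) ^ (2 * N)
      = (\<Sum>m\<le>2 * N. (log_coef m + diff m 0 / fact m) * (1 / s) ^ m) * s ^ (2 * N)" for s
  proof -
    have "log_rem (1 / s) = diff 0 (1 / s) + (\<Sum>m\<le>2 * N. log_coef m * (1 / s) ^ m)"
      unfolding log_rem_def sum_log_coef diff(1) ..
    moreover have "X / (1 / s) ^ (2 * N) = X * s ^ (2 * N)" for X by (simp add: power_one_over)
    ultimately show ?thesis by (simp add: algebra_simps sum.distrib sum_distrib_right)
  qed
  ultimately have "((\<lambda>s. (\<Sum>m\<le>2 * N. (log_coef m + diff m 0 / fact m) * (1 / s) ^ m) * s ^ (2 * N)) \<longlongrightarrow> 0) at_top"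
    by simp
  from polynomial_small_imp_zero[OF this l] have dl: "diff l 0 = - log_coef l * fact l"
    by (simp add: field_simps add_eq_0_iff2)
  show ?thesis
  proof (cases "even l")
    case True
    then obtain k where k: "l = 2 * k" by (auto elim: evenE)
    have i: "\<i> ^ l = of_real ((-1) ^ k)" by (simp add: k power_mult)
    have sq: "((-1::real) ^ k) * (-1) ^ k = 1" by (simp add: power_mult_distrib[symmetric])
    have "cumulant D l = - log_coef l * fact l * (-1) ^ k"
      unfolding cum dl i by (cases "even k") auto
    then have "of_real (cumulant D l) * (\<i> * of_real t) ^ l / fact l = (of_real (- log_coef l * fact l * (-1) ^ k * ((-1) ^ k * t ^ l) / fact l) :: complex)"
      unfolding power_mult_distrib i by simp
    also have "- log_coef l * fact l * (-1) ^ k * ((-1) ^ k * t ^ l) / fact l = - log_coef l * t ^ l * ((-1) ^ k * (-1) ^ k)"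
      by (simp add: field_simps)
    finally show ?thesis unfolding sq by simp
  next
    case False
    then have "log_coef l = 0" by (simp add: log_coef_def)
    then show ?thesis using cum dl by simp
  qed
qed

end

section \<open>Edgeworth polynomials\<close>

text \<open>Closed under sums and products, and integrable against a Gaussian. Membership in this
  class replaces explicit formulas for the dependence of the Edgeworth coefficients on t.\<close>

definition poly_bdd :: "(real \<Rightarrow> complex) \<Rightarrow> bool" where
  "poly_bdd g \<longleftrightarrow> continuous_on UNIV g \<and> (\<exists>C n. \<forall>t. norm (g t) \<le> C * (1 + \<bar>t\<bar>) ^ n)"

lemma poly_bdd_continuous: "poly_bdd g \<Longrightarrow> continuous_on UNIV g"
  by (simp add: poly_bdd_def)

lemma poly_bddE:
  assumes "poly_bdd g"
  obtains C n where "C \<ge> 0" "\<And>t. norm (g t) \<le> C * (1 + \<bar>t\<bar>) ^ n"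
proof -
  obtain C n where "\<And>t. norm (g t) \<le> C * (1 + \<bar>t\<bar>) ^ n" using assms by (auto simp: poly_bdd_def)
  moreover from order_trans[OF norm_ge_zero this[of 0]] have "C \<ge> 0" by simp
  ultimately show thesis by (rule that[rotated])
qed

lemma poly_bdd_const: "poly_bdd (\<lambda>_. c)"
  unfolding poly_bdd_def by (intro conjI continuous_on_const exI[of _ "norm c"] exI[of _ 0]) simp

lemma poly_bdd_of_real: "poly_bdd of_real"
  unfolding poly_bdd_def by (intro conjI continuous_on_of_real continuous_on_id exI[of _ 1]) simp

lemma poly_bdd_add:
  assumes "poly_bdd f" "poly_bdd g"
  shows "poly_bdd (\<lambda>t. f t + g t)"
proof -
  obtain C m where C: "C \<ge> 0" "\<And>t. norm (f t) \<le> C * (1 + \<bar>t\<bar>) ^ m" using assms(1) by (rule poly_bddE) blast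
  obtain D n where D: "D \<ge> 0" "\<And>t. norm (g t) \<le> D * (1 + \<bar>t\<bar>) ^ n" using assms(2) by (rule poly_bddE) blast
  have "norm (f t + g t) \<le> (C + D) * (1 + \<bar>t\<bar>) ^ (m + n)" for t
  proof -
    have "C * (1 + \<bar>t\<bar>) ^ m \<le> C * (1 + \<bar>t\<bar>) ^ (m + n)"
      using C(1) by (intro mult_left_mono power_increasing) auto
    moreover have "D * (1 + \<bar>t\<bar>) ^ n \<le> D * (1 + \<bar>t\<bar>) ^ (m + n)"
      using D(1) by (intro mult_left_mono power_increasing) auto
    ultimately show ?thesis using C(2)[of t] D(2)[of t] norm_triangle_ineq[of "f t" "g t"]
      unfolding distrib_right by linarith
  qed
  then show ?thesis using assms unfolding poly_bdd_def by (intro conjI continuous_on_add) auto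
qed

lemma poly_bdd_mult:
  assumes "poly_bdd f" "poly_bdd g"
  shows "poly_bdd (\<lambda>t. f t * g t)"
proof -
  obtain C m where C: "C \<ge> 0" "\<And>t. norm (f t) \<le> C * (1 + \<bar>t\<bar>) ^ m" using assms(1) by (rule poly_bddE) blast
  obtain D n where D: "D \<ge> 0" "\<And>t. norm (g t) \<le> D * (1 + \<bar>t\<bar>) ^ n" using assms(2) by (rule poly_bddE) blast
  have "norm (f t * g t) \<le> (C * D) * (1 + \<bar>t\<bar>) ^ (m + n)" for t
  proof -
    have "norm (f t * g t) \<le> (C * (1 + \<bar>t\<bar>) ^ m) * (D * (1 + \<bar>t\<bar>) ^ n)"
      unfolding norm_mult using C D by (intro mult_mono) auto
    then show ?thesis by (simp add: power_add mult_ac)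
  qed
  then show ?thesis using assms unfolding poly_bdd_def by (intro conjI continuous_on_mult) auto
qed

lemma poly_bdd_sum: "(\<And>i. i \<in> I \<Longrightarrow> poly_bdd (g i)) \<Longrightarrow> poly_bdd (\<lambda>t. \<Sum>i\<in>I. g i t)"
  by (induction I rule: infinite_finite_induct) (auto intro: poly_bdd_const poly_bdd_add)

lemma poly_bdd_power: "poly_bdd g \<Longrightarrow> poly_bdd (\<lambda>t. g t ^ k)"
  by (induction k) (auto intro: poly_bdd_const poly_bdd_mult)

lemma poly_bdd_norm: "poly_bdd g \<Longrightarrow> poly_bdd (\<lambda>t. of_real (norm (g t)))"
  unfolding poly_bdd_def by (auto intro!: continuous_intros)

text \<open>The exponent A_h(t) of the overview, as a polynomial in h = n^(-1/2) for each fixed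
  t.\<close>

definition edge_poly :: "(nat \<Rightarrow> real) \<Rightarrow> nat \<Rightarrow> real \<Rightarrow> complex poly" where
  "edge_poly \<kappa> m t = (\<Sum>l=3..m. monom (of_real (\<kappa> l) * (\<i> * of_real t) ^ l / fact l) (l - 2))"

text \<open>The exponential series of \<open>edge_poly\<close>, cut after the m-th power. As
  \<open>edge_poly\<close> has no constant term, its k-th power starts at h^k, so the coefficients
  up to index m agree with those of the full exponential.\<close>

definition edge_exp :: "(nat \<Rightarrow> real) \<Rightarrow> nat \<Rightarrow> real \<Rightarrow> complex poly" where
  "edge_exp \<kappa> m t = (\<Sum>k\<le>m. smult (1 / fact k) (edge_poly \<kappa> m t ^ k))"

lemma coeff_edge_poly:
  "poly.coeff (edge_poly \<kappa> m t) i =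
    (if 1 \<le> i \<and> i + 2 \<le> m then of_real (\<kappa> (i + 2)) * (\<i> * of_real t) ^ (i + 2) / fact (i + 2) else 0)"
proof -
  let ?a = "\<lambda>l. of_real (\<kappa> l) * (\<i> * of_real t) ^ l / fact l :: complex"
  have "poly.coeff (edge_poly \<kappa> m t) i = (\<Sum>l=3..m. if l = i + 2 then ?a (i + 2) else 0)"
    unfolding edge_poly_def coeff_sum coeff_monom by (intro sum.cong refl) auto
  also have "\<dots> = (if i + 2 \<in> {3..m} then ?a (i + 2) else 0)" by (rule sum.delta) simp
  finally show ?thesis by auto
qed

lemma coeff_edge_poly_0: "poly.coeff (edge_poly \<kappa> m t) 0 = 0"
  by (simp add: coeff_edge_poly)

lemma degree_edge_poly: "degree (edge_poly \<kappa> m t) \<le> m"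
  by (rule degree_le) (simp add: coeff_edge_poly)

lemma degree_edge_exp: "degree (edge_exp \<kappa> m t) \<le> m * m"
  unfolding edge_exp_def
proof (rule degree_sum_le)
  fix k assume "k \<in> {..m}"
  have "degree (smult (1 / fact k) (edge_poly \<kappa> m t ^ k)) \<le> degree (edge_poly \<kappa> m t ^ k)"
    by (rule degree_smult_le)
  also have "\<dots> \<le> degree (edge_poly \<kappa> m t) * k" by (rule degree_power_le)
  also have "\<dots> \<le> m * m" using \<open>k \<in> {..m}\<close> degree_edge_poly by (intro mult_mono) auto
  finally show "degree (smult (1 / fact k) (edge_poly \<kappa> m t ^ k)) \<le> m * m" .
qed simp

lemma coeff_edge_exp:
  "poly.coeff (edge_exp \<kappa> m t) i = (\<Sum>k\<le>m. poly.coeff (edge_poly \<kappa> m t ^ k) i / fact k)"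
  by (simp add: edge_exp_def coeff_sum)

lemma coeff_edge_exp_0: "poly.coeff (edge_exp \<kappa> m t) 0 = 1"
proof -
  have "poly.coeff (edge_exp \<kappa> m t) 0 = (\<Sum>k\<le>m. if k = 0 then 1 else 0)"
    unfolding coeff_edge_exp
    by (intro sum.cong refl) (auto simp: coeff_power_less[OF coeff_edge_poly_0])
  then show ?thesis by simp
qed

text \<open>The coefficient of h^i in \<open>edge_poly\<close> carries the cumulant of order i + 2,
  so vanishing odd cumulants leave even powers of h only. Hence the restriction to even j in the
  expansion.\<close>

lemma coeff_edge_exp_odd:
  assumes "\<And>l. odd l \<Longrightarrow> l \<le> m \<Longrightarrow> \<kappa> l = 0" "odd i"
  shows "poly.coeff (edge_exp \<kappa> m t) i = 0"
proof -
  have "poly.coeff (edge_poly \<kappa> m t) j = 0" if "odd j" for j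
    using assms(1)[of "j + 2"] that by (simp add: coeff_edge_poly)
  then have "poly.coeff (edge_poly \<kappa> m t ^ k) i = 0" for k by (rule coeff_power_odd[OF _ assms(2)])
  then show ?thesis by (simp add: coeff_edge_exp)
qed

text \<open>\<open>edgeworth_xi\<close> cuts the cumulant sum at j, \<open>edge_exp\<close> at the
  common m. The coefficient of h^(j - 2) depends only on cumulants of order at most j, and neither k
  = 0 nor k > j - 2 contributes to it.\<close>

lemma edgeworth_xi_sum_eq:
  assumes j: "3 \<le> j" "j \<le> m"
  shows "(\<Sum>k=1..j. edgeworth_xi \<kappa> k j t / fact k) = poly.coeff (edge_exp \<kappa> m t) (j - 2)"
proof -
  have "poly.coeff (edge_exp \<kappa> m t) (j - 2) = (\<Sum>k=1..j. poly.coeff (edge_poly \<kappa> m t ^ k) (j - 2) / fact k)"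
    unfolding coeff_edge_exp
  proof (rule sum.mono_neutral_right)
    show "\<forall>k\<in>{..m} - {1..j}. poly.coeff (edge_poly \<kappa> m t ^ k) (j - 2) / fact k = 0"
    proof
      fix k assume "k \<in> {..m} - {1..j}"
      then have "k = 0 \<or> j - 2 < k" by auto
      then show "poly.coeff (edge_poly \<kappa> m t ^ k) (j - 2) / fact k = 0"
      proof
        assume "k = 0"
        moreover have "j - 2 \<noteq> 0" using j by simp
        ultimately show ?thesis by (cases "j - 2") simp_all
      qed (simp add: coeff_power_less[OF coeff_edge_poly_0])
    qed
  qed (use j in auto)
  also have "\<dots> = (\<Sum>k=1..j. edgeworth_xi \<kappa> k j t / fact k)"
  proof (intro sum.cong refl)
    fix k
    have "poly.coeff (edge_poly \<kappa> m t ^ k) (j - 2) = poly.coeff (edge_poly \<kappa> j t ^ k) (j - 2)"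
      by (rule coeff_power_cong[of "j - 2"]) (use j in \<open>auto simp: coeff_edge_poly\<close>)
    then show "poly.coeff (edge_poly \<kappa> m t ^ k) (j - 2) / fact k = edgeworth_xi \<kappa> k j t / fact k"
      by (simp add: edgeworth_xi_def edge_poly_def)
  qed
  finally show ?thesis by simp
qed

lemma poly_bdd_coeff_edge_poly: "poly_bdd (\<lambda>t. poly.coeff (edge_poly \<kappa> m t) i)"
proof (cases "1 \<le> i \<and> i + 2 \<le> m")
  case True
  have "poly_bdd (\<lambda>t. (of_real (\<kappa> (i + 2)) / fact (i + 2)) * (\<i> * of_real t) ^ (i + 2))"
    by (intro poly_bdd_mult poly_bdd_const poly_bdd_power poly_bdd_of_real)
  then show ?thesis using True by (simp add: coeff_edge_poly)
next
  case False
  then show ?thesis using poly_bdd_const[of 0] by (auto simp: coeff_edge_poly)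
qed

lemma poly_bdd_coeff_edge_poly_power: "poly_bdd (\<lambda>t. poly.coeff (edge_poly \<kappa> m t ^ k) i)"
proof (induction k arbitrary: i)
  case 0
  then show ?case using poly_bdd_const by simp
next
  case (Suc k)
  show ?case unfolding power_Suc coeff_mult
    by (intro poly_bdd_sum poly_bdd_mult poly_bdd_coeff_edge_poly Suc)
qed

lemma poly_bdd_coeff_edge_exp: "poly_bdd (\<lambda>t. poly.coeff (edge_exp \<kappa> m t) i)"
proof -
  have "poly_bdd (\<lambda>t. \<Sum>k\<le>m. (1 / fact k) * poly.coeff (edge_poly \<kappa> m t ^ k) i)"
    by (intro poly_bdd_sum poly_bdd_mult poly_bdd_const poly_bdd_coeff_edge_poly_power)
  then show ?thesis by (simp add: coeff_edge_exp)
qed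

lemma edge_poly_bound:
  assumes h: "0 \<le> h" "h \<le> 1"
  shows "norm (poly (edge_poly \<kappa> m t) (of_real h)) \<le> h * (\<Sum>i\<le>m. norm (poly.coeff (edge_poly \<kappa> m t) i))"
  using poly_trunc_bound[OF degree_edge_poly, of "of_real h" \<kappa> m t 1] h by (simp add: coeff_edge_poly_0)

text \<open>The Taylor error of the exponential at z = O(h) plus the coefficients of
  \<open>edge_exp\<close> of index at least m. The constants are uniform in h and polynomial in t;
  the factor exp |z| is kept, to be absorbed by the Gaussian where |t| \<le> e sqrt n.\<close>

lemma edge_exp_trunc_bound:
  obtains C n where "C \<ge> 0" "\<And>h t. 0 \<le> h \<Longrightarrow> h \<le> 1 \<Longrightarrow>
     norm (exp (poly (edge_poly \<kappa> m t) (of_real h)) - (\<Sum>i<m. poly.coeff (edge_exp \<kappa> m t) i * of_real h ^ i))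
       \<le> h ^ m * (C * (1 + \<bar>t\<bar>) ^ n * exp (norm (poly (edge_poly \<kappa> m t) (of_real h))))"
proof -
  define B where "B = (\<lambda>t. \<Sum>i\<le>m. norm (poly.coeff (edge_poly \<kappa> m t) i))"
  define D where "D = (\<lambda>t. \<Sum>i\<le>m * m. norm (poly.coeff (edge_exp \<kappa> m t) i))"
  have B0: "B t \<ge> 0" and D0: "D t \<ge> 0" for t by (auto simp: B_def D_def intro: sum_nonneg)
  have "poly_bdd (\<lambda>t. (\<Sum>i\<le>m. of_real (norm (poly.coeff (edge_poly \<kappa> m t) i))) ^ Suc m + (\<Sum>i\<le>m * m. of_real (norm (poly.coeff (edge_exp \<kappa> m t) i))))"
    by (intro poly_bdd_add poly_bdd_power poly_bdd_sum poly_bdd_norm poly_bdd_coeff_edge_exp poly_bdd_coeff_edge_poly)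
  then obtain C n where C: "C \<ge> 0" "\<And>t. norm ((\<Sum>i\<le>m. of_real (norm (poly.coeff (edge_poly \<kappa> m t) i))) ^ Suc m + (\<Sum>i\<le>m * m. of_real (norm (poly.coeff (edge_exp \<kappa> m t) i))) :: complex) \<le> C * (1 + \<bar>t\<bar>) ^ n"
    by (rule poly_bddE) blast
  have C': "B t ^ Suc m + D t \<le> C * (1 + \<bar>t\<bar>) ^ n" for t
  proof -
    have "(\<Sum>i\<le>m. of_real (norm (poly.coeff (edge_poly \<kappa> m t) i))) ^ Suc m + (\<Sum>i\<le>m * m. of_real (norm (poly.coeff (edge_exp \<kappa> m t) i))) = (of_real (B t ^ Suc m + D t) :: complex)"
      by (simp add: B_def D_def)
    with C(2)[of t] have "norm (of_real (B t ^ Suc m + D t) :: complex) \<le> C * (1 + \<bar>t\<bar>) ^ n" by (simp only:)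
    then show ?thesis unfolding norm_of_real by linarith
  qed
  show thesis
  proof (rule that[OF C(1)])
    fix h t :: real assume h: "0 \<le> h" "h \<le> 1"
    let ?z = "poly (edge_poly \<kappa> m t) (of_real h)"
    have z: "norm ?z \<le> h * B t" using edge_poly_bound[OF h] by (simp add: B_def)
    have pe: "poly (edge_exp \<kappa> m t) (of_real h) = (\<Sum>k\<le>m. ?z ^ k / fact k)"
      by (simp add: edge_exp_def poly_sum poly_power)
    have "norm (exp ?z - poly (edge_exp \<kappa> m t) (of_real h)) \<le> exp \<bar>Re ?z\<bar> * norm ?z ^ Suc m / fact m"
      unfolding pe by (rule Taylor_exp)
    also have "\<dots> \<le> exp (norm ?z) * norm ?z ^ Suc m / 1"
      by (intro frac_le mult_right_mono) (auto simp: abs_Re_le_cmod fact_ge_1)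
    also have "\<dots> \<le> exp (norm ?z) * (h ^ m * B t ^ Suc m)"
    proof -
      have "norm ?z ^ Suc m \<le> (h * B t) ^ Suc m" using z by (intro power_mono) auto
      also have "\<dots> = h ^ Suc m * B t ^ Suc m" by (rule power_mult_distrib)
      also have "\<dots> \<le> h ^ m * B t ^ Suc m"
        using h B0[of t] by (intro mult_right_mono power_decreasing) auto
      finally show ?thesis by simp
    qed
    finally have 1: "norm (exp ?z - poly (edge_exp \<kappa> m t) (of_real h)) \<le> exp (norm ?z) * (h ^ m * B t ^ Suc m)" .
    have "norm (poly (edge_exp \<kappa> m t) (of_real h) - (\<Sum>i<m. poly.coeff (edge_exp \<kappa> m t) i * of_real h ^ i)) \<le> h ^ m * D t"
      using poly_trunc_bound[OF degree_edge_exp, of "of_real h" \<kappa> m t m] h by (simp add: D_def)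
    also have "\<dots> \<le> exp (norm ?z) * (h ^ m * D t)"
    proof -
      have "1 * (h ^ m * D t) \<le> exp (norm ?z) * (h ^ m * D t)"
        using h D0[of t] by (intro mult_right_mono) auto
      then show ?thesis by simp
    qed
    finally have "norm (exp ?z - (\<Sum>i<m. poly.coeff (edge_exp \<kappa> m t) i * of_real h ^ i)) \<le> exp (norm ?z) * (h ^ m * B t ^ Suc m) + exp (norm ?z) * (h ^ m * D t)"
      using 1 by (intro norm_diff_triangle_le)
    also have "\<dots> = h ^ m * ((B t ^ Suc m + D t) * exp (norm ?z))" by (simp add: algebra_simps)
    also have "\<dots> \<le> h ^ m * (C * (1 + \<bar>t\<bar>) ^ n * exp (norm ?z))"
      using h by (intro mult_left_mono mult_right_mono C') auto
    finally show "norm (exp ?z - (\<Sum>i<m. poly.coeff (edge_exp \<kappa> m t) i * of_real h ^ i)) \<le> h ^ m * (C * (1 + \<bar>t\<bar>) ^ n * exp (norm ?z))" .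
  qed
qed

lemma edge_exp_sum_bound:
  obtains C n where "C \<ge> 0" "\<And>h t. 0 \<le> h \<Longrightarrow> h \<le> 1 \<Longrightarrow>
     norm (\<Sum>i<m. poly.coeff (edge_exp \<kappa> m t) i * of_real h ^ i) \<le> C * (1 + \<bar>t\<bar>) ^ n"
proof -
  have "poly_bdd (\<lambda>t. \<Sum>i<m. of_real (norm (poly.coeff (edge_exp \<kappa> m t) i)))"
    by (intro poly_bdd_sum poly_bdd_norm poly_bdd_coeff_edge_exp)
  then obtain C n where C: "C \<ge> 0" "\<And>t. norm (\<Sum>i<m. of_real (norm (poly.coeff (edge_exp \<kappa> m t) i)) :: complex) \<le> C * (1 + \<bar>t\<bar>) ^ n"
    by (rule poly_bddE) blast
  show thesis
  proof (rule that[OF C(1)])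
    fix h t :: real assume h: "0 \<le> h" "h \<le> 1"
    have "norm (\<Sum>i<m. poly.coeff (edge_exp \<kappa> m t) i * of_real h ^ i) \<le> (\<Sum>i<m. norm (poly.coeff (edge_exp \<kappa> m t) i))"
    proof (rule order_trans[OF norm_sum], intro sum_mono)
      fix i
      have "h ^ i \<le> 1" using h by (intro power_le_one)
      then show "norm (poly.coeff (edge_exp \<kappa> m t) i * of_real h ^ i) \<le> norm (poly.coeff (edge_exp \<kappa> m t) i)"
        using h by (simp add: norm_mult norm_power mult_left_le)
    qed
    also have "\<dots> = norm (of_real (\<Sum>i<m. norm (poly.coeff (edge_exp \<kappa> m t) i)) :: complex)"
      unfolding norm_of_real by (simp add: sum_nonneg)
    also have "\<dots> \<le> C * (1 + \<bar>t\<bar>) ^ n" using C(2)[of t] by (simp only: of_real_sum)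
    finally show "norm (\<Sum>i<m. poly.coeff (edge_exp \<kappa> m t) i * of_real h ^ i) \<le> C * (1 + \<bar>t\<bar>) ^ n" .
  qed
qed

section \<open>Fourier inversion\<close>

text \<open>Recovers the value of a continuous density at x from the masses of intervals shrinking
  to x from the right.\<close>

lemma measure_Ioc_derivative:
  fixes g :: "real \<Rightarrow> real"
  assumes cont: "continuous_on UNIV g"
  shows "(\<lambda>k. real (Suc k) * (\<integral>y. indicator {x<..x + 1 / real (Suc k)} y * g y \<partial>lborel)) \<longlonglongrightarrow> g x"
proof (rule LIMSEQ_I)
  fix r :: real assume r: "r > 0"
  have "isCont g x" using cont by (simp add: continuous_on_eq_continuous_at)
  then obtain d where d: "d > 0" "\<And>y. \<bar>y - x\<bar> < d \<Longrightarrow> \<bar>g y - g x\<bar> < r / 2"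
    using r by (force simp: continuous_at_eps_delta dist_real_def dest: spec[of _ "r / 2"])
  obtain k0 where k0: "1 / real (Suc k0) < d" using nat_approx_posE[OF d(1)] by blast
  show "\<exists>no. \<forall>k\<ge>no. norm (real (Suc k) * (\<integral>y. indicator {x<..x + 1 / real (Suc k)} y * g y \<partial>lborel) - g x) < r"
  proof (intro exI allI impI)
    fix k assume k: "k \<ge> k0"
    define e where "e = 1 / real (Suc k)"
    have "1 / real (Suc k) \<le> 1 / real (Suc k0)" using k by (intro divide_left_mono) auto
    then have e: "0 < e" "e < d" using k0 by (auto simp: e_def)
    have "set_integrable lborel {x..x + e} g"
      using cont by (intro borel_integrable_atLeastAtMost') (auto intro: continuous_on_subset)
    then have "set_integrable lborel {x<..x + e} g"
      by (rule set_integrable_subset) auto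
    then have ig: "integrable lborel (\<lambda>y. indicator {x<..x + e} y * g y)" by (simp add: set_integrable_def)
    have ic: "integrable lborel (\<lambda>y. indicator {x<..x + e} y * c)" for c :: real
      by (intro integrable_mult_left integrable_real_indicator) (use e in auto)
    have vc: "(\<integral>y. indicator {x<..x + e} y * c \<partial>lborel) = e * c" for c :: real
      using e by simp
    have "\<bar>(\<integral>y. indicator {x<..x + e} y * g y \<partial>lborel) - e * g x\<bar> = \<bar>\<integral>y. indicator {x<..x + e} y * g y - indicator {x<..x + e} y * g x \<partial>lborel\<bar>"
      unfolding vc[symmetric] by (subst Bochner_Integration.integral_diff[OF ig ic]) simp
    also have "\<dots> \<le> (\<integral>y. \<bar>indicator {x<..x + e} y * g y - indicator {x<..x + e} y * g x\<bar> \<partial>lborel)"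
      by (rule integral_abs_bound)
    also have "\<dots> \<le> (\<integral>y. indicator {x<..x + e} y * (r / 2) \<partial>lborel)"
    proof (rule Bochner_Integration.integral_mono[OF _ ic])
      show "integrable lborel (\<lambda>y. \<bar>indicator {x<..x + e} y * g y - indicator {x<..x + e} y * g x\<bar>)"
        by (intro integrable_abs Bochner_Integration.integrable_diff ig ic)
      fix y
      show "\<bar>indicator {x<..x + e} y * g y - indicator {x<..x + e} y * g x\<bar> \<le> indicator {x<..x + e} y * (r / 2)"
        using d(2)[of y] e by (auto simp: indicator_def)
    qed
    also have "\<dots> = e * (r / 2)" by (rule vc)
    finally have 1: "\<bar>(\<integral>y. indicator {x<..x + e} y * g y \<partial>lborel) - e * g x\<bar> \<le> e * (r / 2)" .
    have "real (Suc k) * I - g x = (I - e * g x) / e" for I using e by (simp add: e_def field_simps)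
    then have "norm (real (Suc k) * (\<integral>y. indicator {x<..x + e} y * g y \<partial>lborel) - g x) = \<bar>(\<integral>y. indicator {x<..x + e} y * g y \<partial>lborel) - e * g x\<bar> / e"
      using e by (simp only: real_norm_def abs_divide abs_of_pos)
    also have "\<dots> \<le> e * (r / 2) / e" using 1 e by (intro divide_right_mono) auto
    also have "\<dots> < r" using e r by simp
    finally show "norm (real (Suc k) * (\<integral>y. indicator {x<..x + 1 / real (Suc k)} y * g y \<partial>lborel) - g x) < r"
      by (simp only: e_def)
  qed
qed

text \<open>Levy's inversion formula is a limit over symmetric truncations. Its kernel is bounded by
  b - a, so an integrable characteristic function turns the limit into an absolutely convergent
  integral.\<close>

lemma (in real_distribution) fourier_inversion_Ioc:
  assumes int: "integrable lborel (char M)" and ab: "a \<le> b"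
    and null: "\<And>x. measure M {x} = 0"
  shows "of_real (measure M {a<..b}) = 1 / (2 * pi) * (CLBINT t. (iexp (- (t * a)) - iexp (- (t * b))) / (\<i> * t) * char M t)"
proof -
  let ?F = "\<lambda>t. (iexp (- (t * a)) - iexp (- (t * b))) / (\<i> * t) * char M t"
  have bound: "norm (?F t) \<le> (b - a) * norm (char M t)" for t
  proof (cases "t = 0")
    case False
    have "norm ((iexp (t * (- a)) - iexp (t * (- b))) / (\<i> * t)) \<le> - a - (- b)"
      by (rule Levy_Inversion_aux2) (use ab False in auto)
    then have "norm ((iexp (- (t * a)) - iexp (- (t * b))) / (\<i> * t)) \<le> b - a" by simp
    then show ?thesis unfolding norm_mult by (intro mult_right_mono) auto
  qed (use ab in simp)
  have "(\<lambda>T::nat. \<integral>t. indicator {- real T<..<real T} t *\<^sub>R ?F t \<partial>lborel) \<longlonglongrightarrow> (\<integral>t. ?F t \<partial>lborel)"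
  proof (rule integral_dominated_convergence)
    show "integrable lborel (\<lambda>t. (b - a) * norm (char M t))"
      by (intro integrable_mult_right integrable_norm int)
    show "AE t in lborel. (\<lambda>T. indicator {- real T<..<real T} t *\<^sub>R ?F t) \<longlonglongrightarrow> ?F t"
    proof (rule AE_I2, rule tendsto_eventually)
      fix t :: real
      obtain n where "\<bar>t\<bar> < real n" using reals_Archimedean2 by blast
      then show "\<forall>\<^sub>F T in sequentially. indicator {- real T<..<real T} t *\<^sub>R ?F t = ?F t"
        by (intro eventually_sequentiallyI[of n]) (auto simp: indicator_def)
    qed
    show "AE t in lborel. norm (indicator {- real T<..<real T} t *\<^sub>R ?F t) \<le> (b - a) * norm (char M t)" for T
    proof (rule AE_I2)
      fix t
      have "norm (indicator {- real T<..<real T} t *\<^sub>R ?F t) \<le> 1 * norm (?F t)"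
        unfolding norm_scaleR by (intro mult_right_mono) (auto simp: indicator_def)
      then show "norm (indicator {- real T<..<real T} t *\<^sub>R ?F t) \<le> (b - a) * norm (char M t)"
        using bound[of t] by linarith
    qed
  qed measurable
  then have 1: "(\<lambda>T::nat. 1 / (2 * pi) * (\<integral>t. indicator {- real T<..<real T} t *\<^sub>R ?F t \<partial>lborel)) \<longlonglongrightarrow> 1 / (2 * pi) * (\<integral>t. ?F t \<partial>lborel)"
    by (intro tendsto_mult tendsto_const)
  have "(CLBINT t=-T..T. ?F t) = (\<integral>t. indicator {- real T<..<real T} t *\<^sub>R ?F t \<partial>lborel)" for T :: nat
    by (simp add: interval_lebesgue_integral_def set_lebesgue_integral_def einterval_def greaterThanLessThan_def greaterThan_def lessThan_def Int_def)
  with Levy_Inversion[OF ab null null]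
  have 2: "(\<lambda>T::nat. 1 / (2 * pi) * (\<integral>t. indicator {- real T<..<real T} t *\<^sub>R ?F t \<partial>lborel)) \<longlonglongrightarrow> of_real (measure M {a<..b})"
    by simp
  show ?thesis by (rule LIMSEQ_unique[OF 2 1])
qed

text \<open>The interval formula divided by the length of the interval. The difference quotients of
  the kernel have modulus at most 1 and converge to the exponential, so the limit passes through the
  integral.\<close>

lemma (in real_distribution) fourier_inversion_density:
  assumes int: "integrable lborel (char M)"
    and dens: "M = density lborel (\<lambda>x. ennreal (g x))"
    and cont: "continuous_on UNIV g" and nn: "\<And>x. 0 \<le> g x"
  shows "of_real (g x) = 1 / (2 * pi) * (CLBINT t. iexp (- (t * x)) * char M t)"
proof -
  have [measurable]: "g \<in> borel_measurable borel" using cont by (rule borel_measurable_continuous_onI)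
  have null: "measure M {y} = 0" for y
  proof -
    have "emeasure M {y} = (\<integral>\<^sup>+ z. ennreal (g z) * indicator {y} z \<partial>lborel)"
      unfolding dens by (rule emeasure_density) auto
    also have "\<dots> = 0" by (rule nn_integral_null_set) auto
    finally show ?thesis by (simp add: measure_def)
  qed
  have meas: "measure M {a<..b} = (\<integral>y. indicator {a<..b} y * g y \<partial>lborel)" for a b
  proof -
    have "emeasure M {a<..b} = (\<integral>\<^sup>+ z. ennreal (g z) * indicator {a<..b} z \<partial>lborel)"
      unfolding dens by (rule emeasure_density) auto
    also have "\<dots> = (\<integral>\<^sup>+ z. ennreal (indicator {a<..b} z * g z) \<partial>lborel)"
      by (intro nn_integral_cong) (auto simp: indicator_def)
    finally show ?thesis
      unfolding measure_def by (subst integral_eq_nn_integral) (auto simp: nn)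
  qed
  let ?h = "\<lambda>k. 1 / real (Suc k)"
  let ?F = "\<lambda>k t. (iexp (- (t * x)) - iexp (- (t * (x + ?h k)))) / (\<i> * t) * char M t"
  have "(\<lambda>k. of_real (real (Suc k) * (\<integral>y. indicator {x<..x + ?h k} y * g y \<partial>lborel)) :: complex) \<longlonglongrightarrow> of_real (g x)"
    by (intro tendsto_of_real measure_Ioc_derivative cont)
  also have "(\<lambda>k. of_real (real (Suc k) * (\<integral>y. indicator {x<..x + ?h k} y * g y \<partial>lborel))) = (\<lambda>k. 1 / (2 * pi) * (CLBINT t. of_real (real (Suc k)) * ?F k t))"
  proof
    fix k
    have "of_real (measure M {x<..x + ?h k}) = 1 / (2 * pi) * (CLBINT t. ?F k t)"
      by (rule fourier_inversion_Ioc[OF int _ null]) simp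
    then show "of_real (real (Suc k) * (\<integral>y. indicator {x<..x + ?h k} y * g y \<partial>lborel)) = 1 / (2 * pi) * (CLBINT t. of_real (real (Suc k)) * ?F k t)"
      unfolding meas integral_mult_right_zero of_real_mult by (simp only: mult_ac)
  qed
  finally have 1: "(\<lambda>k. 1 / (2 * pi) * (CLBINT t. of_real (real (Suc k)) * ?F k t)) \<longlonglongrightarrow> of_real (g x)" .
  have "(\<lambda>k. CLBINT t. of_real (real (Suc k)) * ?F k t) \<longlonglongrightarrow> (CLBINT t. iexp (- (t * x)) * char M t)"
  proof (rule integral_dominated_convergence)
    show "integrable lborel (\<lambda>t. norm (char M t))" using int by (rule integrable_norm)
    show "AE t in lborel. norm (of_real (real (Suc k)) * ?F k t) \<le> norm (char M t)" for k
    proof (rule AE_I2)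
      fix t
      show "norm (of_real (real (Suc k)) * ?F k t) \<le> norm (char M t)"
      proof (cases "t = 0")
        case False
        have "norm ((iexp (t * (- x)) - iexp (t * (- (x + ?h k)))) / (\<i> * t)) \<le> - x - (- (x + ?h k))"
          by (rule Levy_Inversion_aux2) (use False in auto)
        then have "norm ((iexp (- (t * x)) - iexp (- (t * (x + ?h k)))) / (\<i> * t)) \<le> ?h k"
          unfolding mult_minus_right by simp
        then have "real (Suc k) * norm ((iexp (- (t * x)) - iexp (- (t * (x + ?h k)))) / (\<i> * t)) * norm (char M t) \<le> real (Suc k) * ?h k * norm (char M t)"
          by (intro mult_right_mono mult_left_mono) auto
        also have "\<dots> = norm (char M t)" by simp
        finally show ?thesis unfolding norm_mult norm_of_real by (simp add: mult.assoc)
      qed simp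
    qed
    show "AE t in lborel. (\<lambda>k. of_real (real (Suc k)) * ?F k t) \<longlonglongrightarrow> iexp (- (t * x)) * char M t"
      using AE_lborel_singleton[of "0::real"]
    proof eventually_elim
      case (elim t)
      define z where "z = (\<lambda>k. - \<i> * of_real t * of_real (?h k))"
      have z0: "z k \<noteq> 0" for k using elim by (simp add: z_def del: of_nat_Suc)
      have "z \<longlonglongrightarrow> - \<i> * of_real t * of_real 0"
        unfolding z_def by (intro tendsto_mult tendsto_const tendsto_of_real lim_inverse_n'[THEN LIMSEQ_Suc])
      then have "filterlim z (at 0) sequentially"
        unfolding filterlim_at using z0 by auto
      then have "(\<lambda>k. (exp (z k) - 1) / z k) \<longlonglongrightarrow> 1"
        by (rule filterlim_compose[OF lim_exp_minus_1])
      then have "(\<lambda>k. iexp (- (t * x)) * ((exp (z k) - 1) / z k) * char M t) \<longlonglongrightarrow> iexp (- (t * x)) * 1 * char M t"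
        by (intro tendsto_mult tendsto_const)
      moreover have "iexp (- (t * x)) * ((exp (z k) - 1) / z k) * char M t = of_real (real (Suc k)) * ?F k t" for k
      proof -
        have "iexp (- (t * (x + ?h k))) = iexp (- (t * x)) * exp (z k)"
          unfolding mult_exp_exp z_def by (rule arg_cong[of _ _ exp]) (simp add: algebra_simps)
        then have "iexp (- (t * x)) - iexp (- (t * (x + ?h k))) = - iexp (- (t * x)) * (exp (z k) - 1)"
          by (simp add: algebra_simps)
        moreover have "\<i> * of_real t = - z k * of_real (real (Suc k))"
          by (simp add: z_def field_simps del: of_nat_Suc)
        ultimately show ?thesis using z0[of k] elim by (simp add: field_simps del: of_nat_Suc)
      qed
      ultimately show ?case by simp
    qed
  qed measurable
  then have "(\<lambda>k. 1 / (2 * pi) * (CLBINT t. of_real (real (Suc k)) * ?F k t)) \<longlonglongrightarrow> 1 / (2 * pi) * (CLBINT t. iexp (- (t * x)) * char M t)"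
    by (intro tendsto_mult tendsto_const)
  with 1 show ?thesis by (rule LIMSEQ_unique)
qed

section \<open>The characteristic function away from zero\<close>

context heavy_tail_dist
begin

lemma integrable_f: "integrable lborel f"
  using integrable_power_f[of 0] alpha_pos by simp

lemma phi_integral: "phi t = (\<integral>x. f x * cos (t * x) \<partial>lborel)"
  by (simp add: phi_def trig_moment_def)

lemma integrable_f_cos: "integrable lborel (\<lambda>x. f x * cos (t * x))"
  using integrable_trig_moment[of 0 f t 0] integrable_f by simp

lemma phi_minus: "phi (- t) = phi t"
  by (simp add: phi_integral)

text \<open>Otherwise \<sigma> phi t \<ge> 1 for a sign \<sigma>, which forces \<sigma> cos (t x) =
  1 at almost every x with f x \<noteq> 0. Such x satisfy sin (t x) = 0 and form a countable set,
  too small to carry mass 1.\<close>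

lemma phi_abs_less_1:
  assumes t: "t \<noteq> 0"
  shows "\<bar>phi t\<bar> < 1"
proof -
  have pos: "\<sigma> * phi t < 1" if \<sigma>: "\<bar>\<sigma>\<bar> = 1" for \<sigma>
  proof (rule ccontr)
    assume "\<not> \<sigma> * phi t < 1"
    have i: "integrable lborel (\<lambda>x. f x - \<sigma> * (f x * cos (t * x)))"
      by (intro Bochner_Integration.integrable_diff integrable_mult_right integrable_f integrable_f_cos)
    have nn: "0 \<le> f x - \<sigma> * (f x * cos (t * x))" for x
    proof -
      have "\<sigma> * cos (t * x) \<le> \<bar>\<sigma>\<bar> * \<bar>cos (t * x)\<bar>" by (metis abs_ge_self abs_mult)
      also have "\<dots> \<le> 1" using \<sigma> by simp
      finally have "f x * (\<sigma> * cos (t * x)) \<le> f x * 1" using f_nonneg by (intro mult_left_mono) auto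
      then show ?thesis by (simp add: mult_ac)
    qed
    have "(\<integral>x. f x - \<sigma> * (f x * cos (t * x)) \<partial>lborel) = 1 - \<sigma> * phi t"
      by (subst Bochner_Integration.integral_diff)
         (auto simp: integrable_f integrable_f_cos mass phi_integral)
    moreover have "0 \<le> (\<integral>x. f x - \<sigma> * (f x * cos (t * x)) \<partial>lborel)"
      using nn by (intro Bochner_Integration.integral_nonneg) auto
    ultimately have "(\<integral>x. f x - \<sigma> * (f x * cos (t * x)) \<partial>lborel) = 0"
      using \<open>\<not> \<sigma> * phi t < 1\<close> by simp
    then have ae: "AE x in lborel. f x - \<sigma> * (f x * cos (t * x)) = 0"
      using integral_nonneg_eq_0_iff_AE[OF i] nn by auto
    have "{x. sin (t * x) = 0} \<subseteq> range (\<lambda>k::int. of_int k * pi / t)"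
    proof
      fix x assume "x \<in> {x. sin (t * x) = 0}"
      then obtain k :: int where "t * x = of_int k * pi" by (auto simp: sin_zero_iff_int2)
      then have "x = of_int k * pi / t" using t by (simp add: field_simps)
      then show "x \<in> range (\<lambda>k::int. of_int k * pi / t)" by blast
    qed
    then have "countable {x. sin (t * x) = 0}" by (rule countable_subset) simp
    then have "{x. sin (t * x) = 0} \<in> null_sets lborel" by (rule countable_imp_null_set_lborel)
    then have "AE x in lborel. sin (t * x) \<noteq> 0" by (rule AE_I') auto
    with ae have "AE x in lborel. f x = 0"
    proof eventually_elim
      case (elim x)
      show ?case
      proof (rule ccontr)
        assume "f x \<noteq> 0"
        then have "\<sigma> * cos (t * x) = 1" using elim(1) by (simp add: field_simps)
        then have "\<bar>\<sigma>\<bar> * \<bar>cos (t * x)\<bar> = 1" by (metis abs_mult abs_one)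
        then have "\<bar>cos (t * x)\<bar> = 1" using \<sigma> by simp
        then have "(cos (t * x))\<^sup>2 = 1" by (metis abs_1 power2_abs one_power2)
        then have "sin (t * x) = 0" using sin_cos_squared_add[of "t * x"] by simp
        with elim(2) show False by simp
      qed
    qed
    then have "(\<integral>x. f x \<partial>lborel) = 0" by (rule integral_eq_zero_AE)
    with mass show False by simp
  qed
  show ?thesis using pos[of 1] pos[of "-1"] by (auto simp: abs_less_iff)
qed

lemma phi_Lipschitz:
  obtains B where "B \<ge> 0" "\<And>s t. \<bar>phi s - phi t\<bar> \<le> B * \<bar>s - t\<bar>"
proof
  have i: "integrable lborel (\<lambda>x. \<bar>x\<bar> powr 1 * f x)"
    by (rule integrable_powr_f) (use N N_pos in auto)
  show "0 \<le> (\<integral>x. \<bar>x\<bar> powr 1 * f x \<partial>lborel)" by (intro Bochner_Integration.integral_nonneg) (simp add: f_nonneg)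
  fix s t
  have "\<bar>phi s - phi t\<bar> = \<bar>\<integral>x. f x * cos (s * x) - f x * cos (t * x) \<partial>lborel\<bar>"
    unfolding phi_integral by (subst Bochner_Integration.integral_diff[OF integrable_f_cos integrable_f_cos]) simp
  also have "\<dots> \<le> (\<integral>x. \<bar>f x * cos (s * x) - f x * cos (t * x)\<bar> \<partial>lborel)" by (rule integral_abs_bound)
  also have "\<dots> \<le> (\<integral>x. \<bar>s - t\<bar> * (\<bar>x\<bar> powr 1 * f x) \<partial>lborel)"
  proof (rule Bochner_Integration.integral_mono)
    show "integrable lborel (\<lambda>x. \<bar>f x * cos (s * x) - f x * cos (t * x)\<bar>)"
      by (intro integrable_abs Bochner_Integration.integrable_diff integrable_f_cos)
    show "integrable lborel (\<lambda>x. \<bar>s - t\<bar> * (\<bar>x\<bar> powr 1 * f x))" by (intro integrable_mult_right i)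
    fix x
    have "\<bar>f x * cos (s * x) - f x * cos (t * x)\<bar> = f x * \<bar>cos (s * x) - cos (t * x)\<bar>"
      using f_nonneg[of x] by (simp add: abs_mult flip: right_diff_distrib)
    also have "\<dots> \<le> f x * \<bar>s * x - t * x\<bar>" by (intro mult_left_mono abs_cos_diff_le f_nonneg)
    also have "\<dots> = \<bar>s - t\<bar> * (\<bar>x\<bar> powr 1 * f x)" by (simp add: abs_mult flip: left_diff_distrib)
    finally show "\<bar>f x * cos (s * x) - f x * cos (t * x)\<bar> \<le> \<bar>s - t\<bar> * (\<bar>x\<bar> powr 1 * f x)" .
  qed
  finally show "\<bar>phi s - phi t\<bar> \<le> (\<integral>x. \<bar>x\<bar> powr 1 * f x \<partial>lborel) * \<bar>s - t\<bar>"
    by (simp only: integral_mult_right_zero mult.commute)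
qed

text \<open>A Lipschitz function that is at least r in modulus at t stays above r / 2 on an interval
  of fixed length to the right of t, which the vanishing tail integral of |phi| excludes for large
  t.\<close>

lemma phi_eventually_small:
  assumes int: "integrable lborel phi" and r: "r > 0"
  shows "eventually (\<lambda>t. \<bar>phi t\<bar> < r) at_top"
proof -
  obtain B where B: "B \<ge> 0" "\<And>s t. \<bar>phi s - phi t\<bar> \<le> B * \<bar>s - t\<bar>"
    by (rule phi_Lipschitz) blast
  \<comment> \<open>On an interval of this length phi varies by at most B e \<le> r / 2; B + 1
    guards against B = 0.\<close>
  define e where "e = r / (2 * (B + 1))"
  have e: "e > 0" using r B by (simp add: e_def)
  have Be: "B * e \<le> r / 2"
  proof -
    have "B * e \<le> (B + 1) * e" using e by simp
    also have "\<dots> = r / 2" using B by (simp add: e_def field_simps)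
    finally show ?thesis .
  qed
  have [measurable]: "phi \<in> borel_measurable borel" using borel_measurable_integrable[OF int] by simp
  have it: "integrable lborel (\<lambda>u. indicator {t..} u * \<bar>phi u\<bar>)" for t
    using integrable_mult_indicator[OF _ integrable_abs[OF int], of "{t..}"] by simp
  have "((\<lambda>t. \<integral>u. indicator {t..} u * \<bar>phi u\<bar> \<partial>lborel) \<longlongrightarrow> integral\<^sup>L lborel (\<lambda>u::real. 0::real)) at_top"
  proof (rule integral_dominated_convergence_at_top[where w = "\<lambda>u. \<bar>phi u\<bar>"])
    show "AE u in lborel. ((\<lambda>t. indicator {t..} u * \<bar>phi u\<bar>) \<longlongrightarrow> 0) at_top"
    proof (rule AE_I2, rule tendsto_eventually)
      fix u :: real
      show "\<forall>\<^sub>F t in at_top. indicator {t..} u * \<bar>phi u\<bar> = 0"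
        using eventually_gt_at_top[of u] by eventually_elim (auto simp: indicator_def)
    qed
    show "\<forall>\<^sub>F t in at_top. AE u in lborel. norm (indicator {t..} u * \<bar>phi u\<bar>) \<le> \<bar>phi u\<bar>"
      by (intro always_eventually allI AE_I2) (auto simp: indicator_def)
  qed (use int in \<open>auto intro: integrable_abs\<close>)
  then have "((\<lambda>t. \<integral>u. indicator {t..} u * \<bar>phi u\<bar> \<partial>lborel) \<longlongrightarrow> 0) at_top" by simp
  then have "eventually (\<lambda>t. (\<integral>u. indicator {t..} u * \<bar>phi u\<bar> \<partial>lborel) < e * (r / 2)) at_top"
    by (rule order_tendstoD(2)) (use e r in simp)
  then show ?thesis
  proof eventually_elim
    case (elim t)
    show ?case
    proof (rule ccontr)
      assume "\<not> \<bar>phi t\<bar> < r"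
      have "e * (r / 2) = (\<integral>u. indicator {t..t + e} u * (r / 2) \<partial>lborel)" using e by simp
      also have "\<dots> \<le> (\<integral>u. indicator {t..} u * \<bar>phi u\<bar> \<partial>lborel)"
      proof (rule Bochner_Integration.integral_mono[OF _ it])
        show "integrable lborel (\<lambda>u. indicator {t..t + e} u * (r / 2))"
          by (intro integrable_mult_left integrable_real_indicator) (auto simp: emeasure_lborel_Icc_eq)
        fix u
        show "indicator {t..t + e} u * (r / 2) \<le> indicator {t..} u * \<bar>phi u\<bar>"
        proof (cases "u \<in> {t..t + e}")
          case True
          have "\<bar>phi t - phi u\<bar> \<le> B * \<bar>t - u\<bar>" by (rule B(2))
          also have "\<dots> \<le> B * e" using True B(1) by (intro mult_left_mono) auto
          finally have "\<bar>phi t - phi u\<bar> \<le> r / 2" using Be by linarith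
          then have "r / 2 \<le> \<bar>phi u\<bar>" using \<open>\<not> \<bar>phi t\<bar> < r\<close> by linarith
          then show ?thesis using True by simp
        qed (auto simp: indicator_def)
      qed
      finally show False using elim by simp
    qed
  qed
qed

text \<open>Beyond some T the modulus is below 1 / 2; on the compact rest it attains its maximum,
  which is below 1. Symmetry covers negative t.\<close>

lemma phi_gap:
  assumes int: "integrable lborel phi" and e: "e > 0"
  obtains q where "0 \<le> q" "q < 1" "\<And>t. \<bar>t\<bar> \<ge> e \<Longrightarrow> \<bar>phi t\<bar> \<le> q"
proof -
  obtain T where T: "\<And>t. t \<ge> T \<Longrightarrow> \<bar>phi t\<bar> < 1 / 2"
    using phi_eventually_small[OF int, of "1 / 2"] by (auto simp: eventually_at_top_linorder)
  have "\<exists>x\<in>{e..max e T}. \<forall>y\<in>{e..max e T}. \<bar>phi y\<bar> \<le> \<bar>phi x\<bar>"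
    by (rule continuous_attains_sup)
      (auto intro!: continuous_intros continuous_at_imp_continuous_on continuous_phi)
  then obtain x where x: "x \<in> {e..max e T}" "\<And>y. y \<in> {e..max e T} \<Longrightarrow> \<bar>phi y\<bar> \<le> \<bar>phi x\<bar>" by blast
  define q where "q = max (1 / 2) \<bar>phi x\<bar>"
  have pos: "\<bar>phi t\<bar> \<le> q" if "t \<ge> e" for t
    using x(2)[of t] T[of t] that by (cases "t \<le> max e T") (auto simp: q_def le_max_iff_disj)
  show thesis
  proof (rule that[of q])
    show "q < 1" using phi_abs_less_1[of x] x(1) e by (auto simp: q_def)
    show "\<bar>phi t\<bar> \<le> q" if "\<bar>t\<bar> \<ge> e" for t
      using pos[of t] pos[of "- t"] that by (cases "t \<ge> 0") (auto simp: phi_minus)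
  qed (simp add: q_def)
qed

end

section \<open>Limits of the rescaled Fourier integrals\<close>

lemma integral_dominated_convergence_eventually:
  fixes f :: "'a \<Rightarrow> 'b::{banach, second_countable_topology}"
  assumes f: "f \<in> borel_measurable M" and s: "\<And>i. s i \<in> borel_measurable M" and w: "integrable M w"
    and lim: "AE x in M. (\<lambda>i. s i x) \<longlonglongrightarrow> f x"
    and bound: "\<forall>\<^sub>F i in sequentially. AE x in M. norm (s i x) \<le> w x"
  shows "(\<lambda>i. integral\<^sup>L M (s i)) \<longlonglongrightarrow> integral\<^sup>L M f"
proof -
  obtain n where n: "\<And>i. i \<ge> n \<Longrightarrow> AE x in M. norm (s i x) \<le> w x"
    using bound by (auto simp: eventually_sequentially)
  show ?thesis
  proof (rule LIMSEQ_offset[of _ n], rule integral_dominated_convergence[OF f s w])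
    show "AE x in M. (\<lambda>i. s (i + n) x) \<longlonglongrightarrow> f x"
      using lim by eventually_elim (rule LIMSEQ_ignore_initial_segment)
    show "AE x in M. norm (s (i + n) x) \<le> w x" for i by (rule n) simp
  qed
qed

lemma abs_exp_minus_1_le: "\<bar>exp x - 1\<bar> \<le> \<bar>x\<bar> * exp \<bar>x\<bar>" for x :: real
proof -
  have "complex_of_real (exp x - 1) = exp (of_real x) - (\<Sum>k\<le>0. of_real x ^ k / fact k)"
    by (simp add: exp_of_real)
  then have "norm (complex_of_real (exp x - 1)) \<le> exp \<bar>x\<bar> * \<bar>x\<bar>"
    using Taylor_exp[of "of_real x" 0] by simp
  then show ?thesis unfolding norm_of_real by (simp only: mult.commute)
qed

lemma power_split_square:
  fixes s :: "'a::monoid_mult"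
  assumes "2 \<le> l"
  shows "s ^ l = s\<^sup>2 * s ^ (l - 2)"
proof -
  have "2 + (l - 2) = l" using assms by simp
  with power_add[of s 2 "l - 2"] show ?thesis by (simp only:)
qed

context heavy_tail_dist
begin

lemma log_rem_minus: "log_rem (- t) = log_rem t"
  by (simp add: log_rem_def phi_minus)

lemma log_rem_abs: "log_rem \<bar>t\<bar> = log_rem t"
  by (simp add: abs_if log_rem_minus)

lemma log_rem_0: "log_rem 0 = 0"
  unfolding log_rem_def by (simp add: phi_0 coeff_Wpoly_0 sum.lessThan_Suc_shift del: sum.lessThan_Suc)

lemma phi_measurable [measurable]: "phi \<in> borel_measurable borel"
  by (intro borel_measurable_continuous_onI continuous_at_imp_continuous_on) (simp add: continuous_phi)

lemma ln_phi_eq: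
  "ln (phi u) = - u\<^sup>2 / 2 - (\<Sum>l=3..2 * N. log_coef l * u ^ l) + log_rem u"
proof -
  have "{..2 * N} = {0, 1, 2} \<union> {3..2 * N}" using N_pos by auto
  then have "(\<Sum>l\<le>2 * N. log_coef l * u ^ l) = (\<Sum>l\<in>{0, 1, 2}. log_coef l * u ^ l) + (\<Sum>l=3..2 * N. log_coef l * u ^ l)"
    by (simp only:) (rule sum.union_disjoint, auto)
  also have "(\<Sum>l\<in>{0, 1, 2}. log_coef l * u ^ l) = u\<^sup>2 / 2"
    using coeff_Wpoly_1 by (simp add: log_coef_def coeff_Wpoly_0)
  finally show ?thesis unfolding log_rem_def sum_log_coef by simp
qed

text \<open>The value of \<open>edge_poly\<close> at h = 1 / sqrt n, as \<open>edge_poly_eq\<close>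
  shows; it is real because only even powers of i t survive.\<close>

definition edge_real :: "nat \<Rightarrow> real \<Rightarrow> real" where
  "edge_real n t = - real n * (\<Sum>l=3..2 * N. log_coef l * (t / sqrt (real n)) ^ l)"

lemma phi_power_eq:
  assumes n: "n \<ge> 1" and pos: "phi (t / sqrt (real n)) > 0"
  shows "phi (t / sqrt (real n)) ^ n = exp (- t\<^sup>2 / 2) * exp (edge_real n t) * exp (real n * log_rem (t / sqrt (real n)))"
proof -
  let ?u = "t / sqrt (real n)"
  have "phi ?u ^ n = exp (real n * ln (phi ?u))"
    using pos by (simp add: exp_of_nat_mult)
  also have "real n * ln (phi ?u) = - t\<^sup>2 / 2 + edge_real n t + real n * log_rem ?u"
  proof -
    have "real n * ?u\<^sup>2 = t\<^sup>2" using n by (simp add: power_divide)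
    then show ?thesis unfolding ln_phi_eq edge_real_def by (simp add: algebra_simps)
  qed
  finally show ?thesis by (simp only: exp_add)
qed

lemma edge_real_eq:
  assumes n: "n \<ge> 1"
  shows "edge_real n t = (\<Sum>l=3..2 * N. - log_coef l * t ^ l * (1 / sqrt (real n)) ^ (l - 2))"
proof -
  define s where "s = sqrt (real n)"
  have s: "s > 0" "real n = s\<^sup>2" using n by (auto simp: s_def)
  show ?thesis
    unfolding edge_real_def s_def[symmetric] unfolding s(2) sum_distrib_left
  proof (intro sum.cong refl)
    fix l :: nat assume "l \<in> {3..2 * N}"
    then have "s ^ l = s\<^sup>2 * s ^ (l - 2)" by (intro power_split_square) auto
    then show "- s\<^sup>2 * (log_coef l * (t / s) ^ l) = - log_coef l * t ^ l * (1 / s) ^ (l - 2)"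
      using s(1) by (simp add: power_divide)
  qed
qed

lemma edge_poly_eq:
  assumes cum: "\<And>l t. l \<le> 2 * N \<Longrightarrow> of_real (\<kappa> l) * (\<i> * of_real t) ^ l / fact l = (of_real (- log_coef l * t ^ l) :: complex)"
    and n: "n \<ge> 1"
  shows "poly (edge_poly \<kappa> (2 * N) t) (of_real (1 / sqrt (real n))) = of_real (edge_real n t)"
proof -
  have "poly (edge_poly \<kappa> (2 * N) t) (of_real (1 / sqrt (real n))) = (\<Sum>l=3..2 * N. of_real (- log_coef l * t ^ l) * of_real (1 / sqrt (real n)) ^ (l - 2))"
    unfolding edge_poly_def poly_sum poly_monom using cum by (intro sum.cong refl) (simp del: of_real_mult of_real_minus)
  also have "\<dots> = of_real (edge_real n t)"
    unfolding edge_real_eq[OF n] by simp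
  finally show ?thesis .
qed

text \<open>The sum starts at l = 3, so beyond n u^2 = t^2 at least one factor |u| \<le> e is left.
  The value 1 / 8 is a budget: this exponent and n r take t^2/8 each, and exp(-t^2/2) is left as
  exp(-t^2/4).\<close>

lemma edge_real_bound:
  assumes n: "n \<ge> 1" and u: "\<bar>t / sqrt (real n)\<bar> \<le> e" and e: "e \<le> 1" "e * (\<Sum>l=3..2 * N. \<bar>log_coef l\<bar>) \<le> 1 / 8"
  shows "\<bar>edge_real n t\<bar> \<le> t\<^sup>2 / 8"
proof -
  let ?u = "t / sqrt (real n)" and ?S = "\<Sum>l=3..2 * N. \<bar>log_coef l\<bar>"
  have S0: "0 \<le> ?S" by (intro sum_nonneg) simp
  have "\<bar>edge_real n t\<bar> = real n * \<bar>\<Sum>l=3..2 * N. log_coef l * ?u ^ l\<bar>" by (simp add: edge_real_def abs_mult)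
  also have "\<dots> \<le> real n * (\<Sum>l=3..2 * N. \<bar>log_coef l\<bar> * \<bar>?u\<bar> ^ 3)"
  proof (intro mult_left_mono order_trans[OF sum_abs] sum_mono)
    fix l assume "l \<in> {3..2 * N}"
    then have "\<bar>?u\<bar> ^ l \<le> \<bar>?u\<bar> ^ 3" using u e by (intro power_decreasing) auto
    then show "\<bar>log_coef l * ?u ^ l\<bar> \<le> \<bar>log_coef l\<bar> * \<bar>?u\<bar> ^ 3"
      unfolding abs_mult power_abs by (intro mult_left_mono) auto
  qed simp
  also have "\<dots> = (real n * ?u\<^sup>2) * (\<bar>?u\<bar> * ?S)"
    unfolding sum_distrib_right[symmetric] by (simp only: power3_eq_cube power2_eq_square abs_mult_self_eq mult_ac flip: abs_mult)
  also have "real n * ?u\<^sup>2 = t\<^sup>2" using n by (simp add: power_divide)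
  also have "t\<^sup>2 * (\<bar>?u\<bar> * ?S) \<le> t\<^sup>2 * (1 / 8)"
    by (intro mult_left_mono order_trans[OF mult_right_mono[OF u S0] e(2)]) simp
  finally show ?thesis by simp
qed

text \<open>Translates the limits for s = 1 / t \<rightarrow> \<infinity> into estimates on a single
  interval around 0; evenness of phi and r supplies negative t.\<close>

lemma small_arg_estimates:
  assumes sc: "slow_scale \<Lambda>" and lim: "((\<lambda>s. log_rem (1 / s) * s powr \<alpha> / \<Lambda> s) \<longlongrightarrow> c) at_top"
  obtains e where "0 < e" "e \<le> 1" "e * (\<Sum>l=3..2 * N. \<bar>log_coef l\<bar>) \<le> 1 / 8"
    "\<And>t. \<bar>t\<bar> \<le> e \<Longrightarrow> 0 < phi t" "\<And>t. \<bar>t\<bar> \<le> e \<Longrightarrow> \<bar>log_rem t\<bar> \<le> t\<^sup>2 / 8"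
    "\<And>t. t \<noteq> 0 \<Longrightarrow> \<bar>t\<bar> \<le> e \<Longrightarrow> \<bar>log_rem t\<bar> \<le> (\<bar>c\<bar> + 1) * \<bar>t\<bar> powr \<alpha> * \<Lambda> (1 / \<bar>t\<bar>)"
proof -
  let ?S = "\<Sum>l=3..2 * N. \<bar>log_coef l\<bar>"
  have S0: "0 \<le> ?S" by (intro sum_nonneg) simp
  have p0: "(phi \<longlongrightarrow> 1) (at 0)" using isContD[OF continuous_phi[of 0]] by (simp add: phi_0)
  have "filterlim (\<lambda>s::real. 1 / s) (at 0) at_top" by real_asymp
  then have "((\<lambda>s. phi (1 / s)) \<longlongrightarrow> 1) at_top" by (rule filterlim_compose[OF p0])
  then have 1: "\<forall>\<^sub>F s in at_top. 0 < phi (1 / s)" by (rule order_tendstoD) simp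
  have 2: "\<forall>\<^sub>F s in at_top. \<bar>log_rem (1 / s) * s ^ (2 * N)\<bar> < 1 / 8"
    using order_tendstoD(2)[OF tendsto_rabs[OF log_rem_small[OF lim sc]], of "1 / 8"] by simp
  have 3: "\<forall>\<^sub>F s in at_top. \<bar>log_rem (1 / s) * s powr \<alpha> / \<Lambda> s\<bar> < \<bar>c\<bar> + 1"
    using order_tendstoD(2)[OF tendsto_rabs[OF lim], of "\<bar>c\<bar> + 1"] by simp
  have 4: "\<forall>\<^sub>F s in at_top. 0 < \<Lambda> s"
    using slow_scale_potter[OF sc zero_less_one] by (metis eventually_at_top_linorder)
  have "\<forall>\<^sub>F s in at_top. 0 < phi (1 / s) \<and> \<bar>log_rem (1 / s) * s ^ (2 * N)\<bar> < 1 / 8 \<and> \<bar>log_rem (1 / s) * s powr \<alpha> / \<Lambda> s\<bar> < \<bar>c\<bar> + 1 \<and> 0 < \<Lambda> s"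
    using 1 2 3 4 by eventually_elim auto
  then obtain s1 where s1: "\<And>s. s \<ge> s1 \<Longrightarrow> 0 < phi (1 / s) \<and> \<bar>log_rem (1 / s) * s ^ (2 * N)\<bar> < 1 / 8 \<and> \<bar>log_rem (1 / s) * s powr \<alpha> / \<Lambda> s\<bar> < \<bar>c\<bar> + 1 \<and> 0 < \<Lambda> s"
    by (auto simp: eventually_at_top_linorder)
  \<comment> \<open>With e = 1 / \<open>s2\<close> the summand 1 yields e \<le> 1, and 8 S yields e
    S \<le> 1 / 8.\<close>
  define s2 where "s2 = max s1 (1 + 8 * ?S)"
  have s2: "s2 \<ge> 1" "s2 \<ge> s1" "s2 \<ge> 8 * ?S" using S0 by (auto simp: s2_def le_max_iff_disj)
  have pos: "0 < phi t \<and> \<bar>log_rem t\<bar> \<le> t\<^sup>2 / 8 \<and> \<bar>log_rem t\<bar> \<le> (\<bar>c\<bar> + 1) * t powr \<alpha> * \<Lambda> (1 / t)"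
    if t: "0 < t" "t \<le> 1 / s2" for t
  proof -
    define s where "s = 1 / t"
    have s: "s \<ge> s2" "t = 1 / s" "s > 0" using t s2 by (auto simp: s_def field_simps)
    have s11: "s \<ge> s1" using s s2 by simp
    have "\<bar>log_rem t\<bar> * s\<^sup>2 \<le> \<bar>log_rem t\<bar> * s ^ (2 * N)"
      using s s2 N_pos by (intro mult_left_mono power_increasing) auto
    also have "\<dots> \<le> 1 / 8" using s1[OF s11] s by (simp add: abs_mult)
    finally have "\<bar>log_rem t\<bar> \<le> 1 / 8 / s\<^sup>2" using s(3) by (simp add: pos_le_divide_eq)
    moreover have "t\<^sup>2 = 1 / s\<^sup>2" using s(2) by (simp add: power_divide)
    ultimately have a: "\<bar>log_rem t\<bar> \<le> t\<^sup>2 / 8" by simp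
    have "\<bar>log_rem t * s powr \<alpha> / \<Lambda> s\<bar> \<le> \<bar>c\<bar> + 1" "0 < \<Lambda> s" using s1[OF s11] s by auto
    then have "\<bar>log_rem t\<bar> * s powr \<alpha> \<le> (\<bar>c\<bar> + 1) * \<Lambda> s" by (simp add: abs_mult field_simps)
    then have z1: "\<bar>log_rem t\<bar> * s powr \<alpha> * s powr (- \<alpha>) \<le> (\<bar>c\<bar> + 1) * \<Lambda> s * s powr (- \<alpha>)" by (intro mult_right_mono) auto
    have "s powr \<alpha> * s powr (- \<alpha>) = 1" using s by (simp flip: powr_add)
    then have z2: "\<bar>log_rem t\<bar> = \<bar>log_rem t\<bar> * s powr \<alpha> * s powr (- \<alpha>)" by (simp add: mult.assoc)
    have z3: "s powr (- \<alpha>) = t powr \<alpha>"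
      unfolding s(2) using s(3) by (simp add: powr_divide powr_minus_divide)
    have "\<bar>log_rem t\<bar> \<le> (\<bar>c\<bar> + 1) * \<Lambda> s * s powr (- \<alpha>)" using z1 z2 by linarith
    then have b: "\<bar>log_rem t\<bar> \<le> (\<bar>c\<bar> + 1) * t powr \<alpha> * \<Lambda> (1 / t)" unfolding z3 unfolding s_def by (simp only: mult_ac)
    have "0 < phi (1 / s)" using s1[OF s11] by blast
    then have "0 < phi t" by (simp only: s(2)[symmetric])
    then show ?thesis using a b by blast
  qed
  show thesis
  proof (rule that[of "1 / s2"])
    show "0 < 1 / s2" "1 / s2 \<le> 1" using s2(1) by auto
    show "1 / s2 * ?S \<le> 1 / 8" using s2(1,3) by (simp add: divide_le_eq)
    have abs_phi: "phi \<bar>t\<bar> = phi t" for t by (simp add: abs_if phi_minus)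
    have est: "0 < phi t \<and> \<bar>log_rem t\<bar> \<le> t\<^sup>2 / 8 \<and> \<bar>log_rem t\<bar> \<le> (\<bar>c\<bar> + 1) * \<bar>t\<bar> powr \<alpha> * \<Lambda> (1 / \<bar>t\<bar>)"
      if "t \<noteq> 0" "\<bar>t\<bar> \<le> 1 / s2" for t
      using pos[of "\<bar>t\<bar>"] that unfolding abs_phi log_rem_abs power2_abs zero_less_abs_iff by blast
    show "0 < phi t" if "\<bar>t\<bar> \<le> 1 / s2" for t
      using est[of t] that phi_0 by (cases "t = 0") (simp, blast)
    show "\<bar>log_rem t\<bar> \<le> t\<^sup>2 / 8" if "\<bar>t\<bar> \<le> 1 / s2" for t
      using est[of t] that log_rem_0 by (cases "t = 0") (simp, blast)
    show "\<bar>log_rem t\<bar> \<le> (\<bar>c\<bar> + 1) * \<bar>t\<bar> powr \<alpha> * \<Lambda> (1 / \<bar>t\<bar>)" if "t \<noteq> 0" "\<bar>t\<bar> \<le> 1 / s2" for t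
      using est[OF that] by blast
  qed
qed

lemma sqrt_weight:
  assumes "n \<ge> 1"
  shows "real n powr (\<alpha> / 2 - 1) = sqrt (real n) powr (\<alpha> - 2)"
proof -
  have "sqrt (real n) powr (\<alpha> - 2) = (real n powr (1 / 2)) powr (\<alpha> - 2)" using assms by (simp add: powr_half_sqrt)
  also have "\<dots> = real n powr (\<alpha> / 2 - 1)" by (simp add: powr_powr diff_divide_distrib)
  finally show ?thesis by simp
qed

text \<open>For |t| \<le> e sqrt n the difference is the Gaussian times exp (edge_real) times exp (n
  r) - 1. Pointwise the last factor is asymptotic to n r, whose normalisation tends to c
  |t|^\<alpha> by slow variation. The domination rests on |exp y - 1| \<le> |y| exp |y| and a Potter
  bound.\<close>

lemma central_part_limit:
  assumes sc: "slow_scale \<Lambda>" and lim: "((\<lambda>s. log_rem (1 / s) * s powr \<alpha> / \<Lambda> s) \<longlongrightarrow> c) at_top"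
    and e: "0 < e" "e \<le> 1" "e * (\<Sum>l=3..2 * N. \<bar>log_coef l\<bar>) \<le> 1 / 8"
    "\<And>t. \<bar>t\<bar> \<le> e \<Longrightarrow> 0 < phi t" "\<And>t. \<bar>t\<bar> \<le> e \<Longrightarrow> \<bar>log_rem t\<bar> \<le> t\<^sup>2 / 8"
    "\<And>t. t \<noteq> 0 \<Longrightarrow> \<bar>t\<bar> \<le> e \<Longrightarrow> \<bar>log_rem t\<bar> \<le> (\<bar>c\<bar> + 1) * \<bar>t\<bar> powr \<alpha> * \<Lambda> (1 / \<bar>t\<bar>)"
  shows "(\<lambda>n. CLBINT t. iexp (- (t * x)) * of_real (real n powr (\<alpha> / 2 - 1) / \<Lambda> (sqrt (real n)) *
      (of_bool (\<bar>t / sqrt (real n)\<bar> \<le> e) * (phi (t / sqrt (real n)) ^ n - exp (- t\<^sup>2 / 2) * exp (edge_real n t)))))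
    \<longlonglongrightarrow> (CLBINT t. iexp (- (t * x)) * of_real (exp (- t\<^sup>2 / 2) * (c * \<bar>t\<bar> powr \<alpha>)))"
proof -
  define D where "D = (\<lambda>n t. real n powr (\<alpha> / 2 - 1) / \<Lambda> (sqrt (real n)) *
      (of_bool (\<bar>t / sqrt (real n)\<bar> \<le> e) * (phi (t / sqrt (real n)) ^ n - exp (- t\<^sup>2 / 2) * exp (edge_real n t))))"
  obtain C s0 where C: "C > 0" "s0 > 0" "\<And>s. s \<ge> s0 \<Longrightarrow> 0 < \<Lambda> s"
    "\<And>s u. s \<ge> s0 \<Longrightarrow> 0 < u \<Longrightarrow> \<bar>\<Lambda> (u * s)\<bar> \<le> C * (u powr 1 + u powr (- 1)) * \<Lambda> s"
    using slow_scale_potter[OF sc zero_less_one] by blast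
  \<comment> \<open>The Potter bound with exponent 1 replaces |t|^\<alpha> by |t|^(\<alpha> - 1) +
    |t|^(\<alpha> + 1), and (1 + |t|)^k dominates both. The rate 1 / 4 in \<open>w\<close> is 1 / 2
    - 1 / 8 - 1 / 8, from \<open>edge_real\<close> and from exp |n r|.\<close>
  define k where "k = nat \<lceil>\<alpha> + 1\<rceil>"
  define w where "w = (\<lambda>t::real. 2 * C * (\<bar>c\<bar> + 1) * (1 + \<bar>t\<bar>) ^ k * exp (- (1 / 4) * t\<^sup>2))"
  have sq: "filterlim (\<lambda>n. sqrt (real n)) at_top sequentially" by real_asymp
  have ev: "\<forall>\<^sub>F n in sequentially. n \<ge> 1 \<and> sqrt (real n) \<ge> s0"
    using eventually_ge_at_top[of 1] sq[unfolded filterlim_at_top, rule_format, of s0] by eventually_elim auto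
  have D_eq: "D n t = exp (- t\<^sup>2 / 2) * exp (edge_real n t) * (sqrt (real n) powr (\<alpha> - 2) / \<Lambda> (sqrt (real n)) * (exp (real n * log_rem (t / sqrt (real n))) - 1))"
    if "n \<ge> 1" "\<bar>t / sqrt (real n)\<bar> \<le> e" for n t
  proof -
    have "phi (t / sqrt (real n)) ^ n - exp (- t\<^sup>2 / 2) * exp (edge_real n t) = exp (- t\<^sup>2 / 2) * exp (edge_real n t) * (exp (real n * log_rem (t / sqrt (real n))) - 1)"
      unfolding phi_power_eq[OF that(1) e(4)[OF that(2)]] by (simp only: right_diff_distrib mult_1_right)
    moreover have "of_bool (\<bar>t / sqrt (real n)\<bar> \<le> e) = (1::real)" using that(2) by simp
    ultimately show ?thesis unfolding D_def sqrt_weight[OF that(1)] by (simp only: mult_1_left mult_ac)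
  qed
  have wt: "sqrt (real n) powr (\<alpha> - 2) * (real n * X) = sqrt (real n) powr \<alpha> * X" if "n \<ge> 1" for n X
  proof -
    have "sqrt (real n) powr \<alpha> = sqrt (real n) powr (\<alpha> - 2) * sqrt (real n) powr 2"
      by (simp only: powr_add[symmetric] diff_add_cancel)
    also have "sqrt (real n) powr 2 = real n" using that by (simp add: powr_numeral)
    finally show ?thesis by simp
  qed
  have nr: "\<bar>real n * log_rem (t / sqrt (real n))\<bar> \<le> t\<^sup>2 / 8" if "n \<ge> 1" "\<bar>t / sqrt (real n)\<bar> \<le> e" for n t
  proof -
    have "\<bar>real n * log_rem (t / sqrt (real n))\<bar> \<le> real n * ((t / sqrt (real n))\<^sup>2 / 8)"
      unfolding abs_mult using e(5)[OF that(2)] by (intro mult_mono) auto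
    also have "\<dots> = t\<^sup>2 / 8" using that by (simp add: power_divide)
    finally show ?thesis .
  qed
  have bound: "\<bar>D n t\<bar> \<le> w t" if n: "n \<ge> 1" "sqrt (real n) \<ge> s0" and t: "t \<noteq> 0" for n t
  proof (cases "\<bar>t / sqrt (real n)\<bar> \<le> e")
    case False
    then show ?thesis using C by (simp add: D_def w_def)
  next
    case True
    define s where "s = sqrt (real n)"
    have s: "s > 0" "\<Lambda> s > 0" using n C by (auto simp: s_def)
    let ?r = "log_rem (t / s)"
    have "\<bar>D n t\<bar> = exp (- t\<^sup>2 / 2) * exp (edge_real n t) * (s powr (\<alpha> - 2) / \<Lambda> s * \<bar>exp (real n * ?r) - 1\<bar>)"
      unfolding D_eq[OF n(1) True] s_def[symmetric] using s by (simp add: abs_mult)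
    also have "\<dots> \<le> exp (- t\<^sup>2 / 2) * exp (t\<^sup>2 / 8) * (s powr (\<alpha> - 2) / \<Lambda> s * (\<bar>real n * ?r\<bar> * exp (t\<^sup>2 / 8)))"
    proof (intro mult_mono mult_left_mono)
      show "exp (edge_real n t) \<le> exp (t\<^sup>2 / 8)" using edge_real_bound[OF n(1) True e(2,3)] by simp
      have "\<bar>exp (real n * ?r) - 1\<bar> \<le> \<bar>real n * ?r\<bar> * exp \<bar>real n * ?r\<bar>" by (rule abs_exp_minus_1_le)
      also have "\<dots> \<le> \<bar>real n * ?r\<bar> * exp (t\<^sup>2 / 8)"
        using nr[OF n(1) True] by (intro mult_left_mono) (auto simp: s_def)
      finally show "\<bar>exp (real n * ?r) - 1\<bar> \<le> \<bar>real n * ?r\<bar> * exp (t\<^sup>2 / 8)" .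
    qed (use s in auto)
    also have "\<dots> = (exp (- t\<^sup>2 / 2) * exp (t\<^sup>2 / 8) * exp (t\<^sup>2 / 8)) * ((s powr (\<alpha> - 2) * (real n * \<bar>?r\<bar>)) / \<Lambda> s)"
      by (simp add: abs_mult)
    also have "exp (- t\<^sup>2 / 2) * exp (t\<^sup>2 / 8) * exp (t\<^sup>2 / 8) = exp (- (1 / 4) * t\<^sup>2)"
      by (simp flip: exp_add)
    also have "s powr (\<alpha> - 2) * (real n * \<bar>?r\<bar>) = s powr \<alpha> * \<bar>?r\<bar>" unfolding s_def by (rule wt[OF n(1)])
    also have "exp (- (1 / 4) * t\<^sup>2) * (s powr \<alpha> * \<bar>?r\<bar> / \<Lambda> s) \<le> exp (- (1 / 4) * t\<^sup>2) * (2 * C * (\<bar>c\<bar> + 1) * (1 + \<bar>t\<bar>) ^ k)"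
    proof (intro mult_left_mono)
      have u: "0 < 1 / \<bar>t\<bar>" using t by simp
      have pw: "s powr \<alpha> * \<bar>t / s\<bar> powr \<alpha> = \<bar>t\<bar> powr \<alpha>" using s t by (simp add: powr_mult[symmetric] abs_divide)
      have "\<bar>?r\<bar> \<le> (\<bar>c\<bar> + 1) * \<bar>t / s\<bar> powr \<alpha> * \<Lambda> (1 / \<bar>t / s\<bar>)"
        using e(6)[of "t / s"] True s t by (simp add: s_def)
      also have "1 / \<bar>t / s\<bar> = 1 / \<bar>t\<bar> * s" using s by (simp add: abs_divide)
      finally have "s powr \<alpha> * \<bar>?r\<bar> \<le> s powr \<alpha> * ((\<bar>c\<bar> + 1) * \<bar>t / s\<bar> powr \<alpha> * \<Lambda> (1 / \<bar>t\<bar> * s))" by (intro mult_left_mono) auto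
      also have "\<dots> = (\<bar>c\<bar> + 1) * (s powr \<alpha> * \<bar>t / s\<bar> powr \<alpha>) * \<Lambda> (1 / \<bar>t\<bar> * s)" by (simp only: mult_ac)
      also have "\<dots> = (\<bar>c\<bar> + 1) * \<bar>t\<bar> powr \<alpha> * \<Lambda> (1 / \<bar>t\<bar> * s)" unfolding pw ..
      also have "\<dots> \<le> (\<bar>c\<bar> + 1) * \<bar>t\<bar> powr \<alpha> * (C * ((1 / \<bar>t\<bar>) powr 1 + (1 / \<bar>t\<bar>) powr (- 1)) * \<Lambda> s)"
        using C(4)[OF n(2) u] by (intro mult_left_mono) (auto simp: s_def)
      finally have "s powr \<alpha> * \<bar>?r\<bar> / \<Lambda> s \<le> (\<bar>c\<bar> + 1) * \<bar>t\<bar> powr \<alpha> * (C * ((1 / \<bar>t\<bar>) powr 1 + (1 / \<bar>t\<bar>) powr (- 1)))"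
        using s by (simp add: divide_le_eq mult_ac)
      also have "\<dots> = C * (\<bar>c\<bar> + 1) * (\<bar>t\<bar> powr (\<alpha> - 1) + \<bar>t\<bar> powr (\<alpha> + 1))"
      proof -
        have "(1 / \<bar>t\<bar>) powr 1 = \<bar>t\<bar> powr (- 1)" "(1 / \<bar>t\<bar>) powr (- 1) = \<bar>t\<bar> powr 1"
          using t by (auto simp: powr_minus_divide)
        moreover have "K * A * (C * (p + q)) = C * K * (A * p + A * q)" for K A p q :: real
          by (simp add: algebra_simps)
        ultimately show ?thesis by (simp only: powr_add[symmetric] diff_conv_add_uminus)
      qed
      also have "\<dots> \<le> C * (\<bar>c\<bar> + 1) * ((1 + \<bar>t\<bar>) ^ k + (1 + \<bar>t\<bar>) ^ k)"
      proof (intro mult_left_mono add_mono)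
        have a1: "\<alpha> \<ge> 1" using N N_pos by simp
        have "\<bar>t\<bar> powr (\<alpha> - 1) \<le> (1 + \<bar>t\<bar>) ^ nat \<lceil>\<alpha> - 1\<rceil>" using a1 by (intro abs_powr_le_poly) auto
        also have "\<dots> \<le> (1 + \<bar>t\<bar>) ^ k" unfolding k_def by (intro power_increasing nat_mono ceiling_mono) auto
        finally show "\<bar>t\<bar> powr (\<alpha> - 1) \<le> (1 + \<bar>t\<bar>) ^ k" .
        show "\<bar>t\<bar> powr (\<alpha> + 1) \<le> (1 + \<bar>t\<bar>) ^ k" unfolding k_def using a1 by (intro abs_powr_le_poly) auto
      qed (use C in auto)
      finally show "s powr \<alpha> * \<bar>?r\<bar> / \<Lambda> s \<le> 2 * C * (\<bar>c\<bar> + 1) * (1 + \<bar>t\<bar>) ^ k" by (simp add: algebra_simps)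
    qed auto
    finally show ?thesis by (simp add: w_def mult_ac)
  qed
  have lim_D: "(\<lambda>n. D n t) \<longlonglongrightarrow> exp (- t\<^sup>2 / 2) * (c * \<bar>t\<bar> powr \<alpha>)" if t: "t \<noteq> 0" for t
  proof -
    \<comment> \<open>With this scale 1 / v = |t| / sqrt n, so the limit of r at 1 / s can be
      composed with it; the passage from v back to sqrt n is slow variation with factor 1 /
      |t|.\<close>
    define v where "v = (\<lambda>n. sqrt (real n) / \<bar>t\<bar>)"
    have v: "filterlim v at_top sequentially"
    proof -
      have "filterlim (\<lambda>n. 1 / \<bar>t\<bar> * sqrt (real n)) at_top sequentially"
        by (rule filterlim_tendsto_pos_mult_at_top[OF tendsto_const _ sq]) (use t in simp)
      then show ?thesis by (simp add: v_def)
    qed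
    have ratio: "(\<lambda>n. \<Lambda> (1 / \<bar>t\<bar> * sqrt (real n)) / \<Lambda> (sqrt (real n))) \<longlonglongrightarrow> 1"
    proof -
      have "((\<lambda>s. \<Lambda> (1 / \<bar>t\<bar> * s) / \<Lambda> s) \<longlongrightarrow> 1) at_top"
      proof -
        have "slowly_varying \<Lambda>" using sc by (simp add: slow_scale_def)
        from this[unfolded slowly_varying_def, rule_format, of "1 / \<bar>t\<bar>"] t show ?thesis by simp
      qed
      then show ?thesis by (rule filterlim_compose[OF _ sq])
    qed
    have l1: "(\<lambda>n. log_rem (1 / v n) * v n powr \<alpha> / \<Lambda> (v n)) \<longlonglongrightarrow> c" by (rule filterlim_compose[OF lim v])
    have "(\<lambda>n. \<bar>t\<bar> powr \<alpha> * ((log_rem (1 / v n) * v n powr \<alpha> / \<Lambda> (v n)) * (\<Lambda> (1 / \<bar>t\<bar> * sqrt (real n)) / \<Lambda> (sqrt (real n))))) \<longlonglongrightarrow> \<bar>t\<bar> powr \<alpha> * (c * 1)"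
      by (intro tendsto_mult tendsto_const l1 ratio)
    moreover have "\<forall>\<^sub>F n in sequentially. \<bar>t\<bar> powr \<alpha> * ((log_rem (1 / v n) * v n powr \<alpha> / \<Lambda> (v n)) * (\<Lambda> (1 / \<bar>t\<bar> * sqrt (real n)) / \<Lambda> (sqrt (real n))))
        = sqrt (real n) powr (\<alpha> - 2) / \<Lambda> (sqrt (real n)) * (real n * log_rem (t / sqrt (real n)))"
      using ev v[unfolded filterlim_at_top, rule_format, of s0]
    proof eventually_elim
      case (elim n)
      then have n: "n \<ge> 1" by simp
      have Lv: "\<Lambda> (v n) > 0" using C elim by auto
      have vv: "1 / \<bar>t\<bar> * sqrt (real n) = v n" by (simp add: v_def)
      have lr: "log_rem (1 / v n) = log_rem (t / sqrt (real n))"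
        using log_rem_abs[of "t / sqrt (real n)"] by (simp add: v_def abs_divide)
      have pw: "\<bar>t\<bar> powr \<alpha> * v n powr \<alpha> = sqrt (real n) powr \<alpha>"
        unfolding v_def using t by (simp add: powr_mult[symmetric])
      have "\<bar>t\<bar> powr \<alpha> * ((log_rem (1 / v n) * v n powr \<alpha> / \<Lambda> (v n)) * (\<Lambda> (v n) / \<Lambda> (sqrt (real n)))) = (\<bar>t\<bar> powr \<alpha> * v n powr \<alpha>) * log_rem (1 / v n) / \<Lambda> (sqrt (real n))"
        using Lv by simp
      also have "\<dots> = sqrt (real n) powr \<alpha> * log_rem (t / sqrt (real n)) / \<Lambda> (sqrt (real n))" unfolding pw lr ..
      also have "\<dots> = sqrt (real n) powr (\<alpha> - 2) * (real n * log_rem (t / sqrt (real n))) / \<Lambda> (sqrt (real n))" unfolding wt[OF n] ..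
      finally show ?case unfolding vv by simp
    qed
    ultimately have l2: "(\<lambda>n. sqrt (real n) powr (\<alpha> - 2) / \<Lambda> (sqrt (real n)) * (real n * log_rem (t / sqrt (real n)))) \<longlonglongrightarrow> c * \<bar>t\<bar> powr \<alpha>"
      by (simp add: filterlim_cong mult.commute)
    \<comment> \<open>(exp y - 1) / y with its removable singularity filled in, since n r may be 0
      for some n.\<close>
    define E where "E = (\<lambda>y::real. if y = 0 then 1 else (exp y - 1) / y)"
    have "isCont E 0"
    proof -
      have "((\<lambda>y::real. (exp y - 1) / y) \<longlongrightarrow> 1) (at 0)" by real_asymp
      then show ?thesis unfolding isCont_def E_def
        by (subst tendsto_cong[where g = "\<lambda>y::real. (exp y - 1) / y"]) (auto simp: eventually_at_filter)
    qed
    have "(\<lambda>n. t / sqrt (real n)) \<longlonglongrightarrow> 0" by real_asymp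
    then have "\<forall>\<^sub>F n in sequentially. \<bar>t / sqrt (real n)\<bar> < e"
      using e(1) order_tendstoD(2)[OF tendsto_rabs_zero, of "\<lambda>n. t / sqrt (real n)" sequentially e] by simp
    then have ev_in: "\<forall>\<^sub>F n in sequentially. \<bar>t / sqrt (real n)\<bar> \<le> e" by eventually_elim simp
    have nr0: "(\<lambda>n. real n * log_rem (t / sqrt (real n))) \<longlonglongrightarrow> 0"
    proof -
      have "(\<lambda>n. (log_rem (1 / v n) * v n ^ (2 * N)) * (t\<^sup>2 * (1 / v n) ^ (2 * N - 2))) \<longlonglongrightarrow> 0 * (t\<^sup>2 * 0 ^ (2 * N - 2))"
      proof (intro tendsto_mult tendsto_const tendsto_power)
        show "(\<lambda>n. log_rem (1 / v n) * v n ^ (2 * N)) \<longlonglongrightarrow> 0"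
          by (rule filterlim_compose[OF log_rem_small[OF lim sc] v])
        show "(\<lambda>n. 1 / v n) \<longlonglongrightarrow> 0"
          by (rule tendsto_divide_0[OF tendsto_const]) (rule filterlim_at_top_imp_at_infinity[OF v])
      qed
      moreover have "\<forall>\<^sub>F n in sequentially. (log_rem (1 / v n) * v n ^ (2 * N)) * (t\<^sup>2 * (1 / v n) ^ (2 * N - 2)) = real n * log_rem (t / sqrt (real n))"
        using ev
      proof eventually_elim
        case (elim n)
        have vp: "v n > 0" using elim t by (simp add: v_def)
        have "v n ^ (2 * N) * (1 / v n) ^ (2 * N - 2) = (v n)\<^sup>2"
          using vp N_pos by (simp add: power_one_over power_diff field_simps)
        moreover have "(v n)\<^sup>2 * t\<^sup>2 = real n" using t by (simp add: v_def power_divide)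
        moreover have "log_rem (1 / v n) = log_rem (t / sqrt (real n))"
          using log_rem_abs[of "t / sqrt (real n)"] by (simp add: v_def abs_divide)
        ultimately show ?case by (metis mult.assoc mult.commute)
      qed
      ultimately show ?thesis by (simp add: filterlim_cong)
    qed
    have "E 0 = 1" by (simp add: E_def)
    then have El: "(\<lambda>n. E (real n * log_rem (t / sqrt (real n)))) \<longlonglongrightarrow> 1"
      using isCont_tendsto_compose[OF \<open>isCont E 0\<close> nr0] by (simp only:)
    have "(\<lambda>n. \<Sum>l=3..2 * N. - log_coef l * t ^ l * (1 / sqrt (real n)) ^ (l - 2)) \<longlonglongrightarrow> (\<Sum>l=3..2 * N. - log_coef l * t ^ l * 0 ^ (l - 2))"
    proof (intro tendsto_sum tendsto_mult tendsto_const tendsto_power)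
      show "(\<lambda>n. 1 / sqrt (real n)) \<longlonglongrightarrow> 0" by real_asymp
    qed
    moreover have "(\<Sum>l=3..2 * N. - log_coef l * t ^ l * 0 ^ (l - 2)) = 0" by (intro sum.neutral) auto
    moreover have "\<forall>\<^sub>F n in sequentially. (\<Sum>l=3..2 * N. - log_coef l * t ^ l * (1 / sqrt (real n)) ^ (l - 2)) = edge_real n t"
      using ev by eventually_elim (simp add: edge_real_eq)
    ultimately have "(\<lambda>n. edge_real n t) \<longlonglongrightarrow> 0" by (simp add: filterlim_cong)
    then have "(\<lambda>n. exp (edge_real n t)) \<longlonglongrightarrow> exp 0" by (rule tendsto_exp)
    then have "(\<lambda>n. exp (- t\<^sup>2 / 2) * exp (edge_real n t) * ((sqrt (real n) powr (\<alpha> - 2) / \<Lambda> (sqrt (real n)) * (real n * log_rem (t / sqrt (real n)))) * E (real n * log_rem (t / sqrt (real n)))))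
       \<longlonglongrightarrow> exp (- t\<^sup>2 / 2) * exp 0 * ((c * \<bar>t\<bar> powr \<alpha>) * 1)"
      by (intro tendsto_mult[OF tendsto_mult[OF tendsto_const] tendsto_mult[OF l2 El]])
    moreover have "\<forall>\<^sub>F n in sequentially. exp (- t\<^sup>2 / 2) * exp (edge_real n t) * ((sqrt (real n) powr (\<alpha> - 2) / \<Lambda> (sqrt (real n)) * (real n * log_rem (t / sqrt (real n)))) * E (real n * log_rem (t / sqrt (real n)))) = D n t"
      using ev ev_in
    proof eventually_elim
      case (elim n)
      have "y * E y = exp y - 1" for y by (simp add: E_def)
      then show ?case using elim by (subst D_eq) (auto simp: mult.assoc)
    qed
    ultimately show ?thesis by (simp add: filterlim_cong)
  qed
  have "(\<lambda>n. CLBINT t. iexp (- (t * x)) * of_real (D n t)) \<longlonglongrightarrow> (CLBINT t. iexp (- (t * x)) * of_real (exp (- t\<^sup>2 / 2) * (c * \<bar>t\<bar> powr \<alpha>)))"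
  proof (rule integral_dominated_convergence_eventually)
    show "integrable lborel w"
      by (rule integrable_poly_gauss[where a = "1/4" and C = "2 * C * (\<bar>c\<bar> + 1)" and n = k]) (use C in \<open>auto simp: w_def\<close>)
    show "AE t in lborel. (\<lambda>n. iexp (- (t * x)) * of_real (D n t)) \<longlonglongrightarrow> iexp (- (t * x)) * of_real (exp (- t\<^sup>2 / 2) * (c * \<bar>t\<bar> powr \<alpha>))"
      using AE_lborel_singleton[of "0::real"]
      by eventually_elim (intro tendsto_mult[OF tendsto_const] tendsto_of_real lim_D)
    show "\<forall>\<^sub>F n in sequentially. AE t in lborel. norm (iexp (- (t * x)) * of_real (D n t)) \<le> w t"
      using ev
    proof eventually_elim
      case (elim n)
      show ?case using AE_lborel_singleton[of "0::real"]
        by eventually_elim (use elim bound in \<open>auto simp: norm_mult simp del: of_real_mult\<close>)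
    qed
  qed (auto simp: D_def edge_real_def)
  then show ?thesis by (simp only: D_def)
qed

end

section \<open>Truncation error, outer region and the assembled limit\<close>

context heavy_tail_dist
begin

lemma edge_real_measurable [measurable]: "edge_real n \<in> borel_measurable borel"
  unfolding edge_real_def[abs_def] by measurable

text \<open>The power h^i belongs to j = i + 2, so i < 2 N means j \<le> 2 N + 1. The odd
  coefficients vanish, and what remains are the even j below \<alpha>.\<close>

definition edge_trunc :: "(nat \<Rightarrow> real) \<Rightarrow> nat \<Rightarrow> real \<Rightarrow> complex" where
  "edge_trunc \<kappa> n t = (\<Sum>i<2 * N. poly.coeff (edge_exp \<kappa> (2 * N) t) i * of_real (1 / sqrt (real n)) ^ i)"

lemma edge_trunc_measurable [measurable]: "edge_trunc \<kappa> n \<in> borel_measurable borel"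
proof -
  have [measurable]: "(\<lambda>t. poly.coeff (edge_exp \<kappa> (2 * N) t) i) \<in> borel_measurable borel" for i
    by (intro borel_measurable_continuous_onI poly_bdd_continuous poly_bdd_coeff_edge_exp)
  show ?thesis unfolding edge_trunc_def[abs_def] by measurable
qed

(* For |t| > e sqrt n the factor n^(-N) comes from 1 <= (|t| / (e sqrt n))^(2N). *)
lemma residual_bound:
  assumes cum: "\<And>l t. l \<le> 2 * N \<Longrightarrow> of_real (\<kappa> l) * (\<i> * of_real t) ^ l / fact l = (of_real (- log_coef l * t ^ l) :: complex)"
    and e: "0 < e" "e \<le> 1" "e * (\<Sum>l=3..2 * N. \<bar>log_coef l\<bar>) \<le> 1 / 8"
  obtains W :: "real \<Rightarrow> real" where "integrable lborel W"
    "\<And>n t. n \<ge> 1 \<Longrightarrow> norm (of_real (exp (- t\<^sup>2 / 2)) * (of_bool (\<bar>t / sqrt (real n)\<bar> \<le> e) * of_real (exp (edge_real n t)) - edge_trunc \<kappa> n t))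
       \<le> (1 / sqrt (real n)) ^ (2 * N) * W t"
proof -
  obtain C1 n1 where C1: "C1 \<ge> 0" "\<And>h t. 0 \<le> h \<Longrightarrow> h \<le> 1 \<Longrightarrow>
     norm (exp (poly (edge_poly \<kappa> (2 * N) t) (of_real h)) - (\<Sum>i<2 * N. poly.coeff (edge_exp \<kappa> (2 * N) t) i * of_real h ^ i))
       \<le> h ^ (2 * N) * (C1 * (1 + \<bar>t\<bar>) ^ n1 * exp (norm (poly (edge_poly \<kappa> (2 * N) t) (of_real h))))"
    by (rule edge_exp_trunc_bound) blast
  obtain C2 n2 where C2: "C2 \<ge> 0" "\<And>h t. 0 \<le> h \<Longrightarrow> h \<le> 1 \<Longrightarrow>
     norm (\<Sum>i<2 * N. poly.coeff (edge_exp \<kappa> (2 * N) t) i * of_real h ^ i) \<le> C2 * (1 + \<bar>t\<bar>) ^ n2"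
    by (rule edge_exp_sum_bound) blast
  define W1 where "W1 = (\<lambda>t::real. C1 * (1 + \<bar>t\<bar>) ^ n1 * exp (- (1 / 4) * t\<^sup>2))"
  define W2 where "W2 = (\<lambda>t::real. C2 / e ^ (2 * N) * (1 + \<bar>t\<bar>) ^ (n2 + 2 * N) * exp (- (1 / 4) * t\<^sup>2))"
  have W0: "0 \<le> W1 t" "0 \<le> W2 t" for t using C1(1) C2(1) e(1) by (auto simp: W1_def W2_def)
  show thesis
  proof (rule that[of "\<lambda>t. W1 t + W2 t"])
    have "integrable lborel W1"
      by (rule integrable_poly_gauss[where a = "1/4" and C = C1 and n = n1]) (use C1 in \<open>auto simp: W1_def\<close>)
    moreover have "integrable lborel W2"
      by (rule integrable_poly_gauss[where a = "1/4" and C = "C2 / e ^ (2 * N)" and n = "n2 + 2 * N"]) (use C2 e in \<open>auto simp: W2_def\<close>)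
    ultimately show "integrable lborel (\<lambda>t. W1 t + W2 t)" by (rule Bochner_Integration.integrable_add)
    fix n :: nat and t :: real assume n: "n \<ge> 1"
    define h where "h = 1 / sqrt (real n)"
    have h: "0 \<le> h" "h \<le> 1" using n by (auto simp: h_def)
    let ?z = "poly (edge_poly \<kappa> (2 * N) t) (of_real h)"
    have z: "?z = of_real (edge_real n t)" unfolding h_def by (rule edge_poly_eq[OF cum n])
    show "norm (of_real (exp (- t\<^sup>2 / 2)) * (of_bool (\<bar>t / sqrt (real n)\<bar> \<le> e) * of_real (exp (edge_real n t)) - edge_trunc \<kappa> n t))
       \<le> (1 / sqrt (real n)) ^ (2 * N) * (W1 t + W2 t)"
    proof (cases "\<bar>t / sqrt (real n)\<bar> \<le> e")
      case True
      have a: "\<bar>edge_real n t\<bar> \<le> t\<^sup>2 / 8" by (rule edge_real_bound[OF n True e(2,3)])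
      have "norm (of_real (exp (edge_real n t)) - edge_trunc \<kappa> n t) \<le> h ^ (2 * N) * (C1 * (1 + \<bar>t\<bar>) ^ n1 * exp (norm ?z))"
        using C1(2)[OF h, of t] unfolding edge_trunc_def h_def[symmetric] z by (simp only: exp_of_real)
      also have "\<dots> \<le> h ^ (2 * N) * (C1 * (1 + \<bar>t\<bar>) ^ n1 * exp (t\<^sup>2 / 8))"
        unfolding z norm_of_real using a h C1(1) by (intro mult_left_mono) auto
      finally have "exp (- t\<^sup>2 / 2) * norm (of_real (exp (edge_real n t)) - edge_trunc \<kappa> n t) \<le> exp (- t\<^sup>2 / 2) * (h ^ (2 * N) * (C1 * (1 + \<bar>t\<bar>) ^ n1 * exp (t\<^sup>2 / 8)))"
        by (intro mult_left_mono) auto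
      also have "\<dots> = h ^ (2 * N) * (C1 * (1 + \<bar>t\<bar>) ^ n1 * (exp (- t\<^sup>2 / 2) * exp (t\<^sup>2 / 8)))" by (simp only: mult_ac)
      also have "exp (- t\<^sup>2 / 2) * exp (t\<^sup>2 / 8) \<le> exp (- (1 / 4) * t\<^sup>2)" by (simp flip: exp_add)
      then have "h ^ (2 * N) * (C1 * (1 + \<bar>t\<bar>) ^ n1 * (exp (- t\<^sup>2 / 2) * exp (t\<^sup>2 / 8))) \<le> h ^ (2 * N) * W1 t"
        unfolding W1_def using h C1(1) by (intro mult_left_mono) auto
      also have "\<dots> \<le> h ^ (2 * N) * (W1 t + W2 t)" using h W0 by (intro mult_left_mono) auto
      finally show ?thesis using True by (simp add: norm_mult h_def)
    next
      case False
      have "e < \<bar>t\<bar> * h" using False n by (simp add: h_def abs_divide)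
      then have "1 \<le> \<bar>t\<bar> * h / e" using e(1) by simp
      then have "1 \<le> (\<bar>t\<bar> * h / e) ^ (2 * N)" by (rule one_le_power)
      also have "\<dots> = \<bar>t\<bar> ^ (2 * N) * h ^ (2 * N) / e ^ (2 * N)" by (simp add: power_divide power_mult_distrib)
      also have "\<dots> \<le> (1 + \<bar>t\<bar>) ^ (2 * N) * h ^ (2 * N) / e ^ (2 * N)"
        using h e(1) by (intro divide_right_mono mult_right_mono power_mono) auto
      finally have one: "1 \<le> (1 + \<bar>t\<bar>) ^ (2 * N) * h ^ (2 * N) / e ^ (2 * N)" .
      have "norm (edge_trunc \<kappa> n t) \<le> C2 * (1 + \<bar>t\<bar>) ^ n2 * 1"
        using C2(2)[OF h, of t] unfolding edge_trunc_def h_def[symmetric] by simp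
      also have "\<dots> \<le> C2 * (1 + \<bar>t\<bar>) ^ n2 * ((1 + \<bar>t\<bar>) ^ (2 * N) * h ^ (2 * N) / e ^ (2 * N))"
        using one C2(1) by (intro mult_left_mono) auto
      also have "\<dots> = h ^ (2 * N) * (C2 / e ^ (2 * N) * (1 + \<bar>t\<bar>) ^ (n2 + 2 * N))" by (simp add: power_add)
      finally have "exp (- t\<^sup>2 / 2) * norm (edge_trunc \<kappa> n t) \<le> exp (- (1 / 4) * t\<^sup>2) * (h ^ (2 * N) * (C2 / e ^ (2 * N) * (1 + \<bar>t\<bar>) ^ (n2 + 2 * N)))"
        by (intro mult_mono) auto
      also have "\<dots> = h ^ (2 * N) * W2 t" unfolding W2_def by (simp only: mult_ac)
      also have "\<dots> \<le> h ^ (2 * N) * (W1 t + W2 t)" using h W0 by (intro mult_left_mono) auto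
      finally show ?thesis using False by (simp add: norm_mult h_def)
    qed
  qed
qed

lemma integrable_phi_power:
  assumes int: "integrable lborel phi" and n: "n \<ge> 1"
  shows "integrable lborel (\<lambda>t. phi (t / sqrt (real n)) ^ n)"
proof (rule Bochner_Integration.integrable_bound)
  show "integrable lborel (\<lambda>t. phi (0 + (1 / sqrt (real n)) * t))"
    using n by (intro lborel_integrable_real_affine int) auto
  show "AE t in lborel. norm (phi (t / sqrt (real n)) ^ n) \<le> norm (phi (0 + (1 / sqrt (real n)) * t))"
  proof (rule AE_I2)
    fix t
    have "\<bar>phi (t / sqrt (real n))\<bar> \<le> 1"
      using phi_abs_less_1[of "t / sqrt (real n)"] phi_0 by (cases "t / sqrt (real n) = 0") auto
    then have "\<bar>phi (t / sqrt (real n))\<bar> ^ n \<le> \<bar>phi (t / sqrt (real n))\<bar> ^ 1"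
      using n by (intro power_decreasing) auto
    then show "norm (phi (t / sqrt (real n)) ^ n) \<le> norm (phi (0 + (1 / sqrt (real n)) * t))"
      by (simp add: power_abs)
  qed
qed measurable

text \<open>There |phi|^n \<le> q^(n - 1) |phi| with q < 1. Rescaling the integral of |phi| costs a
  factor sqrt n, and the geometric decay beats every power of n as well as the slowly varying
  factor.\<close>

lemma outer_part_limit:
  assumes sc: "slow_scale \<Lambda>" and int: "integrable lborel phi" and e: "0 < e"
  shows "(\<lambda>n. CLBINT t. iexp (- (t * x)) * of_real (real n powr (\<alpha> / 2 - 1) / \<Lambda> (sqrt (real n)) *
      (of_bool (\<not> \<bar>t / sqrt (real n)\<bar> \<le> e) * phi (t / sqrt (real n)) ^ n))) \<longlonglongrightarrow> 0"
proof -
  obtain q0 where q0: "0 \<le> q0" "q0 < 1" "\<And>t. \<bar>t\<bar> \<ge> e \<Longrightarrow> \<bar>phi t\<bar> \<le> q0"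
    by (rule phi_gap[OF int e]) blast
  \<comment> \<open>Raised to at least 1 / 2 so that q is positive and can be written as exp (-
    b).\<close>
  define q where "q = max q0 (1 / 2)"
  have q: "0 < q" "q < 1" "\<And>t. \<bar>t\<bar> \<ge> e \<Longrightarrow> \<bar>phi t\<bar> \<le> q" using q0 by (auto simp: q_def le_max_iff_disj)
  define b where "b = - ln q"
  have b: "b > 0" "q = exp (- b)" using q by (auto simp: b_def)
  define J where "J = (\<integral>t. \<bar>phi t\<bar> \<partial>lborel)"
  let ?D = "\<lambda>n t. of_bool (\<not> \<bar>t / sqrt (real n)\<bar> \<le> e) * phi (t / sqrt (real n)) ^ n"
  let ?w = "\<lambda>n. real n powr (\<alpha> / 2 - 1) / \<Lambda> (sqrt (real n))"
  have bound: "norm (CLBINT t. iexp (- (t * x)) * of_real (?w n * ?D n t)) \<le> \<bar>?w n\<bar> * (q ^ (n - 1) * (sqrt (real n) * J))" if n: "n \<ge> 1" for n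
  proof -
    have ip: "integrable lborel (\<lambda>t. \<bar>phi (0 + (1 / sqrt (real n)) * t)\<bar>)"
      using n by (intro integrable_abs lborel_integrable_real_affine int) auto
    have Jn: "(\<integral>t. \<bar>phi (0 + (1 / sqrt (real n)) * t)\<bar> \<partial>lborel) = sqrt (real n) * J"
    proof -
      have "J = \<bar>1 / sqrt (real n)\<bar> *\<^sub>R (\<integral>t. \<bar>phi (0 + (1 / sqrt (real n)) * t)\<bar> \<partial>lborel)"
        unfolding J_def using n by (intro lborel_integral_real_affine) auto
      then show ?thesis using n by simp
    qed
    have "norm (CLBINT t. iexp (- (t * x)) * of_real (?w n * ?D n t)) \<le> (\<integral>t. norm (iexp (- (t * x)) * of_real (?w n * ?D n t)) \<partial>lborel)"
      by (rule integral_norm_bound)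
    also have "\<dots> \<le> (\<integral>t. \<bar>?w n\<bar> * (q ^ (n - 1) * \<bar>phi (0 + (1 / sqrt (real n)) * t)\<bar>) \<partial>lborel)"
    proof (rule integral_mono')
      show "integrable lborel (\<lambda>t. \<bar>?w n\<bar> * (q ^ (n - 1) * \<bar>phi (0 + (1 / sqrt (real n)) * t)\<bar>))"
        by (intro integrable_mult_right ip)
      fix t
      have "\<bar>?D n t\<bar> \<le> q ^ (n - 1) * \<bar>phi (t / sqrt (real n))\<bar>"
      proof (cases "\<bar>t / sqrt (real n)\<bar> \<le> e")
        case False
        then have "\<bar>phi (t / sqrt (real n))\<bar> ^ (n - 1) \<le> q ^ (n - 1)" by (intro power_mono q(3)) auto
        then have "\<bar>phi (t / sqrt (real n))\<bar> ^ (n - 1) * \<bar>phi (t / sqrt (real n))\<bar> \<le> q ^ (n - 1) * \<bar>phi (t / sqrt (real n))\<bar>"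
          by (intro mult_right_mono) auto
        moreover have "\<bar>phi (t / sqrt (real n))\<bar> ^ (n - 1) * \<bar>phi (t / sqrt (real n))\<bar> = \<bar>phi (t / sqrt (real n)) ^ n\<bar>"
          using n by (cases n) (simp_all add: abs_mult power_abs mult.commute)
        ultimately show ?thesis using False by simp
      qed (use q in simp)
      then have "\<bar>?w n\<bar> * \<bar>?D n t\<bar> \<le> \<bar>?w n\<bar> * (q ^ (n - 1) * \<bar>phi (t / sqrt (real n))\<bar>)" by (intro mult_left_mono) auto
      then show "norm (iexp (- (t * x)) * of_real (?w n * ?D n t)) \<le> \<bar>?w n\<bar> * (q ^ (n - 1) * \<bar>phi (0 + (1 / sqrt (real n)) * t)\<bar>)"
        unfolding norm_mult norm_exp_i_times norm_of_real abs_mult by simp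
    qed (use q in auto)
    also have "\<dots> = \<bar>?w n\<bar> * (q ^ (n - 1) * (sqrt (real n) * J))"
      by (simp only: integral_mult_right_zero Jn)
    finally show ?thesis .
  qed
  have sq: "filterlim (\<lambda>n. sqrt (real n)) at_top sequentially" by real_asymp
  have l1: "(\<lambda>n. sqrt (real n) powr (- 1) / \<Lambda> (sqrt (real n))) \<longlonglongrightarrow> 0"
    by (rule filterlim_compose[OF slow_scale_powr_tendsto_0[OF sc zero_less_one] sq])
  have l2: "(\<lambda>n. sqrt (real n) powr \<alpha> * exp (- b * (real n - 1))) \<longlonglongrightarrow> 0"
    using b(1) alpha_pos by real_asymp
  have l3: "(\<lambda>n. \<bar>sqrt (real n) powr (- 1) / \<Lambda> (sqrt (real n))\<bar> * (sqrt (real n) powr \<alpha> * exp (- b * (real n - 1))) * J) \<longlonglongrightarrow> \<bar>0\<bar> * 0 * J"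
    by (intro tendsto_mult tendsto_const tendsto_rabs l1 l2)
  show ?thesis
  proof (rule Lim_null_comparison)
    show "(\<lambda>n. \<bar>sqrt (real n) powr (- 1) / \<Lambda> (sqrt (real n))\<bar> * (sqrt (real n) powr \<alpha> * exp (- b * (real n - 1))) * J) \<longlonglongrightarrow> 0"
      using l3 by simp
    show "\<forall>\<^sub>F n in sequentially. norm (CLBINT t. iexp (- (t * x)) * of_real (?w n * ?D n t))
        \<le> \<bar>sqrt (real n) powr (- 1) / \<Lambda> (sqrt (real n))\<bar> * (sqrt (real n) powr \<alpha> * exp (- b * (real n - 1))) * J"
      using eventually_ge_at_top[of 1]
    proof eventually_elim
      case (elim n)
      have qn: "q ^ (n - 1) = exp (- b * (real n - 1))"
        unfolding b(2) using elim by (simp add: exp_of_nat_mult[symmetric] of_nat_diff)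
      have p: "sqrt (real n) powr (\<alpha> - 2) * sqrt (real n) = sqrt (real n) powr (- 1) * sqrt (real n) powr \<alpha>"
      proof -
        have "sqrt (real n) powr (\<alpha> - 2) * sqrt (real n) powr 1 = sqrt (real n) powr (- 1) * sqrt (real n) powr \<alpha>"
          unfolding powr_add[symmetric] by simp
        then show ?thesis using elim by simp
      qed
      have "\<bar>?w n\<bar> * (q ^ (n - 1) * (sqrt (real n) * J)) = (sqrt (real n) powr (\<alpha> - 2) * sqrt (real n)) / \<bar>\<Lambda> (sqrt (real n))\<bar> * exp (- b * (real n - 1)) * J"
        unfolding qn sqrt_weight[OF elim] by simp
      also have "\<dots> = \<bar>sqrt (real n) powr (- 1) / \<Lambda> (sqrt (real n))\<bar> * (sqrt (real n) powr \<alpha> * exp (- b * (real n - 1))) * J"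
        unfolding p by (simp add: abs_mult)
      finally show ?case using bound[OF elim] by (simp only:)
    qed
  qed
qed

text \<open>phi^n minus the truncated expansion is split into \<open>?D1\<close>, \<open>?D2\<close>
  and \<open>?D3\<close>: the central difference from the untruncated Gaussian expansion, the
  truncation error (with the whole expansion outside the central region), and phi^n outside. Only
  the first has a nonzero limit. The second is O(n^(-N)), and its normalised size is the quantity in
  \<open>small\<close> at s = sqrt n.\<close>

theorem edgeworth_fourier_limit:
  assumes sc: "slow_scale \<Lambda>" and lim: "((\<lambda>s. log_rem (1 / s) * s powr \<alpha> / \<Lambda> s) \<longlongrightarrow> c) at_top"
    and small: "((\<lambda>s. s powr (\<alpha> - 2 * real N - 2) / \<Lambda> s) \<longlongrightarrow> 0) at_top"
    and int: "integrable lborel phi"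
    and cum: "\<And>l t. l \<le> 2 * N \<Longrightarrow> of_real (\<kappa> l) * (\<i> * of_real t) ^ l / fact l = (of_real (- log_coef l * t ^ l) :: complex)"
  shows "(\<lambda>n. of_real (real n powr (\<alpha> / 2 - 1) / \<Lambda> (sqrt (real n))) *
       (CLBINT t. iexp (- (t * x)) * (of_real (phi (t / sqrt (real n)) ^ n) - of_real (exp (- t\<^sup>2 / 2)) * edge_trunc \<kappa> n t)))
    \<longlonglongrightarrow> (CLBINT t. iexp (- (t * x)) * of_real (exp (- t\<^sup>2 / 2) * (c * \<bar>t\<bar> powr \<alpha>)))"
proof -
  obtain e where e: "0 < e" "e \<le> 1" "e * (\<Sum>l=3..2 * N. \<bar>log_coef l\<bar>) \<le> 1 / 8"
    "\<And>t. \<bar>t\<bar> \<le> e \<Longrightarrow> 0 < phi t" "\<And>t. \<bar>t\<bar> \<le> e \<Longrightarrow> \<bar>log_rem t\<bar> \<le> t\<^sup>2 / 8"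
    "\<And>t. t \<noteq> 0 \<Longrightarrow> \<bar>t\<bar> \<le> e \<Longrightarrow> \<bar>log_rem t\<bar> \<le> (\<bar>c\<bar> + 1) * \<bar>t\<bar> powr \<alpha> * \<Lambda> (1 / \<bar>t\<bar>)"
    by (rule small_arg_estimates[OF sc lim]) blast
  let ?w = "\<lambda>n. real n powr (\<alpha> / 2 - 1) / \<Lambda> (sqrt (real n))"
  let ?B = "\<lambda>n t. \<bar>t / sqrt (real n)\<bar> \<le> e"
  let ?D1 = "\<lambda>n t. of_bool (?B n t) * (phi (t / sqrt (real n)) ^ n - exp (- t\<^sup>2 / 2) * exp (edge_real n t))"
  let ?D2 = "\<lambda>n t. of_real (exp (- t\<^sup>2 / 2)) * (of_bool (?B n t) * of_real (exp (edge_real n t)) - edge_trunc \<kappa> n t) :: complex"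
  let ?D3 = "\<lambda>n t. of_bool (\<not> ?B n t) * phi (t / sqrt (real n)) ^ n"
  obtain W :: "real \<Rightarrow> real" where W: "integrable lborel W"
    "\<And>n t. n \<ge> 1 \<Longrightarrow> norm (?D2 n t) \<le> (1 / sqrt (real n)) ^ (2 * N) * W t"
    by (rule residual_bound[of \<kappa> e, OF _ e(1-3)]) (erule cum, rule that)
  have iD2: "integrable lborel (\<lambda>t. iexp (- (t * x)) * ?D2 n t)" if n: "n \<ge> 1" for n
  proof (rule Bochner_Integration.integrable_bound)
    show "integrable lborel (\<lambda>t. (1 / sqrt (real n)) ^ (2 * N) * W t)" by (intro integrable_mult_right W)
    show "AE t in lborel. norm (iexp (- (t * x)) * ?D2 n t) \<le> norm ((1 / sqrt (real n)) ^ (2 * N) * W t)"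
      by (rule AE_I2, simp only: norm_mult[of "iexp _"] norm_exp_i_times mult_1_left real_norm_def)
        (rule order_trans[OF W(2)[OF n] abs_ge_self])
  qed measurable
  have l1: "(\<lambda>n. CLBINT t. iexp (- (t * x)) * of_real (?w n * ?D1 n t)) \<longlonglongrightarrow> (CLBINT t. iexp (- (t * x)) * of_real (exp (- t\<^sup>2 / 2) * (c * \<bar>t\<bar> powr \<alpha>)))"
    by (rule central_part_limit[OF sc lim e])
  have l3: "(\<lambda>n. CLBINT t. iexp (- (t * x)) * of_real (?w n * ?D3 n t)) \<longlonglongrightarrow> 0"
    by (rule outer_part_limit[OF sc int e(1)])
  have l2: "(\<lambda>n. of_real (?w n) * (CLBINT t. iexp (- (t * x)) * ?D2 n t)) \<longlonglongrightarrow> 0"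
  proof (rule Lim_null_comparison)
    have sq: "filterlim (\<lambda>n. sqrt (real n)) at_top sequentially" by real_asymp
    have "(\<lambda>n. \<bar>sqrt (real n) powr (\<alpha> - 2 * real N - 2) / \<Lambda> (sqrt (real n))\<bar> * (\<integral>t. W t \<partial>lborel)) \<longlonglongrightarrow> \<bar>0\<bar> * (\<integral>t. W t \<partial>lborel)"
      by (intro tendsto_mult tendsto_const tendsto_rabs filterlim_compose[OF small sq])
    then show "(\<lambda>n. \<bar>sqrt (real n) powr (\<alpha> - 2 * real N - 2) / \<Lambda> (sqrt (real n))\<bar> * (\<integral>t. W t \<partial>lborel)) \<longlonglongrightarrow> 0" by simp
    show "\<forall>\<^sub>F n in sequentially. norm (of_real (?w n) * (CLBINT t. iexp (- (t * x)) * ?D2 n t)) \<le> \<bar>sqrt (real n) powr (\<alpha> - 2 * real N - 2) / \<Lambda> (sqrt (real n))\<bar> * (\<integral>t. W t \<partial>lborel)"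
      using eventually_ge_at_top[of 1]
    proof eventually_elim
      case (elim n)
      have "norm (CLBINT t. iexp (- (t * x)) * ?D2 n t) \<le> (\<integral>t. norm (iexp (- (t * x)) * ?D2 n t) \<partial>lborel)"
        by (rule integral_norm_bound)
      also have "\<dots> \<le> (\<integral>t. (1 / sqrt (real n)) ^ (2 * N) * W t \<partial>lborel)"
      proof (rule Bochner_Integration.integral_mono)
        show "integrable lborel (\<lambda>t. norm (iexp (- (t * x)) * ?D2 n t))" by (intro integrable_norm iD2 elim)
        show "integrable lborel (\<lambda>t. (1 / sqrt (real n)) ^ (2 * N) * W t)" by (intro integrable_mult_right W)
        show "norm (iexp (- (t * x)) * ?D2 n t) \<le> (1 / sqrt (real n)) ^ (2 * N) * W t" for t
          unfolding norm_mult[of "iexp _"] norm_exp_i_times using W(2)[OF elim, of t] by simp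
      qed
      also have "\<dots> = (1 / sqrt (real n)) ^ (2 * N) * (\<integral>t. W t \<partial>lborel)" by (rule integral_mult_right_zero)
      finally have "norm (of_real (?w n) * (CLBINT t. iexp (- (t * x)) * ?D2 n t)) \<le> \<bar>?w n\<bar> * ((1 / sqrt (real n)) ^ (2 * N) * (\<integral>t. W t \<partial>lborel))"
        unfolding norm_mult norm_of_real by (intro mult_left_mono) auto
      also have "\<bar>?w n\<bar> = sqrt (real n) powr (\<alpha> - 2) / \<bar>\<Lambda> (sqrt (real n))\<bar>"
        unfolding sqrt_weight[OF elim] by simp
      also have "sqrt (real n) powr (\<alpha> - 2) / \<bar>\<Lambda> (sqrt (real n))\<bar> * ((1 / sqrt (real n)) ^ (2 * N) * (\<integral>t. W t \<partial>lborel))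
          = (sqrt (real n) powr (\<alpha> - 2) * (1 / sqrt (real n)) ^ (2 * N)) / \<bar>\<Lambda> (sqrt (real n))\<bar> * (\<integral>t. W t \<partial>lborel)" by simp
      also have "sqrt (real n) powr (\<alpha> - 2) * (1 / sqrt (real n)) ^ (2 * N) = sqrt (real n) powr (\<alpha> - 2 * real N - 2)"
      proof -
        have "(1 / sqrt (real n)) ^ (2 * N) = inverse (sqrt (real n) ^ (2 * N))" by (simp only: power_one_over inverse_eq_divide)
        also have "\<dots> = sqrt (real n) powr (- real (2 * N))" using elim by (simp only: powr_minus powr_realpow real_sqrt_gt_zero of_nat_0_less_iff)
        finally show ?thesis by (simp add: powr_add[symmetric] algebra_simps)
      qed
      finally show ?case by simp
    qed
  qed
  have "(\<lambda>n. (CLBINT t. iexp (- (t * x)) * of_real (?w n * ?D1 n t)) + of_real (?w n) * (CLBINT t. iexp (- (t * x)) * ?D2 n t) + (CLBINT t. iexp (- (t * x)) * of_real (?w n * ?D3 n t)))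
     \<longlonglongrightarrow> (CLBINT t. iexp (- (t * x)) * of_real (exp (- t\<^sup>2 / 2) * (c * \<bar>t\<bar> powr \<alpha>))) + 0 + 0"
    by (intro tendsto_add l1 l2 l3)
  moreover have "\<forall>\<^sub>F n in sequentially. (CLBINT t. iexp (- (t * x)) * of_real (?w n * ?D1 n t)) + of_real (?w n) * (CLBINT t. iexp (- (t * x)) * ?D2 n t) + (CLBINT t. iexp (- (t * x)) * of_real (?w n * ?D3 n t))
      = of_real (?w n) * (CLBINT t. iexp (- (t * x)) * (of_real (phi (t / sqrt (real n)) ^ n) - of_real (exp (- t\<^sup>2 / 2)) * edge_trunc \<kappa> n t))"
    using eventually_ge_at_top[of 1]
  proof eventually_elim
    case (elim n)
    have iphi: "integrable lborel (\<lambda>t. phi (t / sqrt (real n)) ^ n)" by (rule integrable_phi_power[OF int elim])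
    have i1a: "integrable lborel (\<lambda>t. of_bool (?B n t) * phi (t / sqrt (real n)) ^ n)"
      by (rule Bochner_Integration.integrable_bound[OF iphi]) auto
    have i1b: "integrable lborel (\<lambda>t. of_bool (?B n t) * (exp (- t\<^sup>2 / 2) * exp (edge_real n t)))"
    proof (rule integrable_poly_gauss[where a = "1/4" and C = 1 and n = 0])
      fix t
      show "norm (of_bool (?B n t) * (exp (- t\<^sup>2 / 2) * exp (edge_real n t))) \<le> 1 * (1 + \<bar>t\<bar>) ^ 0 * exp (- (1 / 4) * t\<^sup>2)"
      proof (cases "?B n t")
        case True
        then show ?thesis using edge_real_bound[OF elim True e(2,3)] by (simp flip: exp_add add: abs_le_iff)
      qed simp
    qed auto
    have iD1: "integrable lborel (?D1 n)"
      using Bochner_Integration.integrable_diff[OF i1a i1b] by (simp only: right_diff_distrib)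
    have iD3: "integrable lborel (?D3 n)"
      by (rule Bochner_Integration.integrable_bound[OF iphi]) auto
    have ic: "integrable lborel (\<lambda>t. iexp (- (t * x)) * of_real (D t))" if "integrable lborel D" for D :: "real \<Rightarrow> real"
    proof (rule Bochner_Integration.integrable_bound[OF that])
      show "(\<lambda>t. iexp (- (t * x)) * of_real (D t)) \<in> borel_measurable lborel"
        using borel_measurable_integrable[OF that] by measurable
      show "AE t in lborel. norm (iexp (- (t * x)) * of_real (D t)) \<le> norm (D t)"
        unfolding norm_mult norm_exp_i_times norm_of_real by (intro AE_I2) simp
    qed
    have pull: "(CLBINT t. iexp (- (t * x)) * of_real (?w n * D t)) = of_real (?w n) * (CLBINT t. iexp (- (t * x)) * of_real (D t))" for D
      by (subst integral_mult_right_zero[symmetric]) (simp only: of_real_mult mult_ac)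
    have "(CLBINT t. iexp (- (t * x)) * of_real (?D1 n t)) + (CLBINT t. iexp (- (t * x)) * ?D2 n t) + (CLBINT t. iexp (- (t * x)) * of_real (?D3 n t))
      = (CLBINT t. iexp (- (t * x)) * of_real (?D1 n t) + iexp (- (t * x)) * ?D2 n t + iexp (- (t * x)) * of_real (?D3 n t))"
      by (simp only: Bochner_Integration.integral_add Bochner_Integration.integrable_add ic[OF iD1] ic[OF iD3] iD2[OF elim])
    also have "\<dots> = (CLBINT t. iexp (- (t * x)) * (of_real (phi (t / sqrt (real n)) ^ n) - of_real (exp (- t\<^sup>2 / 2)) * edge_trunc \<kappa> n t))"
    proof (intro Bochner_Integration.integral_cong refl)
      fix t
      have "of_real (?D1 n t) + ?D2 n t + of_real (?D3 n t) = of_real (phi (t / sqrt (real n)) ^ n) - of_real (exp (- t\<^sup>2 / 2)) * edge_trunc \<kappa> n t"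
        by (cases "?B n t") (simp_all add: algebra_simps)
      then show "iexp (- (t * x)) * of_real (?D1 n t) + iexp (- (t * x)) * ?D2 n t + iexp (- (t * x)) * of_real (?D3 n t) = iexp (- (t * x)) * (of_real (phi (t / sqrt (real n)) ^ n) - of_real (exp (- t\<^sup>2 / 2)) * edge_trunc \<kappa> n t)"
        by (simp only: distrib_left[symmetric])
    qed
    finally show ?case unfolding pull distrib_left[symmetric] by (simp only:)
  qed
  ultimately show ?thesis by (simp add: filterlim_cong)
qed

end

section \<open>Expansion of the density\<close>

lemma Re_of_real_mult: "Re (of_real r * z) = r * Re z"
  by simp

lemma Re_fourier_of_real:
  fixes r :: "real \<Rightarrow> real"
  assumes "integrable lborel r"
  shows "Re (CLBINT t. iexp (- (t * x)) * of_real (r t)) = (\<integral>t. cos (t * x) * r t \<partial>lborel)"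
proof -
  have "integrable lborel (\<lambda>t. iexp (- (t * x)) * of_real (r t))"
  proof (rule Bochner_Integration.integrable_bound[OF assms])
    show "(\<lambda>t. iexp (- (t * x)) * of_real (r t)) \<in> borel_measurable lborel"
      using borel_measurable_integrable[OF assms] by measurable
    show "AE t in lborel. norm (iexp (- (t * x)) * of_real (r t)) \<le> norm (r t)"
      unfolding norm_mult norm_exp_i_times norm_of_real by (intro AE_I2) simp
  qed
  then have "Re (CLBINT t. iexp (- (t * x)) * of_real (r t)) = (\<integral>t. Re (iexp (- (t * x)) * of_real (r t)) \<partial>lborel)"
    by (rule integral_Re[symmetric])
  also have "\<dots> = (\<integral>t. cos (t * x) * r t \<partial>lborel)"
    by (intro Bochner_Integration.integral_cong) (auto simp: Re_exp)
  finally show ?thesis .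
qed

lemma gauss_char_factor:
  "exp (- \<i> * of_real (t * x) - of_real (t\<^sup>2 / 2)) = iexp (- (t * x)) * of_real (exp (- t\<^sup>2 / 2))"
  unfolding exp_of_real[symmetric] mult_exp_exp by (rule arg_cong[of _ _ exp]) simp

lemma integrable_gauss_poly_bdd:
  assumes "poly_bdd p"
  shows "integrable lborel (\<lambda>t. iexp (- (t * x)) * of_real (exp (- t\<^sup>2 / 2)) * p t)"
proof -
  obtain C n where C: "C \<ge> 0" "\<And>t. norm (p t) \<le> C * (1 + \<bar>t\<bar>) ^ n" using assms by (rule poly_bddE) blast
  have [measurable]: "p \<in> borel_measurable borel"
    by (intro borel_measurable_continuous_onI poly_bdd_continuous assms)
  show ?thesis
  proof (rule integrable_poly_gauss[where a = "1/2" and C = C and n = n])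
    fix t
    have "norm (iexp (- (t * x)) * of_real (exp (- t\<^sup>2 / 2)) * p t) = exp (- t\<^sup>2 / 2) * norm (p t)"
      unfolding norm_mult norm_exp_i_times norm_of_real by simp
    also have "\<dots> \<le> exp (- t\<^sup>2 / 2) * (C * (1 + \<bar>t\<bar>) ^ n)" by (intro mult_left_mono C) auto
    finally show "norm (iexp (- (t * x)) * of_real (exp (- t\<^sup>2 / 2)) * p t) \<le> C * (1 + \<bar>t\<bar>) ^ n * exp (- (1 / 2) * t\<^sup>2)"
      by (simp add: mult.commute)
  qed auto
qed

text \<open>Brings \<open>eta\<close> into the same inverse Fourier form as the Edgeworth terms, so
  that it can be treated as the term of index 0.\<close>

lemma eta_eq_fourier: "eta x = Re (1 / (2 * of_real pi) * (CLBINT t. iexp (- (t * x)) * of_real (exp (- t\<^sup>2 / 2))))"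
proof -
  have "integrable lborel (\<lambda>t::real. exp (- t\<^sup>2 / 2))" using integrable_gauss_moment[of 0 1] by simp
  from Re_fourier_of_real[OF this, of x]
  have "Re (CLBINT t. iexp (- (t * x)) * of_real (exp (- t\<^sup>2 / 2))) = (\<integral>t. cos (t * x) * exp (- t\<^sup>2 / 2) \<partial>lborel)" .
  also have "\<dots> = 2 * pi * eta x"
    unfolding eta_eq_trig_moment trig_moment_def integral_mult_right_zero[symmetric]
    by (intro Bochner_Integration.integral_cong) (auto simp: mult_ac)
  finally have "Re (CLBINT t. iexp (- (t * x)) * of_real (exp (- t\<^sup>2 / 2))) = 2 * pi * eta x" .
  moreover have "1 / (2 * of_real pi) = (of_real (1 / (2 * pi)) :: complex)" by simp
  ultimately show ?thesis by (simp only: Re_of_real_mult) simp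
qed

context heavy_tail_dist
begin

text \<open>Inverting \<open>edge_trunc\<close> term by term: h^0 gives \<open>eta\<close>, odd
  powers give 0, and h^(j - 2) gives \<open>eta\<close> times the coefficient for j. The index
  ranges match because an even j below \<alpha> \<le> 2 N + 2 is at most 2 N, and conversely 2 N <
  \<alpha>.\<close>

lemma edgeworth_sum_eq:
  assumes odd0: "\<And>l. odd l \<Longrightarrow> l \<le> 2 * N \<Longrightarrow> \<kappa> l = 0" and n: "n \<ge> 1"
  shows "edgeworth_sum \<kappa> \<alpha> n x = Re (1 / (2 * of_real pi) * (CLBINT t. iexp (- (t * x)) * (of_real (exp (- t\<^sup>2 / 2)) * edge_trunc \<kappa> n t)))"
proof -
  let ?h = "1 / sqrt (real n)"
  let ?c = "\<lambda>i t. poly.coeff (edge_exp \<kappa> (2 * N) t) i"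
  define E where "E = (\<lambda>i. Re (1 / (2 * of_real pi) * (CLBINT t. iexp (- (t * x)) * of_real (exp (- t\<^sup>2 / 2)) * ?c i t)))"
  have ic: "integrable lborel (\<lambda>t. iexp (- (t * x)) * of_real (exp (- t\<^sup>2 / 2)) * ?c i t)" for i
    by (intro integrable_gauss_poly_bdd poly_bdd_coeff_edge_exp)
  have eta_pos: "eta x > 0" by (simp add: eta_def)
  have N1: "0 < 2 * N" using N_pos by simp
  let ?J = "{j. 3 \<le> j \<and> real j < \<alpha> \<and> even j}"
  have J: "j \<le> 2 * N" if "j \<in> ?J" for j
  proof -
    have "real j < 2 * real N + 2" using that N by simp
    then have "j < 2 * N + 2" by linarith
    then show ?thesis using that by (auto elim!: evenE)
  qed
  have J': "real j < \<alpha>" if "j \<le> 2 * N" for j using that N by linarith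
  have E0: "E 0 = eta x" unfolding E_def coeff_edge_exp_0 mult_1_right eta_eq_fourier ..
  have Eodd: "E i = 0" if "odd i" for i
    unfolding E_def using coeff_edge_exp_odd[where \<kappa> = \<kappa> and m = "2 * N", OF odd0 that] by simp
  have EG: "E (j - 2) = eta x * edgeworth_G \<kappa> j x" if "j \<in> ?J" for j
  proof -
    have "3 \<le> j" using that by simp
    from edgeworth_xi_sum_eq[OF this J[OF that]] show ?thesis
      unfolding E_def edgeworth_G_def gauss_char_factor using eta_pos by (simp only:) simp
  qed
  have "Re (1 / (2 * of_real pi) * (CLBINT t. iexp (- (t * x)) * (of_real (exp (- t\<^sup>2 / 2)) * edge_trunc \<kappa> n t)))
     = Re (1 / (2 * of_real pi) * (CLBINT t. (\<Sum>i<2 * N. of_real (?h ^ i) * (iexp (- (t * x)) * of_real (exp (- t\<^sup>2 / 2)) * ?c i t))))"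
    unfolding edge_trunc_def sum_distrib_left by (simp only: of_real_power mult_ac)
  also have "\<dots> = Re (1 / (2 * of_real pi) * (\<Sum>i<2 * N. of_real (?h ^ i) * (CLBINT t. iexp (- (t * x)) * of_real (exp (- t\<^sup>2 / 2)) * ?c i t)))"
    using ic by (subst Bochner_Integration.integral_sum) (auto simp only: integral_mult_right_zero intro!: integrable_mult_right)
  also have "\<dots> = (\<Sum>i<2 * N. ?h ^ i * E i)"
  proof -
    have "1 / (2 * of_real pi) * (\<Sum>i<2 * N. of_real (?h ^ i) * (CLBINT t. iexp (- (t * x)) * of_real (exp (- t\<^sup>2 / 2)) * ?c i t))
      = (\<Sum>i<2 * N. of_real (?h ^ i) * (1 / (2 * of_real pi) * (CLBINT t. iexp (- (t * x)) * of_real (exp (- t\<^sup>2 / 2)) * ?c i t)))"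
      unfolding sum_distrib_left by (simp only: mult_ac)
    then show ?thesis unfolding E_def by (simp only: Re_sum Re_complex_of_real Re_of_real_mult)
  qed
  also have "\<dots> = ?h ^ 0 * E 0 + (\<Sum>i\<in>{1..<2 * N}. ?h ^ i * E i)"
    using N1 by (simp only: lessThan_atLeast0 sum.atLeast_Suc_lessThan One_nat_def)
  also have "(\<Sum>i\<in>{1..<2 * N}. ?h ^ i * E i) = (\<Sum>i\<in>{i. 1 \<le> i \<and> i < 2 * N \<and> even i}. ?h ^ i * E i)"
    by (rule sum.mono_neutral_right) (auto simp: Eodd)
  also have "\<dots> = (\<Sum>j\<in>?J. ?h ^ (j - 2) * E (j - 2))"
  proof (rule sum.reindex_bij_witness[of _ "\<lambda>j. j - 2" "\<lambda>i. i + 2"])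
    fix i assume "i \<in> {i. 1 \<le> i \<and> i < 2 * N \<and> even i}"
    then have "1 \<le> i" "i + 2 \<le> 2 * N" "even i" by (auto elim!: evenE)
    then show "i + 2 \<in> ?J" using J'[of "i + 2"] by auto
  next
    fix j assume j: "j \<in> ?J"
    then have "j \<noteq> 3" by auto
    then show "j - 2 \<in> {i. 1 \<le> i \<and> i < 2 * N \<and> even i}" "j - 2 + 2 = j" using j J[OF j] by auto
  qed auto
  also have "\<dots> = (\<Sum>j\<in>?J. eta x * (edgeworth_G \<kappa> j x / real n powr (real j / 2 - 1)))"
  proof (intro sum.cong refl)
    fix j assume j: "j \<in> ?J"
    have "real n powr (real j / 2 - 1) = (real n powr (1 / 2)) powr (real j - 2)"
      by (simp add: powr_powr diff_divide_distrib)
    also have "\<dots> = sqrt (real n) powr real (j - 2)" using j n by (simp add: powr_half_sqrt of_nat_diff)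
    also have "\<dots> = sqrt (real n) ^ (j - 2)" using n by (intro powr_realpow) auto
    finally show "?h ^ (j - 2) * E (j - 2) = eta x * (edgeworth_G \<kappa> j x / real n powr (real j / 2 - 1))"
      unfolding EG[OF j] by (simp add: power_one_over)
  qed
  finally show ?thesis
    unfolding edgeworth_sum_def E0 by (simp add: distrib_left sum_distrib_left)
qed

text \<open>Serves both cases, with \<Lambda> either L or zeta_L. The limit is computed with
  \<Lambda> at sqrt n; slow variation then exchanges this for the argument
  \<open>sv_arg n x\<close>, whose factor |x| is fixed.\<close>

lemma density_expansion:
  assumes sc: "slow_scale \<Lambda>" and lim: "((\<lambda>s. tail_rem (1 / s) * s powr \<alpha> / \<Lambda> s) \<longlongrightarrow> c) at_top"
    and small: "((\<lambda>s. s powr (\<alpha> - 2 * real N - 2) / \<Lambda> s) \<longlongrightarrow> 0) at_top"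
    and int: "integrable lborel phi" and char: "\<And>t. char D t = of_real (phi t)"
    and g: "\<And>n. n \<ge> 1 \<Longrightarrow> of_real (g n) = 1 / (2 * of_real pi) * (CLBINT t. iexp (- (t * x)) * of_real (phi (t / sqrt (real n)) ^ n))"
  shows "(\<lambda>n. g n - (edgeworth_sum (cumulant D) \<alpha> n x + \<Lambda> (sv_arg n x) / real n powr (\<alpha> / 2 - 1) * (c / (2 * pi) * gauss_cos \<alpha> x)))
     \<in> o(\<lambda>n. \<Lambda> (sv_arg n x) / real n powr (\<alpha> / 2 - 1))"
proof -
  have lim': "((\<lambda>s. log_rem (1 / s) * s powr \<alpha> / \<Lambda> s) \<longlongrightarrow> c) at_top"
    by (rule log_rem_limit[OF lim small])
  have cum: "of_real (cumulant D l) * (\<i> * of_real t) ^ l / fact l = (of_real (- log_coef l * t ^ l) :: complex)" if "l \<le> 2 * N" for l t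
    by (rule cumulant_eq[OF char log_rem_small[OF lim' sc] that])
  have odd0: "cumulant D l = 0" if "odd l" "l \<le> 2 * N" for l
    using cum[OF that(2), of 1] that(1) by (simp add: log_coef_def)
  let ?w = "\<lambda>n. real n powr (\<alpha> / 2 - 1)"
  let ?I = "\<lambda>n. CLBINT t. iexp (- (t * x)) * (of_real (phi (t / sqrt (real n)) ^ n) - of_real (exp (- t\<^sup>2 / 2)) * edge_trunc (cumulant D) n t)"
  have "(\<lambda>n. Re (1 / (2 * of_real pi) * (of_real (?w n / \<Lambda> (sqrt (real n))) * ?I n)))
     \<longlonglongrightarrow> Re (1 / (2 * of_real pi) * (CLBINT t. iexp (- (t * x)) * of_real (exp (- t\<^sup>2 / 2) * (c * \<bar>t\<bar> powr \<alpha>))))"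
    by (intro tendsto_Re tendsto_mult tendsto_const edgeworth_fourier_limit[OF sc lim' small int cum])
  also have "Re (1 / (2 * of_real pi) * (CLBINT t. iexp (- (t * x)) * of_real (exp (- t\<^sup>2 / 2) * (c * \<bar>t\<bar> powr \<alpha>)))) = c / (2 * pi) * gauss_cos \<alpha> x"
  proof -
    have i: "integrable lborel (\<lambda>t. exp (- t\<^sup>2 / 2) * (c * \<bar>t\<bar> powr \<alpha>))"
      using integrable_mult_right[OF integrable_gauss_cos[of \<alpha> 0 0], of c] alpha_pos by (simp add: mult_ac)
    have "Re (CLBINT t. iexp (- (t * x)) * of_real (exp (- t\<^sup>2 / 2) * (c * \<bar>t\<bar> powr \<alpha>))) = (\<integral>t. cos (t * x) * (exp (- t\<^sup>2 / 2) * (c * \<bar>t\<bar> powr \<alpha>)) \<partial>lborel)"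
      by (rule Re_fourier_of_real[OF i])
    also have "\<dots> = c * gauss_cos \<alpha> x"
      unfolding gauss_cos_def integral_mult_right_zero[symmetric] by (intro Bochner_Integration.integral_cong) (auto simp: mult_ac)
    finally have r: "Re (CLBINT t. iexp (- (t * x)) * of_real (exp (- t\<^sup>2 / 2) * (c * \<bar>t\<bar> powr \<alpha>))) = c * gauss_cos \<alpha> x" .
    have "1 / (2 * of_real pi) = (of_real (1 / (2 * pi)) :: complex)" by simp
    then show ?thesis by (simp only: Re_of_real_mult r) simp
  qed
  finally have L1: "(\<lambda>n. Re (1 / (2 * of_real pi) * (of_real (?w n / \<Lambda> (sqrt (real n))) * ?I n))) \<longlonglongrightarrow> c / (2 * pi) * gauss_cos \<alpha> x" .
  have eq1: "Re (1 / (2 * of_real pi) * (of_real (?w n / \<Lambda> (sqrt (real n))) * ?I n)) = ?w n / \<Lambda> (sqrt (real n)) * (g n - edgeworth_sum (cumulant D) \<alpha> n x)"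
    if n: "n \<ge> 1" for n
  proof -
    have i1: "integrable lborel (\<lambda>t. iexp (- (t * x)) * of_real (phi (t / sqrt (real n)) ^ n))"
    proof (rule Bochner_Integration.integrable_bound[OF integrable_phi_power[OF int n]])
      show "AE t in lborel. norm (iexp (- (t * x)) * of_real (phi (t / sqrt (real n)) ^ n)) \<le> norm (phi (t / sqrt (real n)) ^ n)"
        unfolding norm_mult norm_exp_i_times norm_of_real by (intro AE_I2) simp
    qed measurable
    have "poly_bdd (edge_trunc (cumulant D) n)"
      unfolding edge_trunc_def[abs_def] by (intro poly_bdd_sum poly_bdd_mult poly_bdd_coeff_edge_exp poly_bdd_const)
    from integrable_gauss_poly_bdd[OF this, of x]
    have i2: "integrable lborel (\<lambda>t. iexp (- (t * x)) * (of_real (exp (- t\<^sup>2 / 2)) * edge_trunc (cumulant D) n t))"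
      by (simp only: mult.assoc)
    have "?I n = (CLBINT t. iexp (- (t * x)) * of_real (phi (t / sqrt (real n)) ^ n)) - (CLBINT t. iexp (- (t * x)) * (of_real (exp (- t\<^sup>2 / 2)) * edge_trunc (cumulant D) n t))"
      unfolding right_diff_distrib by (rule Bochner_Integration.integral_diff[OF i1 i2])
    moreover have "edgeworth_sum (cumulant D) \<alpha> n x = Re (1 / (2 * of_real pi) * (CLBINT t. iexp (- (t * x)) * (of_real (exp (- t\<^sup>2 / 2)) * edge_trunc (cumulant D) n t)))"
      by (rule edgeworth_sum_eq[OF _ n]) (rule odd0)
    ultimately have "Re (1 / (2 * of_real pi) * ?I n) = Re (of_real (g n)) - edgeworth_sum (cumulant D) \<alpha> n x"
      unfolding g[OF n] by (simp only: right_diff_distrib minus_complex.sel)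
    moreover have "1 / (2 * of_real pi) * (of_real (?w n / \<Lambda> (sqrt (real n))) * ?I n) = of_real (?w n / \<Lambda> (sqrt (real n))) * (1 / (2 * of_real pi) * ?I n)"
      by (simp only: mult_ac)
    ultimately show ?thesis by (simp only: Re_of_real_mult Re_complex_of_real)
  qed
  have sq: "filterlim (\<lambda>n. sqrt (real n)) at_top sequentially" by real_asymp
  have pos: "eventually (\<lambda>s. 0 < \<Lambda> s) at_top"
    using slow_scale_potter[OF sc zero_less_one] by (metis eventually_at_top_linorder)
  have ev1: "\<forall>\<^sub>F n in sequentially. 0 < \<Lambda> (sqrt (real n))" using eventually_compose_filterlim[OF pos sq] .
  have sva: "filterlim (\<lambda>n. sv_arg n x) at_top sequentially"
  proof (cases "x = 0")
    case False
    have "filterlim (\<lambda>n. \<bar>x\<bar> * sqrt (real n)) at_top sequentially"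
      by (rule filterlim_tendsto_pos_mult_at_top[OF tendsto_const _ sq]) (use False in simp)
    then show ?thesis using False by (simp add: sv_arg_def mult.commute)
  qed (simp add: sv_arg_def sq)
  have ev2: "\<forall>\<^sub>F n in sequentially. 0 < \<Lambda> (sv_arg n x)" using eventually_compose_filterlim[OF pos sva] .
  have ratio: "(\<lambda>n. \<Lambda> (sv_arg n x) / \<Lambda> (sqrt (real n))) \<longlonglongrightarrow> 1"
  proof (cases "x = 0")
    case True
    show ?thesis by (rule tendsto_eventually, rule eventually_mono[OF ev1]) (simp add: True sv_arg_def)
  next
    case False
    have "slowly_varying \<Lambda>" using sc by (simp add: slow_scale_def)
    then have "((\<lambda>s. \<Lambda> (\<bar>x\<bar> * s) / \<Lambda> s) \<longlongrightarrow> 1) at_top" using False by (simp add: slowly_varying_def)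
    from filterlim_compose[OF this sq] show ?thesis using False by (simp add: sv_arg_def mult.commute)
  qed
  have "(\<lambda>n. Re (1 / (2 * of_real pi) * (of_real (?w n / \<Lambda> (sqrt (real n))) * ?I n)) / (\<Lambda> (sv_arg n x) / \<Lambda> (sqrt (real n))) - c / (2 * pi) * gauss_cos \<alpha> x)
     \<longlonglongrightarrow> c / (2 * pi) * gauss_cos \<alpha> x / 1 - c / (2 * pi) * gauss_cos \<alpha> x"
    by (intro tendsto_diff tendsto_divide L1 ratio tendsto_const) simp
  then have T: "(\<lambda>n. Re (1 / (2 * of_real pi) * (of_real (?w n / \<Lambda> (sqrt (real n))) * ?I n)) / (\<Lambda> (sv_arg n x) / \<Lambda> (sqrt (real n))) - c / (2 * pi) * gauss_cos \<alpha> x) \<longlonglongrightarrow> 0"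
    by simp
  show ?thesis
  proof (rule smalloI_tendsto)
    show "\<forall>\<^sub>F n in sequentially. \<Lambda> (sv_arg n x) / ?w n \<noteq> 0"
      using ev2 eventually_ge_at_top[of 1] by eventually_elim simp
    show "(\<lambda>n. (g n - (edgeworth_sum (cumulant D) \<alpha> n x + \<Lambda> (sv_arg n x) / ?w n * (c / (2 * pi) * gauss_cos \<alpha> x))) / (\<Lambda> (sv_arg n x) / ?w n)) \<longlonglongrightarrow> 0"
    proof (rule Lim_transform_eventually[OF T])
      show "\<forall>\<^sub>F n in sequentially. Re (1 / (2 * of_real pi) * (of_real (?w n / \<Lambda> (sqrt (real n))) * ?I n)) / (\<Lambda> (sv_arg n x) / \<Lambda> (sqrt (real n))) - c / (2 * pi) * gauss_cos \<alpha> x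
         = (g n - (edgeworth_sum (cumulant D) \<alpha> n x + \<Lambda> (sv_arg n x) / ?w n * (c / (2 * pi) * gauss_cos \<alpha> x))) / (\<Lambda> (sv_arg n x) / ?w n)"
        using ev1 ev2 eventually_ge_at_top[of 1]
      proof eventually_elim
        case (elim n)
        have "w / A * d / (B / A) - G = (d - B / w * G) / (B / w)" if "w > 0" "A > 0" "B > 0" for w A B d G :: real
          using that by (simp add: field_simps)
        from this[of "?w n" "\<Lambda> (sqrt (real n))" "\<Lambda> (sv_arg n x)" "g n - edgeworth_sum (cumulant D) \<alpha> n x" "c / (2 * pi) * gauss_cos \<alpha> x"]
        show ?case unfolding eq1[OF elim(3)] using elim by (simp add: diff_diff_eq)
      qed
    qed
  qed
qed

end

section \<open>From the random variables to the characteristic function\<close>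

lemma integral_odd_real:
  fixes h :: "real \<Rightarrow> real"
  assumes "\<And>x. h (- x) = - h x"
  shows "(\<integral>x. h x \<partial>lborel) = 0"
proof -
  have "(\<integral>x. h x \<partial>lborel) = (\<integral>x. h (- x) \<partial>lborel)"
    using lborel_integral_real_affine[of "-1" h 0] by simp
  also have "\<dots> = - (\<integral>x. h x \<partial>lborel)"
    unfolding assms by (rule Bochner_Integration.integral_minus)
  finally show ?thesis by linarith
qed

context prob_space
begin

lemma distributed_distr_borel_eq_density:
  assumes "distributed M lborel Y (\<lambda>x. ennreal (h x))"
  shows "distr M borel Y = density lborel (\<lambda>x. ennreal (h x))"
  using distributed_distr_eq_density[OF assms] by (simp cong: distr_cong)

lemma char_distr_even_density:
  assumes d: "distributed M lborel Y (\<lambda>x. ennreal (h x))" and nn: "\<And>x. 0 \<le> h x"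
    and m [measurable]: "h \<in> borel_measurable borel" and even: "\<And>x. h (- x) = h x"
    and int: "integrable lborel h"
  shows "char (distr M borel Y) t = of_real (\<integral>x. h x * cos (t * x) \<partial>lborel)"
proof -
  have "char (distr M borel Y) t = (CLINT x|lborel. h x *\<^sub>R iexp (t * x))"
    unfolding char_def distributed_distr_borel_eq_density[OF d]
    by (subst integral_density) (auto simp: nn)
  moreover have i: "integrable lborel (\<lambda>x. h x *\<^sub>R iexp (t * x))"
    by (rule Bochner_Integration.integrable_bound[OF int]) (auto simp del: of_real_mult)
  have "Re (CLINT x|lborel. h x *\<^sub>R iexp (t * x)) = (\<integral>x. h x * cos (t * x) \<partial>lborel)"
    unfolding integral_Re[OF i, symmetric] by (intro Bochner_Integration.integral_cong) (auto simp: Re_exp)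
  moreover have "Im (CLINT x|lborel. h x *\<^sub>R iexp (t * x)) = 0"
  proof -
    have "Im (CLINT x|lborel. h x *\<^sub>R iexp (t * x)) = (\<integral>x. h x * sin (t * x) \<partial>lborel)"
      unfolding integral_Im[OF i, symmetric] by (intro Bochner_Integration.integral_cong) (auto simp: Im_exp)
    also have "(\<integral>x. h x * sin (t * x) \<partial>lborel) = 0"
      by (rule integral_odd_real) (simp add: even)
    finally show ?thesis .
  qed
  ultimately show ?thesis by (simp add: complex_eq_iff)
qed

lemma char_distr_normalized_sum:
  assumes indep: "indep_vars (\<lambda>_. borel) X {1..}"
    and char: "\<And>k t. 1 \<le> k \<Longrightarrow> char (distr M borel (X k)) t = of_real (p t)"
  shows "char (distr M borel (\<lambda>\<omega>. (\<Sum>k=1..n. X k \<omega>) / sqrt (real n))) t = of_real (p (t / sqrt (real n)) ^ n)"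
proof -
  have [measurable]: "random_variable borel (X k)" if "k \<in> {1..n}" for k
    using indep that by (auto simp: indep_vars_def)
  have ind: "indep_vars (\<lambda>_. borel) X {1..n}" by (rule indep_vars_subset[OF indep]) auto
  have "char (distr M borel (\<lambda>\<omega>. (\<Sum>k=1..n. X k \<omega>) / sqrt (real n))) t = char (distr M borel (\<lambda>\<omega>. \<Sum>k=1..n. X k \<omega>)) (t / sqrt (real n))"
    unfolding char_def by (subst (1 2) integral_distr) auto
  also have "\<dots> = (\<Prod>k=1..n. char (distr M borel (X k)) (t / sqrt (real n)))"
    by (rule char_distr_sum[OF ind])
  also have "\<dots> = (\<Prod>k=1..n. of_real (p (t / sqrt (real n))))"
    by (intro prod.cong) (auto simp: char)
  finally show ?thesis by simp
qed

end

lemma even_integer_iff: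
  assumes "2 * real N < \<alpha>" "\<alpha> \<le> 2 * real N + 2"
  shows "even_integer \<alpha> \<longleftrightarrow> \<alpha> = 2 * real N + 2"
proof
  assume "even_integer \<alpha>"
  then obtain m :: int where m: "even m" "\<alpha> = of_int m" by (auto simp: even_integer_def)
  then obtain j where j: "m = 2 * j" by (auto elim: evenE)
  have "real_of_int (2 * int N) < of_int m" "real_of_int m \<le> of_int (2 * int N + 2)" using assms m by auto
  then have "2 * int N < m" "m \<le> 2 * int N + 2" by (simp_all only: of_int_less_iff of_int_le_iff)
  then have "m = 2 * int N + 2" using j by presburger
  then show "\<alpha> = 2 * real N + 2" using m by simp
next
  assume "\<alpha> = 2 * real N + 2"
  then show "even_integer \<alpha>" unfolding even_integer_def by (intro exI[of _ "2 * int N + 2"]) simp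
qed

text \<open>For even \<alpha> the divergence of zeta_L expresses that the moment of order \<alpha>
  is infinite. With a finite limit of zeta_L, the bounded errors in
  \<open>tail_integral_even\<close> and \<open>tail_rem_even\<close> would be of the same order as
  zeta_L itself, and zeta_L would not describe the correction.\<close>

theorem theorem2:
  fixes M :: "'a measure" and X :: "nat \<Rightarrow> 'a \<Rightarrow> real" and \<alpha> :: real
    and L f :: "real \<Rightarrow> real" and g :: "nat \<Rightarrow> real \<Rightarrow> real"
  assumes alpha: "\<alpha> > 2"
    and prob: "prob_space M"
    and slowly_varying: "slowly_varying L"
    and bounded: "bounded (L ` {0..})"
    and differentiable: "\<And>u. u > 0 \<Longrightarrow> L differentiable (at u)"
    and deriv: "deriv L \<in> o[at_top](\<lambda>u. L u / u)"
    and f: "\<And>x. f x = (1 + \<bar>x\<bar>) powr (- (\<alpha> + 1)) * L \<bar>x\<bar>"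
    and f_nonneg: "\<And>x. f x \<ge> 0"
    and indep: "prob_space.indep_vars M (\<lambda>_. borel) X {1..}"
    and density: "\<And>k. k \<ge> 1 \<Longrightarrow> distributed M lborel (X k) (\<lambda>x. ennreal (f x))"
    and unit_variance: "\<And>k. k \<ge> 1 \<Longrightarrow> prob_space.variance M (X k) = 1"
    and char_integrable: "integrable lborel (char (distr M borel (X 1)))"
    and zeta_diverges: "even_integer \<alpha> \<Longrightarrow> filterlim (zeta_sv L) at_top at_top"
    and sum_density: "\<And>n. n \<ge> 1 \<Longrightarrow>
           continuous_density M (\<lambda>\<omega>. (\<Sum>k=1..n. X k \<omega>) / sqrt (real n)) (g n)"
  shows "\<forall>x. if even_integer \<alpha>
     then (\<lambda>n. g n x
             - (edgeworth_sum (cumulant (distr M borel (X 1))) \<alpha> n x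
                + zeta_sv L (sv_arg n x) / real n powr (\<alpha> / 2 - 1) * heavy_G \<alpha> x))
          \<in> o(\<lambda>n. zeta_sv L (sv_arg n x) / real n powr (\<alpha> / 2 - 1))
     else (\<lambda>n. g n x
             - (edgeworth_sum (cumulant (distr M borel (X 1))) \<alpha> n x
                + L (sv_arg n x) / real n powr (\<alpha> / 2 - 1) * heavy_G \<alpha> x))
          \<in> o(\<lambda>n. L (sv_arg n x) / real n powr (\<alpha> / 2 - 1))"
proof
  fix x :: real
  interpret prob_space M by (rule prob)
  have L_nonneg: "0 \<le> L u" if "0 \<le> u" for u
    using f_nonneg[of u] f[of u] that by (auto simp: zero_le_mult_iff)
  obtain K where "\<forall>y\<in>L ` {0..}. norm y \<le> K" using bounded unfolding bounded_iff by blast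
  then have K: "L u \<le> K" if "0 \<le> u" for u
    using that by (auto intro: order_trans[OF abs_ge_self])
  \<comment> \<open>The ceiling minus 1, rather than the floor: an even integer \<alpha> must give N
    = \<alpha> / 2 - 1, so that 2 N < \<alpha> is strict.\<close>
  define N where "N = nat (\<lceil>\<alpha> / 2\<rceil> - 1)"
  have "\<lceil>\<alpha> / 2\<rceil> \<ge> 2" using alpha by linarith
  then have rN: "real N = of_int \<lceil>\<alpha> / 2\<rceil> - 1" and N1: "1 \<le> N" unfolding N_def by linarith+
  have N: "2 * real N < \<alpha>" "\<alpha> \<le> 2 * real N + 2"
  proof -
    have "of_int \<lceil>\<alpha> / 2\<rceil> - 1 < \<alpha> / 2" using ceiling_correct[of "\<alpha> / 2"] by blast
    then show "2 * real N < \<alpha>" using rN by argo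
    have "\<alpha> / 2 \<le> of_int \<lceil>\<alpha> / 2\<rceil>" by (rule le_of_int_ceiling)
    then show "\<alpha> \<le> 2 * real N + 2" using rN by argo
  qed
  have X1: "distributed M lborel (X 1) (\<lambda>x. ennreal (f x))" by (rule density) simp
  \<comment> \<open>\<open>distributed\<close> provides measurability of the extended nonnegative
    density; for f \<ge> 0 it can be carried back by \<open>enn2real\<close>.\<close>
  have fm [measurable]: "f \<in> borel_measurable borel"
  proof -
    have "(\<lambda>x. ennreal (f x)) \<in> borel_measurable borel"
      using distributed_borel_measurable[OF X1] by simp
    then have "(\<lambda>x. enn2real (ennreal (f x))) \<in> borel_measurable borel" by measurable
    then show ?thesis using f_nonneg by simp
  qed
  interpret heavy_tail \<alpha> K L f N
    by unfold_locales (use N L_nonneg K f fm in auto)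
  have law: "(\<integral>y. f y * h y \<partial>lborel) = expectation (\<lambda>\<omega>. h (X 1 \<omega>))" if "h \<in> borel_measurable borel" for h :: "real \<Rightarrow> real"
    by (rule distributed_integral[OF X1]) (use that f_nonneg in auto)
  have mass: "(\<integral>y. f y \<partial>lborel) = 1"
    using law[of "\<lambda>_. 1"] by (simp add: prob_space)
  \<comment> \<open>By symmetry the mean is 0, so the unit variance is a statement about the second
    moment.\<close>
  have mean: "expectation (X 1) = 0"
  proof -
    have "(\<integral>y. f y * y \<partial>lborel) = 0" by (rule integral_odd_real) (simp add: f_even)
    then show ?thesis using law[of "\<lambda>y. y"] by simp
  qed
  have second: "(\<integral>y. y\<^sup>2 * f y \<partial>lborel) = 1"
    using law[of "\<lambda>y. y\<^sup>2"] unit_variance[of 1] by (simp add: mean[unfolded One_nat_def] mult.commute)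
  interpret heavy_tail_dist \<alpha> K L f N
    by unfold_locales (use N1 mass second in auto)
  have char: "char (distr M borel (X k)) t = of_real (phi t)" if "1 \<le> k" for k t
    unfolding phi_integral
    by (rule char_distr_even_density[OF density[OF that]]) (use f_nonneg f_even integrable_f fm in auto)
  have int: "integrable lborel phi"
  proof -
    have "char (distr M borel (X 1)) = (\<lambda>t. of_real (phi t))" by (intro ext char) simp
    with char_integrable have "integrable lborel (\<lambda>t. of_real (phi t) :: complex)" by simp
    from integrable_Re[OF this] show ?thesis by simp
  qed
  have g: "of_real (g n x) = 1 / (2 * of_real pi) * (CLBINT t. iexp (- (t * x)) * of_real (phi (t / sqrt (real n)) ^ n))"
    if n: "n \<ge> 1" for n
  proof -
    let ?Y = "\<lambda>\<omega>. (\<Sum>k=1..n. X k \<omega>) / sqrt (real n)"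
    have cd: "continuous_on UNIV (g n)" "\<And>y. 0 \<le> g n y" "distributed M lborel ?Y (\<lambda>y. ennreal (g n y))"
      using sum_density[OF n] by (auto simp: continuous_density_def)
    have rv: "?Y \<in> borel_measurable M" using distributed_measurable[OF cd(3)] by simp
    interpret D: real_distribution "distr M borel ?Y" by (rule real_distribution_distr[OF rv])
    have ch: "char (distr M borel ?Y) = (\<lambda>t. of_real (phi (t / sqrt (real n)) ^ n))"
      by (intro ext char_distr_normalized_sum[OF indep char])
    have "integrable lborel (char (distr M borel ?Y))"
      unfolding ch using integrable_phi_power[OF int n] by (rule integrable_of_real)
    from D.fourier_inversion_density[OF this distributed_distr_borel_eq_density[OF cd(3)] cd(1,2), of x]
    show ?thesis unfolding ch by simp
  qed
  have Lcont: "isCont L u" if "u > 0" for u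
    using differentiable[OF that] by (rule differentiable_imp_continuous_within)
  have hG: "heavy_G \<alpha> x = heavy_coeff \<alpha> / (2 * pi) * gauss_cos \<alpha> x" by (rule heavy_G_eq[OF alpha])
  show "if even_integer \<alpha>
     then (\<lambda>n. g n x
             - (edgeworth_sum (cumulant (distr M borel (X 1))) \<alpha> n x
                + zeta_sv L (sv_arg n x) / real n powr (\<alpha> / 2 - 1) * heavy_G \<alpha> x))
          \<in> o(\<lambda>n. zeta_sv L (sv_arg n x) / real n powr (\<alpha> / 2 - 1))
     else (\<lambda>n. g n x
             - (edgeworth_sum (cumulant (distr M borel (X 1))) \<alpha> n x
                + L (sv_arg n x) / real n powr (\<alpha> / 2 - 1) * heavy_G \<alpha> x))
          \<in> o(\<lambda>n. L (sv_arg n x) / real n powr (\<alpha> / 2 - 1))"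
  proof (cases "even_integer \<alpha>")
    case True
    have a: "\<alpha> = 2 * real N + 2" using True even_integer_iff[OF N] by simp
    have lim: "filterlim (zeta_sv L) at_top at_top" by (rule zeta_diverges[OF True])
    have sc: "slow_scale (zeta_sv L)" by (rule slow_scale_zeta_sv[OF Lcont L_nonneg K lim])
    have "\<alpha> = of_int (2 * int N + 2)" using a by simp
    then have "\<lfloor>\<alpha>\<rfloor> = 2 * int N + 2" by (simp only: floor_of_int)
    then have "nat \<lfloor>\<alpha>\<rfloor> div 2 = Suc N" by simp
    then have hc: "heavy_coeff \<alpha> = (-1) ^ Suc N * 2 / Gamma (\<alpha> + 1)"
      using True by (simp add: heavy_coeff_def)
    \<comment> \<open>The exponent is 0 at an even \<alpha>, so the divergence of zeta_L alone gives
      the limit. In the other case the exponent is negative and outweighs 1 / L.\<close>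
    have small: "((\<lambda>s. s powr (\<alpha> - 2 * real N - 2) / zeta_sv L s) \<longlongrightarrow> 0) at_top"
    proof -
      have "((\<lambda>s. 1 / zeta_sv L s) \<longlongrightarrow> 0) at_top"
        by (intro real_tendsto_divide_at_top[OF tendsto_const] lim)
      moreover have "\<forall>\<^sub>F s in at_top. 1 / zeta_sv L s = s powr (\<alpha> - 2 * real N - 2) / zeta_sv L s"
        using eventually_gt_at_top[of 0] by eventually_elim (simp add: a)
      ultimately show ?thesis by (rule Lim_transform_eventually)
    qed
    have "(\<lambda>n. g n x - (edgeworth_sum (cumulant (distr M borel (X 1))) \<alpha> n x
        + zeta_sv L (sv_arg n x) / real n powr (\<alpha> / 2 - 1) * (heavy_coeff \<alpha> / (2 * pi) * gauss_cos \<alpha> x)))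
      \<in> o(\<lambda>n. zeta_sv L (sv_arg n x) / real n powr (\<alpha> / 2 - 1))"
      unfolding hc by (rule density_expansion[OF sc tail_rem_even[OF a lim] small int char g]) simp_all
    with True show ?thesis by (simp add: hG)
  next
    case False
    have a: "\<alpha> \<noteq> 2 * real N + 2" using False even_integer_iff[OF N] by simp
    have sc: "slow_scale L"
      by (rule slow_scale_of_little_o_deriv[OF slowly_varying L_nonneg K differentiable deriv])
    have hc: "heavy_coeff \<alpha> = - pi / (sin (pi * \<alpha> / 2) * Gamma (\<alpha> + 1))"
      using False by (simp add: heavy_coeff_def)
    have small: "((\<lambda>s. s powr (\<alpha> - 2 * real N - 2) / L s) \<longlongrightarrow> 0) at_top"
      using slow_scale_powr_tendsto_0[OF sc, of "2 * real N + 2 - \<alpha>"] a N(2) by (simp add: algebra_simps)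
    have "(\<lambda>n. g n x - (edgeworth_sum (cumulant (distr M borel (X 1))) \<alpha> n x
        + L (sv_arg n x) / real n powr (\<alpha> / 2 - 1) * (heavy_coeff \<alpha> / (2 * pi) * gauss_cos \<alpha> x)))
      \<in> o(\<lambda>n. L (sv_arg n x) / real n powr (\<alpha> / 2 - 1))"
      unfolding hc by (rule density_expansion[OF sc tail_rem_noneven[OF a sc] small int char g]) simp_all
    with False show ?thesis by (simp add: hG)
  qed
qed

end
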